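(* The weak operator topology closed ideal of $\mathrm{Alg}\,\mathcal{L}$ generated by the finite rank operators in $\mathrm{Alg}\,\mathcal{L}$ is the space $$\mathcal{I}=P_+B(L^2(\mathbb{R}))(I-Q_+).$$ Moreover, each operator of rank $n$ in $\mathrm{Alg}\,\mathcal{L}$ is decomposable as a sum of $n$ rank one operators in $\mathrm{Alg}\,\mathcal{L}$.
   Context: $H^2(\mathbb{R})\subset L^2(\mathbb{R})$ is the Hardy space of the upper half plane. $\mathcal{L}$ is the lattice of closed subspaces of $L^2(\mathbb{R})$ $$\mathcal{L}=\{0\}\cup\{L^2(-\alpha,\infty):\alpha\ge0\}\cup\{e^{i\beta x}H^2(\mathbb{R}):\beta\ge0\}\cup\{L^2(\mathbb{R})\},$$ and $\mathrm{Alg}\,\mathcal{L}$ is the algebra of all bounded operators on $L^2(\mathbb{R})$ that leave every subspace in $\mathcal{L}$ invariant. $P_+$ and $Q_+$ are the orthogonal projections of $L^2(\mathbb{R})$ onto $L^2(\mathbb{R}_+)$ and $H^2(\mathbb{R})$ respectively, and $B(L^2(\mathbb{R}))$ is the algebra of all bounded operators. *)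

theory Defs
  imports "HOL-Complex_Analysis.Complex_Analysis"
begin

section \<open>The Hilbert space \<open>L\<^sup>2(\<real>)\<close>\<close>

definition square_integrable :: "(real \<Rightarrow> complex) \<Rightarrow> bool" where
  "square_integrable f \<longleftrightarrow>
     f \<in> borel_measurable lborel \<and> integrable lborel (\<lambda>x. (cmod (f x))\<^sup>2)"

definition L2_rel :: "(real \<Rightarrow> complex) \<Rightarrow> (real \<Rightarrow> complex) \<Rightarrow> bool" where
  "L2_rel f g \<longleftrightarrow> square_integrable f \<and> square_integrable g \<and> (AE x in lborel. f x = g x)"

lemma square_integrable_0: "square_integrable (\<lambda>_. 0)"
  by (simp add: square_integrable_def)

lemma square_integrable_add:
  assumes "square_integrable f" "square_integrable g"
  shows "square_integrable (\<lambda>x. f x + g x)"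
proof -
  have [measurable]: "f \<in> borel_measurable lborel" "g \<in> borel_measurable lborel"
    using assms by (auto simp: square_integrable_def)
  have bd: "(cmod (f x + g x))\<^sup>2 \<le> 2 * (cmod (f x))\<^sup>2 + 2 * (cmod (g x))\<^sup>2" for x
  proof -
    have "(cmod (f x + g x))\<^sup>2 \<le> (cmod (f x) + cmod (g x))\<^sup>2"
      by (intro power_mono norm_triangle_ineq) auto
    also have "\<dots> \<le> 2 * (cmod (f x))\<^sup>2 + 2 * (cmod (g x))\<^sup>2"
      using sum_squares_bound[of "cmod (f x)" "cmod (g x)"] by (simp add: power2_sum)
    finally show ?thesis .
  qed
  have "integrable lborel (\<lambda>x. 2 * (cmod (f x))\<^sup>2 + 2 * (cmod (g x))\<^sup>2)"
    using assms by (auto simp: square_integrable_def)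
  then have "integrable lborel (\<lambda>x. (cmod (f x + g x))\<^sup>2)"
    by (rule Bochner_Integration.integrable_bound) (use bd in auto)
  then show ?thesis by (simp add: square_integrable_def)
qed

lemma square_integrable_cmult:
  assumes "square_integrable f"
  shows "square_integrable (\<lambda>x. c * f x)"
  using assms by (auto simp: square_integrable_def norm_mult power_mult_distrib)

lemma square_integrable_unimodular_mult:
  assumes "square_integrable f" "u \<in> borel_measurable lborel" "\<And>x. cmod (u x) = 1"
  shows "square_integrable (\<lambda>x. u x * f x)"
  using assms by (auto simp: square_integrable_def norm_mult)

lemma square_integrable_inner_integrable:
  assumes "square_integrable f" "square_integrable g"
  shows "integrable lborel (\<lambda>x. f x * cnj (g x))"
proof -
  have [measurable]: "f \<in> borel_measurable lborel" "g \<in> borel_measurable lborel"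
    using assms by (auto simp: square_integrable_def)
  have bd: "cmod (f x * cnj (g x)) \<le> (cmod (f x))\<^sup>2 + (cmod (g x))\<^sup>2" for x
  proof -
    have "0 \<le> cmod (f x) * cmod (g x)" by simp
    with sum_squares_bound[of "cmod (f x)" "cmod (g x)"] show ?thesis
      unfolding norm_mult complex_mod_cnj by linarith
  qed
  have "cnj \<in> borel_measurable borel"
    by (intro borel_measurable_continuous_onI continuous_intros)
  then have [measurable]: "(\<lambda>x. cnj (g x)) \<in> borel_measurable lborel"
    by (rule measurable_compose[rotated]) measurable
  have "integrable lborel (\<lambda>x. (cmod (f x))\<^sup>2 + (cmod (g x))\<^sup>2)"
    using assms by (auto simp: square_integrable_def)
  then show ?thesis
    by (rule Bochner_Integration.integrable_bound) (use bd in auto)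
qed

quotient_type L2R = "real \<Rightarrow> complex" / partial: L2_rel
proof (rule part_equivpI)
  show "\<exists>f. L2_rel f f"
    by (rule exI[of _ "\<lambda>_. 0"]) (simp add: L2_rel_def square_integrable_0)
  show "symp L2_rel" by (auto simp: symp_def L2_rel_def)
  show "transp L2_rel" by (auto simp: transp_def L2_rel_def)
qed

text \<open>Inner products are linear in the first argument.\<close>

lift_definition L2_cinner :: "L2R \<Rightarrow> L2R \<Rightarrow> complex" is
  "\<lambda>f g. (LINT x|lborel. f x * cnj (g x))"
proof -
  fix f f' g g' assume *: "L2_rel f f'" "L2_rel g g'"
  then have "AE x in lborel. f x = f' x" "AE x in lborel. g x = g' x"
    by (auto simp: L2_rel_def)
  then have "AE x in lborel. f x * cnj (g x) = f' x * cnj (g' x)" by auto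
  moreover have "integrable lborel (\<lambda>x. f x * cnj (g x))" "integrable lborel (\<lambda>x. f' x * cnj (g' x))"
    using * by (auto simp: L2_rel_def intro!: square_integrable_inner_integrable)
  ultimately show "(LINT x|lborel. f x * cnj (g x)) = (LINT x|lborel. f' x * cnj (g' x))"
    by (intro integral_cong_AE) auto
qed

lift_definition L2_scaleC :: "complex \<Rightarrow> L2R \<Rightarrow> L2R" is "\<lambda>c f x. c * f x"
  by (auto simp: L2_rel_def square_integrable_cmult)

instantiation L2R :: real_vector
begin

lift_definition zero_L2R :: L2R is "\<lambda>_. 0"
  by (simp add: L2_rel_def square_integrable_0)

lift_definition plus_L2R :: "L2R \<Rightarrow> L2R \<Rightarrow> L2R" is "\<lambda>f g x. f x + g x"
  by (auto simp: L2_rel_def square_integrable_add)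

definition uminus_L2R :: "L2R \<Rightarrow> L2R" where "uminus_L2R f = L2_scaleC (-1) f"

definition minus_L2R :: "L2R \<Rightarrow> L2R \<Rightarrow> L2R" where "minus_L2R f g = f + - g"

definition scaleR_L2R :: "real \<Rightarrow> L2R \<Rightarrow> L2R" where
  "scaleR_L2R r f = L2_scaleC (complex_of_real r) f"

instance
proof
  fix a b c :: L2R and r s :: real
  show "a + b + c = a + (b + c)"
    by transfer (auto simp: L2_rel_def square_integrable_add add.assoc)
  show "a + b = b + a"
    by transfer (auto simp: L2_rel_def square_integrable_add add.commute)
  show "0 + a = a"
    by transfer (auto simp: L2_rel_def)
  show "- a + a = 0" unfolding uminus_L2R_def
    by transfer (auto simp: L2_rel_def square_integrable_0)
  show "a - b = a + - b" by (simp add: minus_L2R_def)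
  show "r *\<^sub>R (a + b) = r *\<^sub>R a + r *\<^sub>R b" unfolding scaleR_L2R_def
    by transfer (auto simp: L2_rel_def distrib_left distrib_right
        intro!: square_integrable_add square_integrable_cmult)
  show "(r + s) *\<^sub>R a = r *\<^sub>R a + s *\<^sub>R a" unfolding scaleR_L2R_def
    by transfer (auto simp: L2_rel_def distrib_left distrib_right
        intro!: square_integrable_add square_integrable_cmult)
  show "r *\<^sub>R s *\<^sub>R a = (r * s) *\<^sub>R a" unfolding scaleR_L2R_def
    by transfer (auto simp: L2_rel_def mult.assoc
        intro!: square_integrable_add square_integrable_cmult
         square_integrable_cmult[where c = "_ * _", unfolded mult.assoc])
  show "1 *\<^sub>R a = a" unfolding scaleR_L2R_def
    by transfer (auto simp: L2_rel_def)
qed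

end

global_interpretation L2: vector_space L2_scaleC
proof
  fix a b :: complex and f g :: L2R
  show "L2_scaleC a (f + g) = L2_scaleC a f + L2_scaleC a g"
    by transfer (auto simp: L2_rel_def distrib_left distrib_right
        intro!: square_integrable_add square_integrable_cmult)
  show "L2_scaleC (a + b) f = L2_scaleC a f + L2_scaleC b f"
    by transfer (auto simp: L2_rel_def distrib_left distrib_right
        intro!: square_integrable_add square_integrable_cmult)
  show "L2_scaleC a (L2_scaleC b f) = L2_scaleC (a * b) f"
    by transfer (auto simp: L2_rel_def mult.assoc
        intro!: square_integrable_cmult
         square_integrable_cmult[where c = "_ * _", unfolded mult.assoc])
  show "L2_scaleC 1 f = f"
    by transfer (auto simp: L2_rel_def)
qed

lemma L2_cinner_commute: "L2_cinner f g = cnj (L2_cinner g f)"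
  by transfer (subst Bochner_Integration.integral_cnj[symmetric], simp add: mult.commute)

lemma L2_cinner_add_left: "L2_cinner (f + g) h = L2_cinner f h + L2_cinner g h"
  by transfer (auto simp: L2_rel_def distrib_right square_integrable_inner_integrable)

lemma L2_cinner_scaleC_left: "L2_cinner (L2_scaleC c f) g = c * L2_cinner f g"
  by transfer (simp add: mult.assoc)

lemma L2_cinner_self: "L2_cinner f f = complex_of_real (Re (L2_cinner f f)) \<and> 0 \<le> Re (L2_cinner f f)"
proof (transfer)
  fix f :: "real \<Rightarrow> complex"
  have "(LINT x|lborel. f x * cnj (f x)) = complex_of_real (LINT x|lborel. (cmod (f x))\<^sup>2)"
    by (simp flip: complex_norm_square integral_complex_of_real)
  then show "(LINT x|lborel. f x * cnj (f x)) = complex_of_real (Re (LINT x|lborel. f x * cnj (f x)))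
      \<and> 0 \<le> Re (LINT x|lborel. f x * cnj (f x))"
    by simp
qed

lemma L2_cinner_self_eq_0: "L2_cinner f f = 0 \<longleftrightarrow> f = 0"
proof (transfer)
  fix f assume f: "L2_rel f f"
  have eq: "(LINT x|lborel. f x * cnj (f x)) = complex_of_real (LINT x|lborel. (cmod (f x))\<^sup>2)"
    by (simp flip: complex_norm_square integral_complex_of_real)
  have "(LINT x|lborel. (cmod (f x))\<^sup>2) = 0 \<longleftrightarrow> (AE x in lborel. (cmod (f x))\<^sup>2 = 0)"
    using f by (intro integral_nonneg_eq_0_iff_AE) (auto simp: L2_rel_def square_integrable_def)
  then show "(LINT x|lborel. f x * cnj (f x)) = 0 \<longleftrightarrow> L2_rel f (\<lambda>_. 0)"
    using f unfolding eq by (simp add: L2_rel_def square_integrable_0)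
qed

instantiation L2R :: real_inner
begin

definition inner_L2R :: "L2R \<Rightarrow> L2R \<Rightarrow> real" where
  "inner_L2R f g = Re (L2_cinner f g)"

definition norm_L2R :: "L2R \<Rightarrow> real" where
  "norm_L2R f = sqrt (Re (L2_cinner f f))"

definition dist_L2R :: "L2R \<Rightarrow> L2R \<Rightarrow> real" where
  "dist_L2R f g = norm (f - g)"

definition sgn_L2R :: "L2R \<Rightarrow> L2R" where
  "sgn_L2R f = inverse (norm f) *\<^sub>R f"

definition uniformity_L2R :: "(L2R \<times> L2R) filter" where
  "uniformity_L2R = (INF e\<in>{0<..}. principal {(f, g). dist f g < e})"

definition open_L2R :: "L2R set \<Rightarrow> bool" where
  "open_L2R U \<longleftrightarrow> (\<forall>f\<in>U. \<forall>\<^sub>F (f', g) in uniformity. f' = f \<longrightarrow> g \<in> U)"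

instance
proof
  fix f g h :: L2R and r :: real
  show "dist f g = norm (f - g)" by (rule dist_L2R_def)
  show "sgn f = f /\<^sub>R norm f" by (rule sgn_L2R_def)
  show "uniformity = (INF e\<in>{0<..}. principal {(f :: L2R, g). dist f g < e})"
    by (rule uniformity_L2R_def)
  show "open U \<longleftrightarrow> (\<forall>f\<in>U. \<forall>\<^sub>F (f', g) in uniformity. f' = f \<longrightarrow> g \<in> U)" for U :: "L2R set"
    by (rule open_L2R_def)
  show "f \<bullet> g = g \<bullet> f"
    unfolding inner_L2R_def by (subst L2_cinner_commute) simp
  show "(f + g) \<bullet> h = f \<bullet> h + g \<bullet> h"
    by (simp add: inner_L2R_def L2_cinner_add_left)
  show "(r *\<^sub>R f) \<bullet> g = r * (f \<bullet> g)"
    by (simp add: inner_L2R_def scaleR_L2R_def L2_cinner_scaleC_left)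
  show "0 \<le> f \<bullet> f"
    using L2_cinner_self[of f] by (simp add: inner_L2R_def)
  show "f \<bullet> f = 0 \<longleftrightarrow> f = 0"
    using L2_cinner_self[of f] L2_cinner_self_eq_0[of f]
    by (metis inner_L2R_def of_real_0 zero_complex.sel(1))
  show "norm f = sqrt (f \<bullet> f)"
    by (simp add: norm_L2R_def inner_L2R_def)
qed

end

lemma norm_L2_scaleC: "norm (L2_scaleC c f) = cmod c * norm f"
proof -
  have "L2_cinner (L2_scaleC c f) (L2_scaleC c f) = c * cnj c * L2_cinner f f"
    by (metis L2_cinner_commute L2_cinner_scaleC_left complex_cnj_cnj complex_cnj_mult mult.assoc)
  also have "\<dots> = complex_of_real ((cmod c)\<^sup>2) * L2_cinner f f"
    by (simp only: complex_norm_square)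
  finally show ?thesis
    by (simp add: norm_L2R_def real_sqrt_mult)
qed


section \<open>The subspaces in the lattice\<close>

text \<open>\<open>L\<^sup>2(a,\<infinity>)\<close> as the subspace of functions vanishing off \<open>(a,\<infinity>)\<close>.\<close>

lift_definition vanishes_below :: "real \<Rightarrow> L2R \<Rightarrow> bool" is
  "\<lambda>a f. AE x in lborel. x \<le> a \<longrightarrow> f x = 0"
  by (auto simp: L2_rel_def elim: AE_mp)

definition L2_above :: "real \<Rightarrow> L2R set" where
  "L2_above a = {f. vanishes_below a f}"

lift_definition modulation :: "real \<Rightarrow> L2R \<Rightarrow> L2R" is
  "\<lambda>\<beta> f x. exp (\<i> * of_real (\<beta> * x)) * f x"
proof -
  fix \<beta> :: real and f g assume fg: "L2_rel f g"
  have "square_integrable (\<lambda>x. exp (\<i> * of_real (\<beta> * x)) * h x)" if "square_integrable h" for h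
    using that by (intro square_integrable_unimodular_mult)
      (auto intro!: borel_measurable_continuous_onI continuous_intros)
  then show "L2_rel (\<lambda>x. exp (\<i> * of_real (\<beta> * x)) * f x) (\<lambda>x. exp (\<i> * of_real (\<beta> * x)) * g x)"
    using fg by (auto simp: L2_rel_def)
qed

text \<open>
  \<open>H\<^sup>2(\<real>)\<close> consists of the boundary functions of the holomorphic \<open>F\<close> on the upper half plane
  with \<open>sup\<^bsub>y>0\<^esub> \<integral>|F(x + iy)|\<^sup>2 dx < \<infinity>\<close>. The boundary function is the limit of
  \<open>F(\<cdot> + iy)\<close> in \<open>L\<^sup>2\<close>-norm as \<open>y\<close> tends to \<open>0\<close> from above; for such \<open>F\<close> it agrees almost
  everywhere with the nontangential limit.
\<close>

lift_definition hardy_boundary :: "(complex \<Rightarrow> complex) \<Rightarrow> L2R \<Rightarrow> bool" is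
  "\<lambda>F f. ((\<lambda>y. \<integral>\<^sup>+x. ennreal ((cmod (F (Complex x y) - f x))\<^sup>2) \<partial>lborel) \<longlongrightarrow> 0) (at_right 0)"
proof -
  fix F :: "complex \<Rightarrow> complex" and f g assume "L2_rel f g"
  then have "AE x in lborel. f x = g x" by (simp add: L2_rel_def)
  then have "(\<integral>\<^sup>+x. ennreal ((cmod (F (Complex x y) - f x))\<^sup>2) \<partial>lborel) =
      (\<integral>\<^sup>+x. ennreal ((cmod (F (Complex x y) - g x))\<^sup>2) \<partial>lborel)" for y
    by (intro nn_integral_cong_AE) auto
  then show "((\<lambda>y. \<integral>\<^sup>+x. ennreal ((cmod (F (Complex x y) - f x))\<^sup>2) \<partial>lborel) \<longlongrightarrow> 0) (at_right 0) =
      ((\<lambda>y. \<integral>\<^sup>+x. ennreal ((cmod (F (Complex x y) - g x))\<^sup>2) \<partial>lborel) \<longlongrightarrow> 0) (at_right 0)"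
    by simp
qed

definition H2 :: "L2R set" where
  "H2 = {f. \<exists>F. F holomorphic_on {z. 0 < Im z} \<and>
           (SUP y\<in>{0<..}. \<integral>\<^sup>+x. ennreal ((cmod (F (Complex x y)))\<^sup>2) \<partial>lborel) < \<infinity> \<and>
           hardy_boundary F f}"

definition binest :: "L2R set set" where
  "binest = {{0}} \<union> {L2_above (- \<alpha>) | \<alpha>. 0 \<le> \<alpha>} \<union> {modulation \<beta> ` H2 | \<beta>. 0 \<le> \<beta>} \<union> {UNIV}"


section \<open>Operators\<close>

text \<open>
  The type \<open>L2R \<Rightarrow>\<^sub>L L2R\<close> contains all bounded real-linear maps; \<open>B(L\<^sup>2(\<real>))\<close> consists of the
  complex-linear ones.
\<close>

definition BL2 :: "(L2R \<Rightarrow>\<^sub>L L2R) set" where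
  "BL2 = {T. \<forall>c f. blinfun_apply T (L2_scaleC c f) = L2_scaleC c (blinfun_apply T f)}"

lift_definition scalar_op :: "complex \<Rightarrow> L2R \<Rightarrow>\<^sub>L L2R" is L2_scaleC
proof (rule bounded_linear_intro[where K = "cmod _"])
  fix c f g and r :: real
  show "L2_scaleC c (f + g) = L2_scaleC c f + L2_scaleC c g"
    by (rule L2.scale_right_distrib)
  show "L2_scaleC c (r *\<^sub>R f) = r *\<^sub>R L2_scaleC c f"
    by (simp add: scaleR_L2R_def mult.commute)
  show "norm (L2_scaleC c f) \<le> norm f * cmod c"
    by (simp add: norm_L2_scaleC mult.commute)
qed

definition Alg :: "L2R set set \<Rightarrow> (L2R \<Rightarrow>\<^sub>L L2R) set" where
  "Alg L = {T \<in> BL2. \<forall>M\<in>L. blinfun_apply T ` M \<subseteq> M}"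

text \<open>For a closed complex subspace \<open>M\<close> this is the orthogonal projection onto \<open>M\<close>.\<close>

definition orth_proj :: "L2R set \<Rightarrow> L2R \<Rightarrow>\<^sub>L L2R" where
  "orth_proj M = (THE P. \<forall>f. blinfun_apply P f \<in> M \<and>
                     (\<forall>g\<in>M. L2_cinner (f - blinfun_apply P f) g = 0))"

definition P_plus :: "L2R \<Rightarrow>\<^sub>L L2R" where "P_plus = orth_proj (L2_above 0)"

definition Q_plus :: "L2R \<Rightarrow>\<^sub>L L2R" where "Q_plus = orth_proj H2"

text \<open>
  The coarsest topology on \<open>B(L\<^sup>2(\<real>))\<close> making all \<open>T \<mapsto> \<langle>T f, g\<rangle>\<close> continuous;
  \<open>euclidean\<close> is here the product topology on \<open>L2R \<times> L2R \<Rightarrow> complex\<close>.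
\<close>

definition weak_operator_topology :: "(L2R \<Rightarrow>\<^sub>L L2R) topology" where
  "weak_operator_topology =
     pullback_topology BL2 (\<lambda>T (f, g). L2_cinner (blinfun_apply T f) g) euclidean"

definition two_sided_ideal :: "(L2R \<Rightarrow>\<^sub>L L2R) set \<Rightarrow> (L2R \<Rightarrow>\<^sub>L L2R) set \<Rightarrow> bool" where
  "two_sided_ideal A J \<longleftrightarrow>
     J \<subseteq> A \<and> 0 \<in> J \<and> (\<forall>S\<in>J. \<forall>T\<in>J. S + T \<in> J) \<and> (\<forall>c. \<forall>S\<in>J. scalar_op c o\<^sub>L S \<in> J) \<and>
     (\<forall>T\<in>A. \<forall>S\<in>J. T o\<^sub>L S \<in> J \<and> S o\<^sub>L T \<in> J)"

definition wot_closed_ideal_generated ::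
    "(L2R \<Rightarrow>\<^sub>L L2R) set \<Rightarrow> (L2R \<Rightarrow>\<^sub>L L2R) set \<Rightarrow> (L2R \<Rightarrow>\<^sub>L L2R) set" where
  "wot_closed_ideal_generated A X =
     (\<lambda>J. two_sided_ideal A J \<and> closedin weak_operator_topology J) hull X"

definition finite_rank :: "(L2R \<Rightarrow>\<^sub>L L2R) \<Rightarrow> bool" where
  "finite_rank T \<longleftrightarrow> (\<exists>B. finite B \<and> range (blinfun_apply T) \<subseteq> L2.span B)"

text \<open>Finiteness is required separately because \<open>L2.dim\<close> is \<open>0\<close> on infinite-dimensional subspaces.\<close>

definition has_rank :: "(L2R \<Rightarrow>\<^sub>L L2R) \<Rightarrow> nat \<Rightarrow> bool" where
  "has_rank T n \<longleftrightarrow> finite_rank T \<and> L2.dim (range (blinfun_apply T)) = n"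

end

theory Submission
  imports Defs "HOL-Real_Asymp.Real_Asymp"
begin

text \<open>
  Membership in \<open>P\<^sub>+ B(L\<^sup>2) (I - Q\<^sub>+)\<close> is the conjunction of two linear conditions on an operator
  \<open>T\<close>: the range of \<open>T\<close> lies in \<open>L\<^sup>2(0,\<infinity>)\<close>, and \<open>T\<close> vanishes on \<open>H\<^sup>2\<close> (\<open>corner_eq\<close>). In this form it
  is immediate that these operators belong to \<open>Alg L\<close>, as they annihilate every \<open>e\<^sup>i\<^sup>\<beta>\<^sup>x H\<^sup>2\<close> and map
  into every \<open>L\<^sup>2(-\<alpha>,\<infinity>)\<close>, and that they form a weakly closed ideal of it.

  The substance is that a finite rank \<open>T\<close> in \<open>Alg L\<close> satisfies both conditions
  (\<open>finite_rank_mem_corner\<close>). The subspaces \<open>T L\<^sup>2(-n,\<infinity>)\<close> increase with \<open>n\<close> inside a finite-dimensional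
  space, so they are all contained in one of them, hence in some \<open>L\<^sup>2(-N,\<infinity>)\<close>; as the \<open>L\<^sup>2(-n,\<infinity>)\<close>
  have dense union, the whole range of \<open>T\<close> lies in \<open>L\<^sup>2(-N,\<infinity>)\<close>. Therefore
  \<open>T H\<^sup>2 \<subseteq> H\<^sup>2 \<inter> L\<^sup>2(-N,\<infinity>) = 0\<close>. Now \<open>T\<close> maps both \<open>H\<^sup>2\<close> and \<open>L\<^sup>2(0,\<infinity>)\<close> into \<open>L\<^sup>2(0,\<infinity>)\<close>, and
  \<open>H\<^sup>2 + L\<^sup>2(0,\<infinity>)\<close> is dense, so all of the range lies in \<open>L\<^sup>2(0,\<infinity>)\<close>.

  Conversely, given \<open>T = P\<^sub>+ T (I - Q\<^sub>+)\<close> and finitely many vectors \<open>f\<^sub>k\<close>, let \<open>F\<close> be the finite rank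
  projection onto the span of the \<open>(I - Q\<^sub>+) f\<^sub>k\<close>; then \<open>T F (I - Q\<^sub>+)\<close> is a finite rank operator of the
  same kind and agrees with \<open>T\<close> on every \<open>f\<^sub>k\<close>. So \<open>T\<close> is a weak limit of finite rank operators in
  \<open>Alg L\<close>. For the decomposition of an operator of rank \<open>n\<close>, expand the values of \<open>T\<close> in an orthogonal
  basis of its range: each term \<open>f \<mapsto> \<langle>T f, u\<rangle> e\<close> again has range in \<open>L\<^sup>2(0,\<infinity>)\<close> and vanishes on \<open>H\<^sup>2\<close>.

  Two facts about \<open>H\<^sup>2\<close> carry this: it meets each \<open>L\<^sup>2(a,\<infinity>)\<close> only in \<open>0\<close>, and its orthogonal complement
  meets \<open>L\<^sup>2(-\<infinity>,0)\<close> only in \<open>0\<close> (\<open>H2_Int_L2_above\<close>, \<open>orthogonal_H2_L2_above_trivial\<close>). Both follow from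
  orthogonality to the kernels \<open>(t - w)\<^sup>-\<^sup>n\<close>, which are in \<open>H\<^sup>2\<close> for \<open>w\<close> in the lower half plane and
  orthogonal to \<open>H\<^sup>2\<close> for \<open>w\<close> in the upper one. For a function supported on a half line the pole may be
  moved to a real point off the support, after which the substitution \<open>s = 1 / (1 + t)\<close> turns the kernels
  into the powers of \<open>s\<close> on \<open>[0,1]\<close>, and the Weierstrass theorem applies
  (\<open>half_line_cauchy_completeness\<close>).

  That \<open>Q\<^sub>+\<close> is an orthogonal projection at all requires \<open>L\<^sup>2\<close> to be complete and \<open>H\<^sup>2\<close> to be closed. The
  latter rests on the Poisson formula \<open>F(z) = \<langle>f, p\<^sub>z\<rangle>\<close> for the holomorphic extension \<open>F\<close> of \<open>f \<in> H\<^sup>2\<close>,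
  obtained by shifting contours in the half plane: it makes the extensions of an \<open>L\<^sup>2\<close>-convergent
  sequence converge locally uniformly, and as Poisson integration contracts the norm on every horizontal
  line, the convergence on these lines is uniform in the height
  (\<open>closed_H2\<close>).
\<close>

section \<open>The inner product and norm on representatives\<close>

lemma L2_rel_refl: "L2_rel f f \<longleftrightarrow> square_integrable f"
  by (auto simp: L2_rel_def)

lemma L2R_cases:
  obtains f where "square_integrable f" "x = abs_L2R f"
  by (metis L2_rel_def Quotient3_L2R Quotient3_def)

lemma abs_L2R_eq_iff:
  assumes "square_integrable f" "square_integrable g"
  shows "abs_L2R f = abs_L2R g \<longleftrightarrow> (AE x in lborel. f x = g x)"
  using Quotient3_rel[OF Quotient3_L2R, of f g] assms by (auto simp: L2_rel_def)

lemma abs_L2R_plus: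
  "square_integrable f \<Longrightarrow> square_integrable g \<Longrightarrow> abs_L2R f + abs_L2R g = abs_L2R (\<lambda>x. f x + g x)"
  by (rule plus_L2R.abs_eq) (simp_all add: L2_rel_refl)

lemma abs_L2R_scaleC: "square_integrable f \<Longrightarrow> L2_scaleC c (abs_L2R f) = abs_L2R (\<lambda>x. c * f x)"
  by (rule L2_scaleC.abs_eq) (simp_all add: L2_rel_refl)

lemma abs_L2R_minus:
  assumes "square_integrable f" "square_integrable g"
  shows "abs_L2R f - abs_L2R g = abs_L2R (\<lambda>x. f x - g x)"
proof -
  have "L2_scaleC (-1) (abs_L2R g) = abs_L2R (\<lambda>x. -1 * g x)" by (rule abs_L2R_scaleC[OF assms(2)])
  then show ?thesis
    unfolding minus_L2R_def uminus_L2R_def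
    using abs_L2R_plus[OF assms(1) square_integrable_cmult[OF assms(2), of "-1"]] by simp
qed

lemma square_integrable_diff:
  "square_integrable f \<Longrightarrow> square_integrable g \<Longrightarrow> square_integrable (\<lambda>x. f x - g x)"
  using square_integrable_add[of f "\<lambda>x. -1 * g x"] square_integrable_cmult[of g "-1"] by simp

lemma cinner_abs_L2R:
  "square_integrable f \<Longrightarrow> square_integrable g \<Longrightarrow>
     L2_cinner (abs_L2R f) (abs_L2R g) = (LINT x|lborel. f x * cnj (g x))"
  by (rule L2_cinner.abs_eq) (simp_all add: L2_rel_refl)

lemma modulation_abs_L2R:
  "square_integrable f \<Longrightarrow> modulation \<beta> (abs_L2R f) = abs_L2R (\<lambda>x. exp (\<i> * of_real (\<beta> * x)) * f x)"
  by (rule modulation.abs_eq) (simp_all add: L2_rel_refl)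

lemma square_integrable_measurable: "square_integrable f \<Longrightarrow> f \<in> borel_measurable borel"
  by (simp add: square_integrable_def)

lemma square_integrable_iff_nn_integral:
  "square_integrable f \<longleftrightarrow>
     f \<in> borel_measurable borel \<and> (\<integral>\<^sup>+x. ennreal ((cmod (f x))\<^sup>2) \<partial>lborel) < \<infinity>"
  by (auto simp: square_integrable_def integrable_iff_bounded)

lemma norm_abs_L2R_sq:
  assumes "square_integrable f"
  shows "(norm (abs_L2R f))\<^sup>2 = (LINT x|lborel. (cmod (f x))\<^sup>2)"
proof -
  have "L2_cinner (abs_L2R f) (abs_L2R f) = complex_of_real (LINT x|lborel. (cmod (f x))\<^sup>2)"
    using assms by (simp add: cinner_abs_L2R flip: complex_norm_square integral_complex_of_real)
  then show ?thesis by (simp add: norm_L2R_def)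
qed

lemma nn_integral_abs_L2R:
  assumes "square_integrable f"
  shows "(\<integral>\<^sup>+x. ennreal ((cmod (f x))\<^sup>2) \<partial>lborel) = ennreal ((norm (abs_L2R f))\<^sup>2)"
  using assms by (subst nn_integral_eq_integral) (auto simp: square_integrable_def norm_abs_L2R_sq)

lemma norm_abs_L2R_le:
  assumes "f \<in> borel_measurable borel" "(\<integral>\<^sup>+x. ennreal ((cmod (f x))\<^sup>2) \<partial>lborel) \<le> ennreal (c\<^sup>2)" "0 \<le> c"
  shows "square_integrable f" "norm (abs_L2R f) \<le> c"
proof -
  show *: "square_integrable f"
    using assms unfolding square_integrable_iff_nn_integral
    by (metis ennreal_less_top infinity_ennreal_def order_le_less_trans)
  show "norm (abs_L2R f) \<le> c"
    using assms(2) unfolding nn_integral_abs_L2R[OF *] by (simp add: abs_le_square_iff[symmetric] assms(3))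
qed

lemma square_integrable_mono:
  assumes "square_integrable g" "f \<in> borel_measurable borel" "\<And>x. cmod (f x) \<le> cmod (g x)"
  shows "square_integrable f"
  unfolding square_integrable_def
proof
  show "integrable lborel (\<lambda>x. (cmod (f x))\<^sup>2)"
  proof (rule Bochner_Integration.integrable_bound[of _ "\<lambda>x. (cmod (g x))\<^sup>2"])
    show "integrable lborel (\<lambda>x. (cmod (g x))\<^sup>2)" using assms(1) by (simp add: square_integrable_def)
    show "(\<lambda>x. (cmod (f x))\<^sup>2) \<in> borel_measurable lborel" using assms(2) by measurable
    show "AE x in lborel. norm ((cmod (f x))\<^sup>2) \<le> norm ((cmod (g x))\<^sup>2)"
      using assms(3) by (simp add: power_mono)
  qed
qed (use assms in simp)

lemma borel_measurable_cnj [measurable (raw)]: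
  "f \<in> borel_measurable M \<Longrightarrow> (\<lambda>x. cnj (f x)) \<in> borel_measurable M"
  by (erule measurable_compose) (intro borel_measurable_continuous_onI continuous_intros)

lemma square_integrable_cnj: "square_integrable f \<Longrightarrow> square_integrable (\<lambda>x. cnj (f x))"
  by (rule square_integrable_mono[of f]) (auto dest: square_integrable_measurable intro: borel_measurable_cnj)

lemma square_integrable_mult_integrable:
  assumes "square_integrable f" "square_integrable g"
  shows "integrable lborel (\<lambda>x. f x * g x)"
  using square_integrable_inner_integrable[OF assms(1) square_integrable_cnj[OF assms(2)]] by simp

lemma abs_L2R_tendstoI:
  assumes f: "\<And>k. square_integrable (f k)" and g: "square_integrable g"
    and lim: "((\<lambda>k. LINT x|lborel. (cmod (f k x - g x))\<^sup>2) \<longlongrightarrow> 0) F"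
  shows "((\<lambda>k. abs_L2R (f k)) \<longlongrightarrow> abs_L2R g) F"
proof -
  have "((\<lambda>k. sqrt (LINT x|lborel. (cmod (f k x - g x))\<^sup>2)) \<longlongrightarrow> sqrt 0) F"
    by (intro tendsto_intros lim)
  moreover have "sqrt (LINT x|lborel. (cmod (f k x - g x))\<^sup>2) = norm (abs_L2R (f k) - abs_L2R g)" for k
    unfolding norm_abs_L2R_sq[OF square_integrable_diff[OF f g], symmetric]
    by (simp add: abs_L2R_minus f g)
  ultimately show ?thesis by (simp add: tendsto_norm_zero_iff LIM_zero_iff)
qed

lemma abs_L2R_dominated_convergence:
  fixes f :: "nat \<Rightarrow> real \<Rightarrow> complex"
  assumes f: "\<And>k. f k \<in> borel_measurable borel" and g: "g \<in> borel_measurable borel"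
    and h: "square_integrable h"
    and bd: "\<And>k x. cmod (f k x) \<le> cmod (h x)" and lim: "\<And>x. (\<lambda>k. f k x) \<longlonglongrightarrow> g x"
  shows "(\<lambda>k. abs_L2R (f k)) \<longlonglongrightarrow> abs_L2R g"
proof (rule abs_L2R_tendstoI)
  have bdg: "cmod (g x) \<le> cmod (h x)" for x
    by (rule LIMSEQ_le_const2[OF tendsto_norm[OF lim]]) (use bd in auto)
  show "square_integrable (f k)" for k by (rule square_integrable_mono[OF h f bd])
  show "square_integrable g" by (rule square_integrable_mono[OF h g bdg])
  have "(\<lambda>k. LINT x|lborel. (cmod (f k x - g x))\<^sup>2) \<longlonglongrightarrow> integral\<^sup>L lborel (\<lambda>x::real. 0::real)"
  proof (rule integral_dominated_convergence[where w = "\<lambda>x. 4 * (cmod (h x))\<^sup>2"])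
    show "integrable lborel (\<lambda>x. 4 * (cmod (h x))\<^sup>2)" using h by (simp add: square_integrable_def)
    show "(\<lambda>x. (cmod (f k x - g x))\<^sup>2) \<in> borel_measurable lborel" for k using f[of k] g by measurable
    show "AE x in lborel. (\<lambda>k. (cmod (f k x - g x))\<^sup>2) \<longlonglongrightarrow> 0"
    proof (intro AE_I2)
      fix x
      have "(\<lambda>k. (cmod (f k x - g x))\<^sup>2) \<longlonglongrightarrow> (cmod (g x - g x))\<^sup>2" by (intro tendsto_intros lim)
      then show "(\<lambda>k. (cmod (f k x - g x))\<^sup>2) \<longlonglongrightarrow> 0" by simp
    qed
    show "AE x in lborel. norm ((cmod (f k x - g x))\<^sup>2) \<le> 4 * (cmod (h x))\<^sup>2" for k
    proof (intro AE_I2)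
      fix x
      have "cmod (f k x - g x) \<le> 2 * cmod (h x)"
        using norm_triangle_ineq4[of "f k x" "g x"] bd[of k x] bdg[of x] by linarith
      then have "(cmod (f k x - g x))\<^sup>2 \<le> (2 * cmod (h x))\<^sup>2" by (intro power_mono) auto
      then show "norm ((cmod (f k x - g x))\<^sup>2) \<le> 4 * (cmod (h x))\<^sup>2" by (simp add: power_mult_distrib)
    qed
  qed simp
  then show "(\<lambda>k. LINT x|lborel. (cmod (f k x - g x))\<^sup>2) \<longlonglongrightarrow> 0" by simp
qed

lemma L2_cinner_diff_left: "L2_cinner (f - g) h = L2_cinner f h - L2_cinner g h"
  unfolding minus_L2R_def uminus_L2R_def L2_cinner_add_left L2_cinner_scaleC_left by simp

lemma L2_cinner_diff_right: "L2_cinner h (f - g) = L2_cinner h f - L2_cinner h g"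
  by (metis L2_cinner_commute L2_cinner_diff_left complex_cnj_diff)

lemma L2_cinner_add_right: "L2_cinner h (f + g) = L2_cinner h f + L2_cinner h g"
  by (metis L2_cinner_commute L2_cinner_add_left complex_cnj_add)

lemma L2_cinner_scaleC_right: "L2_cinner f (L2_scaleC c g) = cnj c * L2_cinner f g"
  by (metis L2_cinner_commute L2_cinner_scaleC_left complex_cnj_mult)

lemma L2_cinner_zero [simp]: "L2_cinner 0 f = 0" "L2_cinner f 0 = 0"
  using L2_cinner_diff_left[of f f f] L2_cinner_diff_right[of f f f] by simp_all

lemma L2_cinner_eq_inner: "L2_cinner f g = Complex (f \<bullet> g) (f \<bullet> L2_scaleC \<i> g)"
  by (simp add: inner_L2R_def L2_cinner_scaleC_right complex_eq_iff)

lemma norm_L2_cinner_le: "norm (L2_cinner f g) \<le> 2 * norm f * norm g"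
proof -
  have "\<bar>f \<bullet> g\<bar> \<le> norm f * norm g" "\<bar>f \<bullet> L2_scaleC \<i> g\<bar> \<le> norm f * norm g"
    using Cauchy_Schwarz_ineq2[of f g] Cauchy_Schwarz_ineq2[of f "L2_scaleC \<i> g"]
    by (simp_all add: norm_L2_scaleC)
  then show ?thesis using cmod_le[of "L2_cinner f g"] by (simp add: L2_cinner_eq_inner)
qed

lemma bounded_bilinear_L2_cinner: "bounded_bilinear L2_cinner"
proof
  show "L2_cinner (f + g) h = L2_cinner f h + L2_cinner g h" for f g h by (rule L2_cinner_add_left)
  show "L2_cinner h (f + g) = L2_cinner h f + L2_cinner h g" for f g h by (rule L2_cinner_add_right)
  show "L2_cinner (r *\<^sub>R f) g = r *\<^sub>R L2_cinner f g" for r f g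
    by (simp add: scaleR_L2R_def L2_cinner_scaleC_left scaleR_conv_of_real)
  show "L2_cinner f (r *\<^sub>R g) = r *\<^sub>R L2_cinner f g" for r f g
    by (simp add: scaleR_L2R_def L2_cinner_scaleC_right scaleR_conv_of_real)
  have "norm (L2_cinner f g) \<le> norm f * norm g * 2" for f g
    using norm_L2_cinner_le[of f g] by (simp add: mult_ac)
  then show "\<exists>K. \<forall>a b. norm (L2_cinner a b) \<le> norm a * norm b * K" by blast
qed

lemmas tendsto_L2_cinner = bounded_bilinear.tendsto[OF bounded_bilinear_L2_cinner]

section \<open>Completeness of \<open>L\<^sup>2\<close>\<close>

lemma nn_integral_diff_abs_L2R:
  assumes "square_integrable f" "square_integrable g"
  shows "(\<integral>\<^sup>+x. ennreal ((cmod (f x - g x))\<^sup>2) \<partial>lborel) = ennreal ((norm (abs_L2R f - abs_L2R g))\<^sup>2)"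
  using nn_integral_abs_L2R[OF square_integrable_diff[OF assms]] by (simp add: abs_L2R_minus assms)

text \<open>
  The weights \<open>4\<^sup>n\<close> make \<open>\<Sum> 4\<^sup>n |f\<^sub>n\<^sub>+\<^sub>1 - f\<^sub>n|\<^sup>2\<close> integrable by monotone convergence. Where this sum is
  finite, its terms are bounded, so the increments decay geometrically and telescope.
\<close>

lemma fast_Cauchy_converges_AE:
  fixes f :: "nat \<Rightarrow> real \<Rightarrow> complex"
  assumes f: "\<And>n. square_integrable (f n)"
    and fast: "\<And>n. norm (abs_L2R (f (Suc n)) - abs_L2R (f n)) \<le> (1/4) ^ n"
  shows "AE x in lborel. convergent (\<lambda>n. f n x)"
proof -
  have [measurable]: "f n \<in> borel_measurable borel" for n by (rule square_integrable_measurable[OF f])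
  have term_le: "(\<integral>\<^sup>+x. ennreal (4 ^ n * (cmod (f (Suc n) x - f n x))\<^sup>2) \<partial>lborel) \<le> ennreal ((1/4) ^ n)" for n
  proof -
    have "(\<integral>\<^sup>+x. ennreal (4 ^ n * (cmod (f (Suc n) x - f n x))\<^sup>2) \<partial>lborel) =
        ennreal (4 ^ n) * ennreal ((norm (abs_L2R (f (Suc n)) - abs_L2R (f n)))\<^sup>2)"
      by (simp add: ennreal_mult nn_integral_cmult nn_integral_diff_abs_L2R f)
    also have "\<dots> \<le> ennreal (4 ^ n) * ennreal (((1/4) ^ n)\<^sup>2)"
      by (intro mult_left_mono ennreal_leI power_mono fast) auto
    also have "\<dots> = ennreal ((1/4) ^ n)"
      by (simp add: power2_eq_square power_one_over flip: ennreal_mult)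
    finally show ?thesis .
  qed
  have "(\<integral>\<^sup>+x. (\<Sum>n. ennreal (4 ^ n * (cmod (f (Suc n) x - f n x))\<^sup>2)) \<partial>lborel) =
      (\<Sum>n. \<integral>\<^sup>+x. ennreal (4 ^ n * (cmod (f (Suc n) x - f n x))\<^sup>2) \<partial>lborel)"
    by (rule nn_integral_suminf) simp
  also have "\<dots> \<le> (\<Sum>n. ennreal ((1/4) ^ n))" by (intro suminf_le term_le) auto
  also have "\<dots> < \<infinity>" by (subst suminf_ennreal2) (auto intro: summable_geometric)
  finally have fin: "(\<integral>\<^sup>+x. (\<Sum>n. ennreal (4 ^ n * (cmod (f (Suc n) x - f n x))\<^sup>2)) \<partial>lborel) < \<infinity>" .
  have "AE x in lborel. (\<Sum>n. ennreal (4 ^ n * (cmod (f (Suc n) x - f n x))\<^sup>2)) \<noteq> \<infinity>"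
    by (rule nn_integral_noteq_infinite[OF _ less_imp_neq[OF fin]]) measurable
  then show ?thesis
  proof eventually_elim
    case (elim x)
    define a where "a n = ennreal (4 ^ n * (cmod (f (Suc n) x - f n x))\<^sup>2)" for n
    have "suminf a \<noteq> \<infinity>" using elim unfolding a_def[abs_def] .
    then obtain C where C: "suminf a = ennreal C" "0 \<le> C" by (cases "suminf a") auto
    have "a n \<le> ennreal C" for n
      unfolding C(1)[symmetric] using sum_le_suminf[of a "{n}"] by simp
    then have le: "4 ^ n * (cmod (f (Suc n) x - f n x))\<^sup>2 \<le> C" for n using C(2) by (simp add: a_def)
    have bd: "norm (f (Suc n) x - f n x) \<le> sqrt C * (1/2) ^ n" for n
    proof -
      have "sqrt (4 ^ n * (cmod (f (Suc n) x - f n x))\<^sup>2) \<le> sqrt C" using le by simp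
      moreover have "sqrt (4 ^ n) = (2::real) ^ n"
        by (simp add: real_sqrt_power)
      ultimately show ?thesis by (simp add: real_sqrt_mult field_simps)
    qed
    have "summable (\<lambda>n. f (Suc n) x - f n x)"
      by (rule summable_comparison_test'[OF _ bd]) (intro summable_mult summable_geometric, simp)
    then have "convergent (\<lambda>n. \<Sum>k<n. f (Suc k) x - f k x)" by (simp add: summable_iff_convergent)
    then have "convergent (\<lambda>n. f n x - f 0 x)" 
      unfolding sum_lessThan_telescope[of "\<lambda>n. f n x"] .
    then have "convergent (\<lambda>n. f n x - f 0 x + f 0 x)" by (intro convergent_add convergent_const)
    then show ?case by simp
  qed
qed

lemma Cauchy_fast_subseq:
  fixes X :: "nat \<Rightarrow> 'a :: metric_space"
  assumes "Cauchy X"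
  obtains r where "strict_mono r" "\<And>n m. r n \<le> m \<Longrightarrow> dist (X m) (X (r n)) \<le> (1/4) ^ n"
proof -
  have "\<exists>N. \<forall>m\<ge>N. \<forall>m'\<ge>N. dist (X m) (X m') < (1/4) ^ n" for n :: nat
    using assms unfolding Cauchy_def by (meson ge_iff_diff_ge_0 zero_less_divide_1_iff zero_less_numeral zero_less_power)
  then obtain N where N: "\<And>n m m'. m \<ge> N n \<Longrightarrow> m' \<ge> N n \<Longrightarrow> dist (X m) (X m') < (1/4) ^ n"
    by metis
  define r where "r n = (\<Sum>k\<le>n. Suc (N k))" for n
  have r: "strict_mono r" by (rule strict_mono_Suc_iff[THEN iffD2]) (simp add: r_def)
  have "N n \<le> r n" for n
    unfolding r_def using member_le_sum[of n "{..n}" "\<lambda>k. Suc (N k)"] by auto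
  then have "dist (X m) (X (r n)) \<le> (1/4) ^ n" if "r n \<le> m" for n m
    using N[of n m "r n"] that le_trans by (intro less_imp_le) blast
  with r show thesis by (rule that)
qed

text \<open>
  Riesz-Fischer: a rapidly converging subsequence has a pointwise limit almost everywhere, and Fatou's
  lemma turns the Cauchy estimate into convergence in norm.
\<close>

instance L2R :: complete_space
proof
  fix X :: "nat \<Rightarrow> L2R" assume X: "Cauchy X"
  obtain r where r: "strict_mono r" and fast: "\<And>n m. r n \<le> m \<Longrightarrow> dist (X m) (X (r n)) \<le> (1/4) ^ n"
    using Cauchy_fast_subseq[OF X] by blast
  have "\<exists>g. square_integrable g \<and> X (r n) = abs_L2R g" for n by (metis L2R_cases)
  then obtain f where f: "\<And>n. square_integrable (f n)" and fX: "\<And>n. X (r n) = abs_L2R (f n)" by metis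
  have [measurable]: "f n \<in> borel_measurable borel" for n by (rule square_integrable_measurable[OF f])
  define g where "g x = lim (\<lambda>n. f n x)" for x
  have [measurable]: "g \<in> borel_measurable borel" unfolding g_def by measurable
  have conv: "AE x in lborel. convergent (\<lambda>n. f n x)"
    by (rule fast_Cauchy_converges_AE[OF f])
      (use fast r in \<open>simp add: dist_norm strict_mono_less_eq flip: fX\<close>)
  have le: "(\<integral>\<^sup>+x. ennreal ((cmod (g x - f n x))\<^sup>2) \<partial>lborel) \<le> ennreal (((1/4) ^ n)\<^sup>2)" for n
  proof -
    have "(\<integral>\<^sup>+x. ennreal ((cmod (g x - f n x))\<^sup>2) \<partial>lborel) =
        (\<integral>\<^sup>+x. liminf (\<lambda>m. ennreal ((cmod (f m x - f n x))\<^sup>2)) \<partial>lborel)"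
    proof (rule nn_integral_cong_AE, use conv in eventually_elim)
      case (elim x)
      then have "(\<lambda>m. f m x) \<longlonglongrightarrow> g x" unfolding g_def by (simp add: convergent_LIMSEQ_iff)
      then have "(\<lambda>m. ennreal ((cmod (f m x - f n x))\<^sup>2)) \<longlonglongrightarrow> ennreal ((cmod (g x - f n x))\<^sup>2)"
        by (intro tendsto_intros)
      from lim_imp_Liminf[OF _ this] show ?case by simp
    qed
    also have "\<dots> \<le> liminf (\<lambda>m. \<integral>\<^sup>+x. ennreal ((cmod (f m x - f n x))\<^sup>2) \<partial>lborel)"
      by (rule nn_integral_liminf) simp
    also have "\<dots> = liminf (\<lambda>m. ennreal ((norm (X (r m) - X (r n)))\<^sup>2))"
      by (simp add: nn_integral_diff_abs_L2R f fX)
    also have "\<dots> \<le> ennreal (((1/4) ^ n)\<^sup>2)"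
      by (rule Liminf_le)
        (use fast r in \<open>auto intro!: eventually_sequentiallyI[of n] ennreal_leI power_mono
           simp: strict_mono_less_eq simp flip: dist_norm\<close>)
    finally show ?thesis .
  qed
  have "square_integrable (\<lambda>x. g x - f 0 x)" by (rule norm_abs_L2R_le(1)[OF _ le]) auto
  from square_integrable_add[OF this f[of 0]] have g: "square_integrable g" by simp
  have "norm (abs_L2R g - X (r n)) \<le> (1/4) ^ n" for n
    using norm_abs_L2R_le(2)[OF _ le[of n]] by (simp add: fX abs_L2R_minus f g)
  then have "norm (X (r n) - abs_L2R g) \<le> (1/4) ^ n" for n
    by (subst norm_minus_commute)
  then have "(\<lambda>n. X (r n) - abs_L2R g) \<longlonglongrightarrow> 0"
    by (intro Lim_null_comparison[OF _ LIMSEQ_power_zero[of "1/4"]]) auto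
  then have "(\<lambda>n. X (r n)) \<longlonglongrightarrow> abs_L2R g" by (simp add: LIM_zero_iff)
  then have "X \<longlonglongrightarrow> abs_L2R g" by (intro Cauchy_converges_subseq[OF X r]) (simp add: o_def)
  then show "convergent X" by (auto simp: convergent_def)
qed

section \<open>Orthogonal projections\<close>

text \<open>
  By the parallelogram law a sequence in \<open>M\<close> whose distances to \<open>f\<close> tend to the infimum is Cauchy; the
  residual at its limit is orthogonal to \<open>M\<close> because no step along \<open>g \<in> M\<close> can shorten it.
\<close>

lemma orthogonal_projection_exists:
  fixes M :: "'a::{real_inner, complete_space} set"
  assumes "closed M" "subspace M"
  shows "\<exists>p\<in>M. \<forall>g\<in>M. (f - p) \<bullet> g = 0"
proof -
  define d where "d = infdist f M"
  have M0: "0 \<in> M" using assms(2) by (rule subspace_0)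
  have "\<exists>p\<in>M. dist f p < d + 1 / real (Suc n)" for n
  proof (rule ccontr)
    assume "\<not> ?thesis"
    then have "d + 1 / real (Suc n) \<le> (INF p\<in>M. dist f p)"
      using M0 by (intro cINF_greatest) (auto simp: not_less)
    also have "\<dots> = d" unfolding d_def by (subst infdist_notempty) (use M0 in auto)
    finally show False by simp
  qed
  then obtain p where p: "\<And>n. p n \<in> M" "\<And>n. dist f (p n) < d + 1 / real (Suc n)" by metis
  have d0: "0 \<le> d" by (simp add: d_def infdist_nonneg)
  have par: "(norm (p m - p n))\<^sup>2 \<le> 2 * (norm (f - p n))\<^sup>2 + 2 * (norm (f - p m))\<^sup>2 - 4 * d\<^sup>2" for m n
  proof -
    have "(1/2) *\<^sub>R (p m + p n) \<in> M"
      using assms(2) p(1) by (intro subspace_scale subspace_add) auto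
    then have "d \<le> norm (f - (1/2) *\<^sub>R (p m + p n))"
      unfolding d_def by (metis dist_norm infdist_le)
    then have "d\<^sup>2 \<le> (norm (f - (1/2) *\<^sub>R (p m + p n)))\<^sup>2" using d0 by (simp add: power_mono)
    moreover have "(norm (p m - p n))\<^sup>2 + 4 * (norm (f - (1/2) *\<^sub>R (p m + p n)))\<^sup>2 =
        2 * (norm (f - p n))\<^sup>2 + 2 * (norm (f - p m))\<^sup>2"
      by (simp add: power2_norm_eq_inner inner_simps inner_commute algebra_simps)
    ultimately show ?thesis by linarith
  qed
  have lim: "(\<lambda>n. norm (f - p n)) \<longlonglongrightarrow> d"
  proof (rule tendsto_sandwich[of "\<lambda>n. d" _ _ "\<lambda>n. d + 1 / real (Suc n)"])
    show "\<forall>\<^sub>F n in sequentially. d \<le> norm (f - p n)"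
      using p(1) by (simp add: d_def infdist_le flip: dist_norm)
    show "\<forall>\<^sub>F n in sequentially. norm (f - p n) \<le> d + 1 / real (Suc n)"
      using p(2) by (simp add: less_imp_le flip: dist_norm)
    show "(\<lambda>n. d + 1 / real (Suc n)) \<longlonglongrightarrow> d"
      using tendsto_add[OF tendsto_const[of d] LIMSEQ_inverse_real_of_nat] by (simp add: inverse_eq_divide)
  qed auto
  have "Cauchy p"
  proof (rule CauchyI)
    fix e :: real assume "0 < e"
    have "(\<lambda>n. (norm (f - p n))\<^sup>2 - d\<^sup>2) \<longlonglongrightarrow> d\<^sup>2 - d\<^sup>2" by (intro tendsto_intros lim)
    then have "\<forall>\<^sub>F n in sequentially. (norm (f - p n))\<^sup>2 - d\<^sup>2 < e\<^sup>2 / 4"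
      using \<open>0 < e\<close> by (intro order_tendstoD) auto
    then obtain N where N: "\<And>n. N \<le> n \<Longrightarrow> (norm (f - p n))\<^sup>2 - d\<^sup>2 < e\<^sup>2 / 4"
      by (auto simp: eventually_sequentially)
    have "norm (p m - p n) < e" if "N \<le> m" "N \<le> n" for m n
    proof -
      have "(norm (p m - p n))\<^sup>2 < e\<^sup>2" using par[of m n] N[OF that(1)] N[OF that(2)] by linarith
      then show ?thesis using \<open>0 < e\<close> by (simp add: power2_less_imp_less)
    qed
    then show "\<exists>N. \<forall>m\<ge>N. \<forall>n\<ge>N. norm (p m - p n) < e" by blast
  qed
  then obtain q where q: "p \<longlonglongrightarrow> q" using Cauchy_convergent convergent_def by blast
  have qM: "q \<in> M" using closed_sequentially[OF assms(1)] p(1) q by blast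
  have "(\<lambda>n. norm (f - p n)) \<longlonglongrightarrow> norm (f - q)" by (intro tendsto_intros q)
  with lim have dq: "norm (f - q) = d" by (rule LIMSEQ_unique[symmetric])
  have "(f - q) \<bullet> g = 0" if g: "g \<in> M" for g
  proof (cases "g = 0")
    case False
    \<comment> \<open>the minimiser of the quadratic \<open>t \<mapsto> |f - q - t g|\<^sup>2\<close>\<close>
    define t where "t = ((f - q) \<bullet> g) / (g \<bullet> g)"
    have gg: "g \<bullet> g > 0" using False by simp
    have "q + t *\<^sub>R g \<in> M" using assms(2) qM g by (intro subspace_add subspace_scale)
    then have "d \<le> norm (f - (q + t *\<^sub>R g))" unfolding d_def by (metis dist_norm infdist_le)
    then have "(norm (f - q))\<^sup>2 \<le> (norm (f - (q + t *\<^sub>R g)))\<^sup>2" using d0 by (simp add: dq power_mono)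
    also have "\<dots> = (norm (f - q))\<^sup>2 - 2 * t * ((f - q) \<bullet> g) + t\<^sup>2 * (g \<bullet> g)"
      unfolding power2_norm_eq_inner by (simp add: inner_simps inner_commute algebra_simps power2_eq_square)
    also have "\<dots> = (norm (f - q))\<^sup>2 - ((f - q) \<bullet> g)\<^sup>2 / (g \<bullet> g)"
      using gg by (simp add: t_def field_simps power2_eq_square)
    finally have "((f - q) \<bullet> g)\<^sup>2 / (g \<bullet> g) \<le> 0" by simp
    then show ?thesis using gg by (simp add: divide_le_0_iff)
  qed simp
  with qM show ?thesis by blast
qed

lemma L2_subspace_imp_subspace: "L2.subspace M \<Longrightarrow> subspace M"
  by (auto simp: L2.subspace_def subspace_def scaleR_L2R_def)

lemmas L2_subspaceD = L2.subspace_0 L2.subspace_add L2.subspace_scale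

text \<open>
  Real orthogonality to a complex subspace is complex orthogonality: the imaginary part of
  \<open>\<langle>f, g\<rangle>\<close> is the real inner product with \<open>\<i> g\<close>.
\<close>

lemma L2_projection_ex:
  assumes "closed M" "L2.subspace M"
  obtains p where "p \<in> M" "\<And>g. g \<in> M \<Longrightarrow> L2_cinner (f - p) g = 0"
proof -
  obtain p where p: "p \<in> M" "\<forall>g\<in>M. (f - p) \<bullet> g = 0"
    using orthogonal_projection_exists[OF assms(1) L2_subspace_imp_subspace[OF assms(2)]] by blast
  have "L2_cinner (f - p) g = 0" if "g \<in> M" for g
    using p(2) that L2_subspaceD(3)[OF assms(2)]
    by (simp add: L2_cinner_eq_inner complex_eq_iff)
  with p(1) show thesis by (rule that)
qed

lemma L2_projection_unique:
  assumes M: "L2.subspace M"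
    and p: "p \<in> M" "\<And>g. g \<in> M \<Longrightarrow> L2_cinner (f - p) g = 0"
    and q: "q \<in> M" "\<And>g. g \<in> M \<Longrightarrow> L2_cinner (f - q) g = 0"
  shows "p = q"
proof -
  have d: "p - q \<in> M" using M p(1) q(1) by (rule L2.subspace_diff)
  have "L2_cinner (p - q) (p - q) = L2_cinner (f - q) (p - q) - L2_cinner (f - p) (p - q)"
    by (simp add: L2_cinner_diff_left)
  then have "L2_cinner (p - q) (p - q) = 0" using p(2)[OF d] q(2)[OF d] by simp
  then show ?thesis by (simp add: L2_cinner_self_eq_0)
qed

text \<open>
  The definite description in \<open>orth_proj\<close> denotes something only once the pointwise nearest vectors are
  known to form a bounded operator, which here follows from their uniqueness.
\<close>

lemma orth_proj_properties:
  assumes "closed M" "L2.subspace M"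
  shows "blinfun_apply (orth_proj M) f \<in> M"
    and "g \<in> M \<Longrightarrow> L2_cinner (f - blinfun_apply (orth_proj M) f) g = 0"
    and "orth_proj M \<in> BL2"
proof -
  note M = assms(2)
  have "\<exists>p. p \<in> M \<and> (\<forall>g\<in>M. L2_cinner (f - p) g = 0)" for f
    using L2_projection_ex[OF assms, of f] by metis
  then obtain p where pM: "\<And>f. p f \<in> M" and orth: "\<And>f g. g \<in> M \<Longrightarrow> L2_cinner (f - p f) g = 0" by metis
  have add: "p (f + g) = p f + p g" for f g
  proof (rule L2_projection_unique[OF M pM orth])
    show "L2_cinner (f + g - (p f + p g)) h = 0" if "h \<in> M" for h
    proof -
      have "f + g - (p f + p g) = (f - p f) + (g - p g)" by simp
      then show ?thesis by (simp only: L2_cinner_add_left orth[OF that]) simp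
    qed
  qed (use M pM in \<open>auto intro: L2_subspaceD\<close>)
  have scale: "p (L2_scaleC c f) = L2_scaleC c (p f)" for c f
  proof (rule L2_projection_unique[OF M pM orth])
    show "L2_cinner (L2_scaleC c f - L2_scaleC c (p f)) h = 0" if "h \<in> M" for h
      using orth[OF that, of f]
      by (simp add: L2_cinner_scaleC_left flip: L2.scale_right_diff_distrib)
  qed (use M pM in \<open>auto intro: L2_subspaceD\<close>)
  have le: "norm (p f) \<le> norm f" for f
  proof -
    have "(f - p f) \<bullet> p f = 0" using orth[OF pM, of f f] by (simp add: inner_L2R_def)
    then have "(norm f)\<^sup>2 = (norm (f - p f))\<^sup>2 + (norm (p f))\<^sup>2"
      by (simp add: power2_norm_eq_inner inner_simps inner_commute algebra_simps)
    then have "(norm (p f))\<^sup>2 \<le> (norm f)\<^sup>2" by simp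
    then show ?thesis by (rule power2_le_imp_le) (rule norm_ge_zero)
  qed
  have bl: "bounded_linear p"
    by (rule bounded_linear_intro[where K = 1]) (auto simp: add scaleR_L2R_def scale le)
  have "orth_proj M = Blinfun p"
    unfolding orth_proj_def
  proof (rule the_equality)
    show "\<forall>f. blinfun_apply (Blinfun p) f \<in> M \<and> (\<forall>g\<in>M. L2_cinner (f - blinfun_apply (Blinfun p) f) g = 0)"
      using pM orth by (simp add: bounded_linear_Blinfun_apply[OF bl])
    show "P = Blinfun p"
      if "\<forall>f. blinfun_apply P f \<in> M \<and> (\<forall>g\<in>M. L2_cinner (f - blinfun_apply P f) g = 0)" for P
    proof (rule blinfun_eqI)
      fix f
      have "blinfun_apply P f = p f"
        by (rule L2_projection_unique[OF M]) (use that pM orth in blast)+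
      then show "blinfun_apply P f = blinfun_apply (Blinfun p) f"
        by (simp add: bounded_linear_Blinfun_apply[OF bl])
    qed
  qed
  then have *: "blinfun_apply (orth_proj M) = p" by (simp add: bounded_linear_Blinfun_apply[OF bl])
  show "blinfun_apply (orth_proj M) f \<in> M"
    and "g \<in> M \<Longrightarrow> L2_cinner (f - blinfun_apply (orth_proj M) f) g = 0"
    and "orth_proj M \<in> BL2"
    unfolding BL2_def using pM orth scale by (simp_all add: *)
qed

lemma orth_proj_fixes:
  assumes "closed M" "L2.subspace M" "f \<in> M"
  shows "blinfun_apply (orth_proj M) f = f"
  using orth_proj_properties(1,2)[OF assms(1,2)] assms(3)
  by (intro L2_projection_unique[OF assms(2)]) auto

lemma eq_UNIV_if_orthogonal_trivial:
  assumes "closed M" "L2.subspace M" and triv: "\<And>g. (\<And>f. f \<in> M \<Longrightarrow> L2_cinner g f = 0) \<Longrightarrow> g = 0"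
  shows "M = UNIV"
proof -
  have "f \<in> M" for f
  proof -
    obtain p where p: "p \<in> M" "\<And>g. g \<in> M \<Longrightarrow> L2_cinner (f - p) g = 0"
      using L2_projection_ex[OF assms(1,2)] by blast
    have "f - p = 0" by (rule triv) (rule p(2))
    with p(1) show ?thesis by simp
  qed
  then show ?thesis by blast
qed

section \<open>Functions supported on a half line\<close>

text \<open>
  The multiplication by the indicator of \<open>(a,\<infinity>)\<close> is a bounded operator with fixed space \<open>L\<^sup>2(a,\<infinity>)\<close>; this
  gives closedness of that space and the density of the union of the \<open>L\<^sup>2(-n,\<infinity>)\<close>.
\<close>

lemma square_integrable_cutoff:
  assumes h: "square_integrable h" shows "square_integrable (\<lambda>x. indicator {a::real<..} x * h x)"
proof (rule square_integrable_mono[OF h])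
  show "(\<lambda>x. indicator {a<..} x * h x) \<in> borel_measurable borel"
    using square_integrable_measurable[OF h] by measurable
qed (auto simp: indicator_def)

lift_definition cutoff :: "real \<Rightarrow> L2R \<Rightarrow> L2R" is "\<lambda>a f x. indicator {a<..} x * f x"
  by (auto simp: L2_rel_def square_integrable_cutoff)

lemma cutoff_abs_L2R:
  "square_integrable f \<Longrightarrow> cutoff a (abs_L2R f) = abs_L2R (\<lambda>x. indicator {a<..} x * f x)"
  by (rule cutoff.abs_eq) (simp_all add: L2_rel_refl)

lemma vanishes_below_abs_L2R:
  "square_integrable f \<Longrightarrow> vanishes_below a (abs_L2R f) \<longleftrightarrow> (AE x in lborel. x \<le> a \<longrightarrow> f x = 0)"
  by (rule vanishes_below.abs_eq) (simp_all add: L2_rel_refl)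

lemma L2_above_iff_cutoff: "f \<in> L2_above a \<longleftrightarrow> cutoff a f = f"
proof (cases f rule: L2R_cases)
  case (1 g)
  have "(x \<le> a \<longrightarrow> g x = 0) \<longleftrightarrow> indicator {a<..} x * g x = g x" for x
    by (auto simp: indicator_def)
  then show ?thesis
    by (simp add: 1 L2_above_def vanishes_below_abs_L2R cutoff_abs_L2R abs_L2R_eq_iff square_integrable_cutoff)
qed

lemma bounded_linear_cutoff: "bounded_linear (cutoff a)"
proof (rule bounded_linear_intro[where K = 1])
  show "cutoff a (f + g) = cutoff a f + cutoff a g" for f g
    by (cases f rule: L2R_cases, cases g rule: L2R_cases)
      (simp add: abs_L2R_plus cutoff_abs_L2R square_integrable_cutoff square_integrable_add distrib_left)
  show "cutoff a (r *\<^sub>R f) = r *\<^sub>R cutoff a f" for r f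
    by (cases f rule: L2R_cases)
      (simp add: scaleR_L2R_def abs_L2R_scaleC cutoff_abs_L2R square_integrable_cutoff square_integrable_cmult mult.left_commute)
  show "norm (cutoff a f) \<le> norm f * 1" for f
  proof (cases f rule: L2R_cases)
    case (1 g)
    have "(\<integral>\<^sup>+x. ennreal ((cmod (indicator {a<..} x * g x))\<^sup>2) \<partial>lborel) \<le> (\<integral>\<^sup>+x. ennreal ((cmod (g x))\<^sup>2) \<partial>lborel)"
      by (intro nn_integral_mono) (auto simp: indicator_def)
    then have "ennreal ((norm (cutoff a f))\<^sup>2) \<le> ennreal ((norm f)\<^sup>2)"
      unfolding nn_integral_abs_L2R[OF square_integrable_cutoff[OF 1(1)]] nn_integral_abs_L2R[OF 1(1)]
      by (simp only: 1(2) cutoff_abs_L2R[OF 1(1)])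
    then have sq: "(norm (cutoff a f))\<^sup>2 \<le> (norm f)\<^sup>2" by simp
    show ?thesis using power2_le_imp_le[OF sq norm_ge_zero] by simp
  qed
qed

lemma cutoff_scaleC: "cutoff a (L2_scaleC c f) = L2_scaleC c (cutoff a f)"
  by (cases f rule: L2R_cases)
    (simp add: abs_L2R_scaleC cutoff_abs_L2R square_integrable_cutoff square_integrable_cmult mult.left_commute)

lemma closed_L2_above: "closed (L2_above a)"
proof -
  have "L2_above a = {f. cutoff a f = f}" using L2_above_iff_cutoff by blast
  then show ?thesis
    using linear_continuous_on[OF bounded_linear_cutoff] by (simp add: closed_Collect_eq)
qed

lemma subspace_L2_above: "L2.subspace (L2_above a)"
  using bounded_linear_cutoff[of a]
  by (auto simp: L2.subspace_def L2_above_iff_cutoff cutoff_scaleC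
      linear_add[OF bounded_linear.linear] linear_0[OF bounded_linear.linear])

lemma cutoff_in_L2_above: "cutoff a f \<in> L2_above a"
  by (cases f rule: L2R_cases)
    (simp add: L2_above_iff_cutoff cutoff_abs_L2R square_integrable_cutoff mult.assoc[symmetric] indicator_inter_arith[symmetric])

lemma L2_above_antimono: "a \<le> b \<Longrightarrow> L2_above b \<subseteq> L2_above a"
proof
  fix f assume "a \<le> b" "f \<in> L2_above b"
  then show "f \<in> L2_above a"
    by (cases f rule: L2R_cases) (auto simp: L2_above_def vanishes_below_abs_L2R elim!: AE_mp)
qed

lemma cutoff_tendsto: "(\<lambda>n. cutoff (- real n) f) \<longlonglongrightarrow> f"
proof (cases f rule: L2R_cases)
  case (1 g)
  have [measurable]: "g \<in> borel_measurable borel" using 1 by (simp add: square_integrable_measurable)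
  have "(\<lambda>n. abs_L2R (\<lambda>x. indicator {- real n<..} x * g x)) \<longlonglongrightarrow> abs_L2R g"
  proof (rule abs_L2R_dominated_convergence[of _ _ g])
    show "(\<lambda>n. indicator {- real n<..} x * g x) \<longlonglongrightarrow> g x" for x
    proof (rule tendsto_eventually)
      have "\<forall>\<^sub>F n in sequentially. real n > - x"
        using filterlim_real_sequentially by (simp add: filterlim_at_top_dense)
      then show "\<forall>\<^sub>F n in sequentially. indicator {- real n<..} x * g x = g x"
        by eventually_elim (auto simp: indicator_def)
    qed
    show "cmod (indicator {- real k<..} x * g x) \<le> cmod (g x)" for k x by (simp add: indicator_def)
  qed (use 1 in auto)
  then show ?thesis using 1 by (simp add: cutoff_abs_L2R)
qed

section \<open>Cauchy and Poisson kernels\<close>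

lemma nn_integral_inverse_quadratic:
  fixes a b :: real
  assumes b: "0 < b"
  shows "(\<integral>\<^sup>+x. ennreal (1 / ((x - a)\<^sup>2 + b\<^sup>2)) \<partial>lborel) = ennreal (pi / b)"
proof -
  let ?f = "\<lambda>x. 1 / ((x - a)\<^sup>2 + b\<^sup>2)" and ?F = "\<lambda>x. arctan ((x - a) / b) / b"
  have pos: "0 < (x - a)\<^sup>2 + b\<^sup>2" for x using b by (simp add: sum_power2_gt_zero_iff)
  have D: "DERIV ?F x :> ?f x" for x
  proof -
    have e: "(x - a)\<^sup>2 + b\<^sup>2 = (1 + ((x - a) / b)\<^sup>2) * (b * b)"
      using b by (simp add: distrib_right power_divide power2_eq_square)
    show ?thesis unfolding e using b by (auto intro!: derivative_eq_intros simp: divide_inverse)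
  qed
  have C: "isCont ?f x" for x using pos[of x] by (intro continuous_intros) auto
  have t: "filterlim (\<lambda>x. (x - a) / b) at_top at_top"
    using b by real_asymp
  have t': "filterlim (\<lambda>x. (x - a) / b) at_bot at_bot"
    using b by real_asymp
  have A: "(?F \<longlongrightarrow> - (pi / 2) / b) at_bot"
    using b by (intro tendsto_divide tendsto_const filterlim_compose[OF tendsto_arctan_at_bot t']) auto
  have B: "(?F \<longlongrightarrow> (pi / 2) / b) at_top"
    using b by (intro tendsto_divide tendsto_const filterlim_compose[OF tendsto_arctan_at_top t]) auto
  have A': "((?F \<circ> real_of_ereal) \<longlongrightarrow> - (pi / 2) / b) (at_right (-\<infinity>))"
    unfolding ereal_tendsto_simps using A by simp
  have B': "((?F \<circ> real_of_ereal) \<longlongrightarrow> (pi / 2) / b) (at_left \<infinity>)"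
    unfolding ereal_tendsto_simps using B by simp
  have nn: "AE x in lborel. -\<infinity> < ereal x \<longrightarrow> ereal x < \<infinity> \<longrightarrow> 0 \<le> ?f x"
    using pos by (auto intro!: less_imp_le)
  have "set_integrable lborel (einterval (-\<infinity>) \<infinity>) ?f"
    by (rule interval_integral_FTC_nonneg(1)[OF _ D C nn A' B']) auto
  then have int: "integrable lborel ?f" by (simp add: set_integrable_def)
  have "(LBINT x=-\<infinity>..\<infinity>. ?f x) = (pi / 2) / b - (- (pi / 2) / b)"
    by (rule interval_integral_FTC_nonneg(2)[OF _ D C nn A' B']) auto
  then have "(LINT x|lborel. ?f x) = pi / b"
    by (simp add: interval_lebesgue_integral_def set_lebesgue_integral_def)
  then show ?thesis using int pos by (subst nn_integral_eq_integral) (auto intro!: less_imp_le)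
qed

lemma cmod_real_minus_sq: "(cmod (of_real x - w))\<^sup>2 = (x - Re w)\<^sup>2 + (Im w)\<^sup>2"
  by (simp add: cmod_power2)

lemma nn_integral_resolvent_sq:
  assumes "Im w \<noteq> 0"
  shows "(\<integral>\<^sup>+x. ennreal (1 / (cmod (of_real x - w))\<^sup>2) \<partial>lborel) = ennreal (pi / \<bar>Im w\<bar>)"
  using nn_integral_inverse_quadratic[of "\<bar>Im w\<bar>" "Re w"] assms by (simp add: cmod_real_minus_sq)

lemma Im_le_cmod_real_minus: "\<bar>Im w\<bar> \<le> cmod (of_real x - w)"
  using abs_Im_le_cmod[of "of_real x - w"] by simp

definition cauchy_kernel :: "complex \<Rightarrow> nat \<Rightarrow> real \<Rightarrow> complex" where
  "cauchy_kernel w n t = 1 / (of_real t - w) ^ n"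

lemma borel_measurable_cauchy_kernel [measurable]: "cauchy_kernel w n \<in> borel_measurable borel"
  unfolding cauchy_kernel_def by measurable

text \<open>
  All but two of the \<open>2n\<close> factors \<open>|t - w|\<close> are estimated from below by \<open>b\<close>; the remaining two leave a
  multiple of the arctangent density.
\<close>

lemma nn_integral_cauchy_kernel_le:
  assumes b: "0 < b" "b \<le> \<bar>Im w\<bar>" and n: "1 \<le> n"
  shows "(\<integral>\<^sup>+x. ennreal ((cmod (cauchy_kernel w n x))\<^sup>2) \<partial>lborel) \<le> ennreal (pi / b ^ (2 * n - 1))"
proof -
  have "(cmod (cauchy_kernel w n x))\<^sup>2 \<le> 1 / b ^ (2 * n - 2) * (1 / (cmod (of_real x - w))\<^sup>2)" for x
  proof -
    define m where "m = cmod (of_real x - w)"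
    have m: "b \<le> m" "0 < m" using Im_le_cmod_real_minus[of w x] b by (auto simp: m_def)
    have "b ^ (2 * n - 2) * m\<^sup>2 \<le> m ^ (2 * n - 2) * m\<^sup>2"
      using m b by (intro mult_right_mono power_mono) auto
    also have "\<dots> = m ^ (2 * n)"
    proof -
      have "2 * n - 2 + 2 = 2 * n" using n by simp
      then show ?thesis by (metis power_add)
    qed
    finally have "1 / m ^ (2 * n) \<le> 1 / (b ^ (2 * n - 2) * m\<^sup>2)"
      using m b by (intro divide_left_mono mult_pos_pos) auto
    moreover have "(cmod (cauchy_kernel w n x))\<^sup>2 = 1 / m ^ (2 * n)"
      by (simp add: cauchy_kernel_def norm_divide norm_power m_def power_divide mult.commute flip: power_mult)
    ultimately show ?thesis by (simp add: m_def)
  qed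
  then have "(\<integral>\<^sup>+x. ennreal ((cmod (cauchy_kernel w n x))\<^sup>2) \<partial>lborel)
      \<le> (\<integral>\<^sup>+x. ennreal (1 / b ^ (2 * n - 2)) * ennreal (1 / (cmod (of_real x - w))\<^sup>2) \<partial>lborel)"
    using b by (intro nn_integral_mono) (simp add: ennreal_mult[symmetric] ennreal_leI)
  also have "\<dots> = ennreal (1 / b ^ (2 * n - 2)) * ennreal (pi / \<bar>Im w\<bar>)"
    using b by (subst nn_integral_cmult) (auto simp: nn_integral_resolvent_sq)
  also have "\<dots> \<le> ennreal (1 / b ^ (2 * n - 2)) * ennreal (pi / b)"
    using b by (intro mult_left_mono ennreal_leI divide_left_mono) auto
  also have "\<dots> = ennreal (pi / b ^ (2 * n - 1))"
  proof -
    have "2 * n - 1 = Suc (2 * n - 2)" using n by simp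
    then show ?thesis using b by (simp flip: ennreal_mult)
  qed
  finally show ?thesis .
qed

lemma square_integrable_cauchy_kernel:
  assumes "Im w \<noteq> 0" "1 \<le> n"
  shows "square_integrable (cauchy_kernel w n)"
  unfolding square_integrable_iff_nn_integral
  using nn_integral_cauchy_kernel_le[of "\<bar>Im w\<bar>" w n] assms
  by (auto intro: le_less_trans)

definition cauchy_vector :: "complex \<Rightarrow> nat \<Rightarrow> L2R" where
  "cauchy_vector w n = abs_L2R (cauchy_kernel w n)"

text \<open>
  Near \<open>w\<close> all kernels are dominated by \<open>2\<^sup>n\<close> times the one at \<open>w\<close>, because moving the pole by at most
  half its distance from the real line at most halves \<open>|t - w|\<close>.
\<close>

lemma continuous_on_cauchy_vector:
  assumes n: "1 \<le> n"
  shows "continuous_on {w. Im w \<noteq> 0} (\<lambda>w. cauchy_vector w n)"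
proof (rule continuous_on_sequentiallyI)
  fix u w assume u: "\<forall>k. u k \<in> {w. Im w \<noteq> 0}" and w: "w \<in> {w. Im w \<noteq> 0}" and lim: "u \<longlonglongrightarrow> w"
  have "\<forall>\<^sub>F k in sequentially. dist (u k) w < \<bar>Im w\<bar> / 2"
    using w by (intro tendstoD[OF lim]) auto
  then obtain N where N: "\<And>k. N \<le> k \<Longrightarrow> cmod (u k - w) < \<bar>Im w\<bar> / 2"
    by (auto simp: eventually_sequentially dist_norm)
  have "(\<lambda>k. abs_L2R (cauchy_kernel (u (k + N)) n)) \<longlonglongrightarrow> abs_L2R (cauchy_kernel w n)"
  proof (rule abs_L2R_dominated_convergence[where h = "\<lambda>x. 2 ^ n * cauchy_kernel w n x"])
    show "square_integrable (\<lambda>x. 2 ^ n * cauchy_kernel w n x)"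
      using w n by (intro square_integrable_cmult square_integrable_cauchy_kernel) auto
    show "cmod (cauchy_kernel (u (k + N)) n x) \<le> cmod (2 ^ n * cauchy_kernel w n x)" for k x
    proof -
      define m where "m = cmod (of_real x - w)"
      have m: "\<bar>Im w\<bar> \<le> m" "0 < m" using Im_le_cmod_real_minus[of w x] w by (auto simp: m_def)
      have "m \<le> cmod (of_real x - u (k + N)) + cmod (u (k + N) - w)"
        unfolding m_def using norm_triangle_ineq[of "of_real x - u (k + N)" "u (k + N) - w"] by simp
      then have "m / 2 \<le> cmod (of_real x - u (k + N))" using N[of "k + N"] m by simp
      then have "1 / cmod (of_real x - u (k + N)) ^ n \<le> 1 / (m / 2) ^ n"
        using m by (intro divide_left_mono power_mono mult_pos_pos zero_less_power) (auto intro: less_le_trans[of _ "m / 2"])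
      then show ?thesis
        by (simp add: cauchy_kernel_def norm_divide norm_mult norm_power m_def power_divide)
    qed
    show "(\<lambda>k. cauchy_kernel (u (k + N)) n x) \<longlonglongrightarrow> cauchy_kernel w n x" for x
    proof -
      have "of_real x - w \<noteq> 0" using w by (auto simp: complex_eq_iff)
      then show ?thesis
        unfolding cauchy_kernel_def by (intro tendsto_intros LIMSEQ_ignore_initial_segment lim) auto
    qed
  qed auto
  then show "(\<lambda>k. cauchy_vector (u k) n) \<longlonglongrightarrow> cauchy_vector w n"
    unfolding cauchy_vector_def by (rule LIMSEQ_offset)
qed

lemma cinner_cauchy_vector:
  assumes "square_integrable f" "Im w \<noteq> 0" "1 \<le> n"
  shows "L2_cinner (abs_L2R f) (cauchy_vector w n) = (LINT x|lborel. f x / (of_real x - cnj w) ^ n)"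
  using assms
  by (simp add: cauchy_vector_def cinner_abs_L2R square_integrable_cauchy_kernel cauchy_kernel_def)

definition poisson_kernel :: "complex \<Rightarrow> real \<Rightarrow> real" where
  "poisson_kernel z t = Im z / (pi * (cmod (of_real t - z))\<^sup>2)"

lemma poisson_kernel_nonneg: "0 \<le> Im z \<Longrightarrow> 0 \<le> poisson_kernel z t"
  by (simp add: poisson_kernel_def)

lemma borel_measurable_poisson_kernel [measurable]: "poisson_kernel z \<in> borel_measurable borel"
  unfolding poisson_kernel_def by measurable

lemma nn_integral_poisson_kernel:
  assumes "0 < Im z"
  shows "(\<integral>\<^sup>+t. ennreal (poisson_kernel z t) \<partial>lborel) = 1"
proof -
  have "(\<integral>\<^sup>+t. ennreal (poisson_kernel z t) \<partial>lborel) =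
      (\<integral>\<^sup>+t. ennreal (Im z / pi) * ennreal (1 / (cmod (of_real t - z))\<^sup>2) \<partial>lborel)"
    using assms by (simp add: poisson_kernel_def flip: ennreal_mult)
  also have "\<dots> = ennreal (Im z / pi) * ennreal (pi / \<bar>Im z\<bar>)"
    using assms by (subst nn_integral_cmult) (auto simp: nn_integral_resolvent_sq)
  also have "\<dots> = 1" using assms by (simp flip: ennreal_mult)
  finally show ?thesis .
qed

text \<open>
  The kernel depends only on \<open>x - t\<close> and \<open>y\<close> and is even in the former, so it is a probability density in
  \<open>x\<close> as well as in \<open>t\<close>.
\<close>

lemma nn_integral_poisson_kernel_slice:
  assumes "0 < y"
  shows "(\<integral>\<^sup>+x. ennreal (poisson_kernel (Complex x y) t) \<partial>lborel) = 1"
proof -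
  have "poisson_kernel (Complex x y) t = poisson_kernel (Complex t y) x" for x
    by (simp add: poisson_kernel_def cmod_power2 power2_commute)
  then show ?thesis using nn_integral_poisson_kernel[of "Complex t y"] assms by simp
qed

lemma square_integrable_poisson_kernel:
  assumes "0 < d" "d \<le> Im z"
  shows "square_integrable (\<lambda>t. complex_of_real (poisson_kernel z t))"
    and "norm (abs_L2R (\<lambda>t. complex_of_real (poisson_kernel z t))) \<le> sqrt (1 / d)"
proof -
  have p: "0 < Im z" using assms by simp
  have le: "(cmod (complex_of_real (poisson_kernel z t)))\<^sup>2 \<le> (1 / d) * poisson_kernel z t" for t
  proof -
    define m where "m = cmod (of_real t - z)"
    have m: "Im z \<le> m" "0 < m" using Im_le_cmod_real_minus[of z t] p by (auto simp: m_def)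
    have "d * Im z \<le> pi * m\<^sup>2"
    proof -
      have "d * Im z \<le> m * m" using assms m by (intro mult_mono) auto
      also have "\<dots> \<le> pi * m\<^sup>2" using mult_right_mono[of 1 pi "m * m"] pi_ge_two by (simp add: power2_eq_square)
      finally show ?thesis .
    qed
    then have "poisson_kernel z t \<le> 1 / d"
      using assms m p by (simp add: poisson_kernel_def field_simps flip: m_def)
    then have "poisson_kernel z t * poisson_kernel z t \<le> (1 / d) * poisson_kernel z t"
      using p by (intro mult_right_mono poisson_kernel_nonneg) auto
    then show ?thesis by (simp add: power2_eq_square)
  qed
  have "(\<integral>\<^sup>+t. ennreal ((cmod (complex_of_real (poisson_kernel z t)))\<^sup>2) \<partial>lborel)
      \<le> (\<integral>\<^sup>+t. ennreal (1 / d) * ennreal (poisson_kernel z t) \<partial>lborel)"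
    using assms p le by (intro nn_integral_mono) (auto simp: poisson_kernel_nonneg intro!: ennreal_leI simp flip: ennreal_mult)
  also have "\<dots> = ennreal ((sqrt (1 / d))\<^sup>2)"
    using assms p by (subst nn_integral_cmult) (auto simp: nn_integral_poisson_kernel)
  finally have *: "(\<integral>\<^sup>+t. ennreal ((cmod (complex_of_real (poisson_kernel z t)))\<^sup>2) \<partial>lborel)
      \<le> ennreal ((sqrt (1 / d))\<^sup>2)" .
  show "square_integrable (\<lambda>t. complex_of_real (poisson_kernel z t))"
    and "norm (abs_L2R (\<lambda>t. complex_of_real (poisson_kernel z t))) \<le> sqrt (1 / d)"
    by (rule norm_abs_L2R_le[OF _ *]; use assms in simp)+
qed

definition poisson_vector :: "complex \<Rightarrow> L2R" where
  "poisson_vector z = abs_L2R (\<lambda>t. complex_of_real (poisson_kernel z t))"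

lemma cinner_poisson_vector:
  assumes "square_integrable f" "0 < Im z"
  shows "L2_cinner (abs_L2R f) (poisson_vector z) = (LINT t|lborel. f t * complex_of_real (poisson_kernel z t))"
  using assms square_integrable_poisson_kernel(1)[of "Im z" z] by (simp add: poisson_vector_def cinner_abs_L2R)

lemma poisson_kernel_eq_cauchy_kernel:
  assumes "0 < Im z"
  shows "complex_of_real (poisson_kernel z t) = (cauchy_kernel z 1 t - cauchy_kernel (cnj z) 1 t) / (2 * pi * \<i>)"
proof -
  have ne: "of_real t - z \<noteq> 0" "of_real t - cnj z \<noteq> 0" using assms by (auto simp: complex_eq_iff)
  have "cauchy_kernel z 1 t - cauchy_kernel (cnj z) 1 t = (z - cnj z) / ((of_real t - z) * (of_real t - cnj z))"
    using ne by (simp add: cauchy_kernel_def field_simps)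
  also have "(of_real t - z) * (of_real t - cnj z) = complex_of_real ((cmod (of_real t - z))\<^sup>2)"
    unfolding complex_norm_square by simp
  also have "z - cnj z = 2 * \<i> * Im z" by (simp add: complex_eq_iff)
  finally show ?thesis by (simp add: poisson_kernel_def field_simps)
qed

text \<open>
  Splits the Poisson integral into two Cauchy integrals with poles at conjugate points; for boundary
  functions of the upper half plane only the first of the two is nonzero.
\<close>

lemma cinner_poisson_vector_eq:
  assumes "0 < Im z"
  shows "L2_cinner f (poisson_vector z) =
    (L2_cinner f (cauchy_vector (cnj z) 1) - L2_cinner f (cauchy_vector z 1)) / (2 * pi * \<i>)"
proof (cases f rule: L2R_cases)
  case (1 g)
  have *: "square_integrable (cauchy_kernel z 1)" "square_integrable (cauchy_kernel (cnj z) 1)"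
    using assms by (auto intro: square_integrable_cauchy_kernel)
  have "L2_cinner f (poisson_vector z) = (LINT t|lborel. (g t * cauchy_kernel z 1 t - g t * cauchy_kernel (cnj z) 1 t) / (2 * pi * \<i>))"
    using 1 assms by (simp add: cinner_poisson_vector poisson_kernel_eq_cauchy_kernel right_diff_distrib)
  also have "\<dots> = ((LINT t|lborel. g t * cauchy_kernel z 1 t) - (LINT t|lborel. g t * cauchy_kernel (cnj z) 1 t)) / (2 * pi * \<i>)"
    using square_integrable_mult_integrable[OF 1(1) *(1)] square_integrable_mult_integrable[OF 1(1) *(2)] by simp
  finally show ?thesis
    using 1 assms by (simp add: cinner_cauchy_vector cauchy_kernel_def)
qed

text \<open>
  Poisson integration contracts the \<open>L\<^sup>2\<close>-norm: the Cauchy-Schwarz inequality for the probability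
  density \<open>p\<close> gives \<open>|\<integral> g p|\<^sup>2 \<le> \<integral> |g|\<^sup>2 p\<close>, and the \<open>x\<close>-integral of \<open>p\<close> is again \<open>1\<close>.
\<close>

lemma nn_integral_poisson_le:
  assumes y: "0 < y"
  shows "(\<integral>\<^sup>+x. ennreal ((cmod (L2_cinner f (poisson_vector (Complex x y))))\<^sup>2) \<partial>lborel) \<le> ennreal ((norm f)\<^sup>2)"
proof (cases f rule: L2R_cases)
  case (1 g)
  have [measurable]: "g \<in> borel_measurable borel" by (rule square_integrable_measurable[OF 1(1)])
  have pw: "ennreal ((cmod (L2_cinner f (poisson_vector (Complex x y))))\<^sup>2)
      \<le> (\<integral>\<^sup>+t. ennreal ((cmod (g t))\<^sup>2) * ennreal (poisson_kernel (Complex x y) t) \<partial>lborel)" for x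
  proof -
    let ?p = "poisson_kernel (Complex x y)"
    have p0: "0 \<le> ?p t" for t using y by (simp add: poisson_kernel_nonneg)
    have int: "integrable lborel (\<lambda>t. g t * complex_of_real (?p t))"
      using y square_integrable_poisson_kernel(1)[of y "Complex x y"]
      by (intro square_integrable_mult_integrable[OF 1(1)]) simp
    have "ennreal (cmod (L2_cinner f (poisson_vector (Complex x y)))) \<le> (\<integral>\<^sup>+t. ennreal (cmod (g t * complex_of_real (?p t))) \<partial>lborel)"
      using y 1 int by (simp add: cinner_poisson_vector integral_norm_bound_ennreal)
    also have "\<dots> = (\<integral>\<^sup>+t. ennreal (cmod (g t) * sqrt (?p t)) * ennreal (sqrt (?p t)) \<partial>lborel)"
      using p0 by (intro nn_integral_cong) (simp add: norm_mult mult.assoc flip: ennreal_mult)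
    finally have "(ennreal (cmod (L2_cinner f (poisson_vector (Complex x y)))))\<^sup>2 \<le>
        (\<integral>\<^sup>+t. ennreal (cmod (g t) * sqrt (?p t)) * ennreal (sqrt (?p t)) \<partial>lborel)\<^sup>2"
      by (intro power_mono) auto
    also have "\<dots> \<le> (\<integral>\<^sup>+t. (ennreal (cmod (g t) * sqrt (?p t)))\<^sup>2 \<partial>lborel) * (\<integral>\<^sup>+t. (ennreal (sqrt (?p t)))\<^sup>2 \<partial>lborel)"
      by (rule Cauchy_Schwarz_nn_integral) auto
    also have "(\<integral>\<^sup>+t. (ennreal (sqrt (?p t)))\<^sup>2 \<partial>lborel) = 1"
      using p0 y nn_integral_poisson_kernel[of "Complex x y"] by (simp add: ennreal_power)
    also have "(\<integral>\<^sup>+t. (ennreal (cmod (g t) * sqrt (?p t)))\<^sup>2 \<partial>lborel) =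
       (\<integral>\<^sup>+t. ennreal ((cmod (g t))\<^sup>2) * ennreal (?p t) \<partial>lborel)"
      using p0 by (intro nn_integral_cong) (simp add: ennreal_power power_mult_distrib flip: ennreal_mult)
    finally show ?thesis by (simp add: ennreal_power)
  qed
  have "(\<integral>\<^sup>+x. ennreal ((cmod (L2_cinner f (poisson_vector (Complex x y))))\<^sup>2) \<partial>lborel) \<le>
     (\<integral>\<^sup>+x. \<integral>\<^sup>+t. ennreal ((cmod (g t))\<^sup>2) * ennreal (poisson_kernel (Complex x y) t) \<partial>lborel \<partial>lborel)"
    by (intro nn_integral_mono pw)
  also have "\<dots> = (\<integral>\<^sup>+t. \<integral>\<^sup>+x. ennreal ((cmod (g t))\<^sup>2) * ennreal (poisson_kernel (Complex x y) t) \<partial>lborel \<partial>lborel)"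
  proof (rule lborel_pair.Fubini')
    have "(\<lambda>(t, x). ennreal ((cmod (g t))\<^sup>2) * ennreal (y / (pi * ((t - x)\<^sup>2 + y\<^sup>2)))) \<in> borel_measurable (lborel \<Otimes>\<^sub>M lborel)"
      by measurable
    then show "(\<lambda>(t, x). ennreal ((cmod (g t))\<^sup>2) * ennreal (poisson_kernel (Complex x y) t)) \<in> borel_measurable (lborel \<Otimes>\<^sub>M lborel)"
      by (simp add: poisson_kernel_def cmod_power2)
  qed
  also have "\<dots> = (\<integral>\<^sup>+t. ennreal ((cmod (g t))\<^sup>2) \<partial>lborel)"
  proof (rule nn_integral_cong)
    fix t
    have "(\<lambda>x. ennreal (y / (pi * ((t - x)\<^sup>2 + y\<^sup>2)))) \<in> borel_measurable lborel" by measurable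
    then have "(\<lambda>x. ennreal (poisson_kernel (Complex x y) t)) \<in> borel_measurable lborel"
      by (simp add: poisson_kernel_def cmod_power2)
    then show "(\<integral>\<^sup>+x. ennreal ((cmod (g t))\<^sup>2) * ennreal (poisson_kernel (Complex x y) t) \<partial>lborel) = ennreal ((cmod (g t))\<^sup>2)"
      using y by (simp add: nn_integral_cmult nn_integral_poisson_kernel_slice)
  qed
  finally show ?thesis using 1 by (simp add: nn_integral_abs_L2R)
qed

section \<open>Moving contours across a strip\<close>

text \<open>
  The counterpart for horizontal segments of \<open>contour_integral_linepath_same_Re\<close>, obtained from the
  real axis by translation.
\<close>

lemma contour_integral_linepath_horizontal:
  assumes "a < b"
  shows "contour_integral (linepath (Complex a y) (Complex b y)) f = integral {a..b} (\<lambda>x. f (Complex x y))"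
proof -
  have "contour_integral (linepath (Complex a y) (Complex b y)) f =
      contour_integral (linepath (of_real a) (of_real b)) (\<lambda>z. f (z + \<i> * of_real y))"
  proof -
    have "linepath (Complex a y) (Complex b y) x = linepath (of_real a) (of_real b) x + \<i> * of_real y" for x
      by (simp add: linepath_def complex_eq_iff algebra_simps)
    moreover have "Complex b y - Complex a y = of_real b - of_real a" by (simp add: complex_eq_iff)
    ultimately show ?thesis by (simp add: contour_integral_integral)
  qed
  also have "\<dots> = integral {a..b} (\<lambda>x. f (of_real x + \<i> * of_real y))"
    using assms by (subst contour_integral_linepath_Reals_eq) auto
  finally show ?thesis by (simp add: Complex_eq)
qed

lemma contour_integral_rectpath:
  assumes ab: "a < b" and R: "0 < R"
    and cont: "continuous_on (path_image (rectpath (Complex (-R) a) (Complex R b))) h"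
  shows "contour_integral (rectpath (Complex (-R) a) (Complex R b)) h =
    integral {-R..R} (\<lambda>x. h (Complex x a)) - integral {-R..R} (\<lambda>x. h (Complex x b)) +
    \<i> * (integral {a..b} (\<lambda>y. h (Complex R y)) - integral {a..b} (\<lambda>y. h (Complex (-R) y)))"
proof -
  let ?p = "path_image (rectpath (Complex (-R) a) (Complex R b))"
  have p: "?p = closed_segment (Complex (-R) a) (Complex R a) \<union> closed_segment (Complex R a) (Complex R b)
     \<union> closed_segment (Complex R b) (Complex (-R) b) \<union> closed_segment (Complex (-R) b) (Complex (-R) a)"
    by (simp add: rectpath_def Let_def path_image_join Un_assoc)
  have c: "continuous_on (closed_segment (Complex (-R) a) (Complex R a)) h"
    "continuous_on (closed_segment (Complex R a) (Complex R b)) h"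
    "continuous_on (closed_segment (Complex R b) (Complex (-R) b)) h"
    "continuous_on (closed_segment (Complex (-R) b) (Complex (-R) a)) h"
    by (rule continuous_on_subset[OF cont]; simp add: p; blast)+
  note i = c[THEN contour_integrable_continuous_linepath]
  have "contour_integral (rectpath (Complex (-R) a) (Complex R b)) h =
     contour_integral (linepath (Complex (-R) a) (Complex R a)) h + (contour_integral (linepath (Complex R a) (Complex R b)) h
     + (contour_integral (linepath (Complex R b) (Complex (-R) b)) h + contour_integral (linepath (Complex (-R) b) (Complex (-R) a)) h))"
    unfolding rectpath_def Let_def using i
    by (simp add: contour_integrable_join)
  also have "contour_integral (linepath (Complex R b) (Complex (-R) b)) h = - contour_integral (linepath (Complex (-R) b) (Complex R b)) h"
    by (rule contour_integral_reverse_linepath[OF c(3)])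
  also have "contour_integral (linepath (Complex (-R) b) (Complex (-R) a)) h = - contour_integral (linepath (Complex (-R) a) (Complex (-R) b)) h"
    by (rule contour_integral_reverse_linepath[OF c(4)])
  also have "contour_integral (linepath (Complex (-R) a) (Complex (-R) b)) h = \<i> * integral {a..b} (\<lambda>y. h (Complex (-R) y))"
    using ab by (intro contour_integral_linepath_same_Re) auto
  also have "contour_integral (linepath (Complex R a) (Complex R b)) h = \<i> * integral {a..b} (\<lambda>y. h (Complex R y))"
    using ab by (intro contour_integral_linepath_same_Re) auto
  also have "contour_integral (linepath (Complex (-R) a) (Complex R a)) h = integral {-R..R} (\<lambda>x. h (Complex x a))"
    using R by (intro contour_integral_linepath_horizontal) auto
  also have "contour_integral (linepath (Complex (-R) b) (Complex R b)) h = integral {-R..R} (\<lambda>x. h (Complex x b))"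
    using R by (intro contour_integral_linepath_horizontal) auto
  finally show ?thesis by (simp add: algebra_simps)
qed

text \<open>
  Vertical sides for the rectangles below: the pair \<open>\<plusminus>R\<close> must be good simultaneously. If it never were,
  \<open>D(x) + D(-x)\<close> would be at least \<open>d\<close> on a half line.
\<close>

lemma integrable_small_symmetric_values:
  fixes D :: "real \<Rightarrow> ennreal"
  assumes [measurable]: "D \<in> borel_measurable borel" and fin: "(\<integral>\<^sup>+x. D x \<partial>lborel) < \<infinity>" and d: "0 < d"
  shows "\<exists>R>R1. D R < ennreal d \<and> D (-R) < ennreal d"
proof (rule ccontr)
  assume *: "\<not> ?thesis"
  have ge: "ennreal d \<le> D x + D (-x)" if "R1 < x" for x
    using * that by (metis add_increasing add_increasing2 not_less zero_le)
  obtain B where B: "(\<integral>\<^sup>+x. D x \<partial>lborel) = ennreal B" "0 \<le> B"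
    using fin by (cases "\<integral>\<^sup>+x. D x \<partial>lborel") auto
  obtain n :: nat where n: "2 * B < d * real n"
    using reals_Archimedean3[OF d] by (metis mult.commute)
  have "ennreal (d * real n) = (\<integral>\<^sup>+x. ennreal d * indicator {R1<..<R1 + real n} x \<partial>lborel)"
    using d by (simp add: nn_integral_cmult_indicator ennreal_mult ennreal_of_nat_eq_real_of_nat)
  also have "\<dots> \<le> (\<integral>\<^sup>+x. D x + D (-x) \<partial>lborel)"
    by (intro nn_integral_mono) (auto simp: indicator_def ge)
  also have "\<dots> = (\<integral>\<^sup>+x. D x \<partial>lborel) + (\<integral>\<^sup>+x. D (-x) \<partial>lborel)"
    by (rule nn_integral_add) auto
  also have "(\<integral>\<^sup>+x. D (-x) \<partial>lborel) = (\<integral>\<^sup>+x. D x \<partial>lborel)"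
    using nn_integral_real_affine[of D "-1" 0] by simp
  also have "(\<integral>\<^sup>+x. D x \<partial>lborel) + (\<integral>\<^sup>+x. D x \<partial>lborel) = ennreal (2 * B)"
    unfolding B(1) using B(2) by (simp flip: ennreal_plus)
  finally have "d * real n \<le> 2 * B" using B(2) by (simp add: ennreal_le_iff)
  with n show False by simp
qed

text \<open>
  If \<open>h\<close> is absolutely integrable over the outer part of a strip, then by Tonelli there are rectangles with
  arbitrarily small vertical sides, and only the two full horizontal lines survive in the limit.
  Integrability is asked only for \<open>|Re z| \<ge> R0\<close> so that \<open>h\<close> may have a pole inside the rectangles,
  which then contributes the constant \<open>c\<close>.
\<close>

lemma strip_contour_shift:
  fixes h :: "complex \<Rightarrow> complex"
  assumes ab: "a < b"
    and cont: "continuous_on {z. a \<le> Im z \<and> Im z \<le> b \<and> (R0 \<le> \<bar>Re z\<bar> \<or> Im z = a \<or> Im z = b)} h"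
    and strip: "(\<integral>\<^sup>+y. \<integral>\<^sup>+x. ennreal (cmod (h (Complex x y))) * indicator {x. R0 \<le> \<bar>x\<bar>} x * indicator {a..b} y \<partial>lborel \<partial>lborel) < \<infinity>"
    and int: "integrable lborel (\<lambda>x. h (Complex x a))" "integrable lborel (\<lambda>x. h (Complex x b))"
    and rect: "\<And>R. R0 < R \<Longrightarrow> 0 < R \<Longrightarrow> contour_integral (rectpath (Complex (-R) a) (Complex R b)) h = c"
  shows "(LINT x|lborel. h (Complex x a)) - (LINT x|lborel. h (Complex x b)) = c"
proof -
  let ?S = "{p::real \<times> real. R0 \<le> \<bar>fst p\<bar> \<and> a \<le> snd p \<and> snd p \<le> b}"
  define k where "k p = ennreal (cmod (indicat_real ?S p *\<^sub>R h (Complex (fst p) (snd p))))" for p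
  have k_eq: "k (x, y) = ennreal (cmod (h (Complex x y))) * indicator {x. R0 \<le> \<bar>x\<bar>} x * indicator {a..b} y" for x y
    by (auto simp: k_def indicator_def)
  have "closed ?S"
    by (intro closed_Collect_conj closed_Collect_le continuous_intros)
  moreover have "continuous_on ?S (\<lambda>p. h (Complex (fst p) (snd p)))"
    by (rule continuous_on_compose2[OF cont])
      (auto intro!: continuous_intros simp: Complex_eq)
  ultimately have "(\<lambda>p. indicat_real ?S p *\<^sub>R h (Complex (fst p) (snd p))) \<in> borel_measurable borel"
    by (intro borel_measurable_continuous_on_indicator) auto
  then have k_meas: "k \<in> borel_measurable (lborel \<Otimes>\<^sub>M lborel)"
    unfolding k_def lborel_prod by measurable
  define D where "D x = (\<integral>\<^sup>+y. k (x, y) \<partial>lborel)" for x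
  have D_meas: "D \<in> borel_measurable borel"
    unfolding D_def using lborel.borel_measurable_nn_integral[of "\<lambda>x y. k (x, y)" lborel] k_meas by simp
  have "(\<integral>\<^sup>+x. D x \<partial>lborel) = (\<integral>\<^sup>+y. \<integral>\<^sup>+x. k (x, y) \<partial>lborel \<partial>lborel)"
    unfolding D_def using lborel_pair.Fubini'[of "\<lambda>x y. k (x, y)"] k_meas by simp
  also have "\<dots> < \<infinity>" using strip by (simp only: k_eq)
  finally have D_fin: "(\<integral>\<^sup>+x. D x \<partial>lborel) < \<infinity>" .
  have "\<exists>R > max (real n) (max R0 0). D R < ennreal (1 / real (Suc n)) \<and> D (-R) < ennreal (1 / real (Suc n))" for n
    by (rule integrable_small_symmetric_values[OF D_meas D_fin]) simp
  then obtain R where R: "\<And>n. real n < R n" "\<And>n. R0 < R n" "\<And>n. 0 < R n"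
    and DR: "\<And>n. D (R n) < ennreal (1 / real (Suc n))" "\<And>n. D (- R n) < ennreal (1 / real (Suc n))"
    by (metis max_less_iff_conj)
  have side: "cmod (integral {a..b} (\<lambda>y. h (Complex x y))) \<le> e"
    if x: "R0 \<le> \<bar>x\<bar>" and De: "D x < ennreal e" for x e
  proof -
    have "continuous_on {a..b} (\<lambda>y. h (Complex x y))"
      by (rule continuous_on_compose2[OF cont])
        (use x in \<open>auto intro!: continuous_intros simp: Complex_eq\<close>)
    then have si: "set_integrable lborel {a..b} (\<lambda>y. h (Complex x y))"
      by (rule borel_integrable_atLeastAtMost')
    have "ennreal (cmod (integral {a..b} (\<lambda>y. h (Complex x y)))) = ennreal (cmod (LINT y|lborel. indicat_real {a..b} y *\<^sub>R h (Complex x y)))"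
      using set_borel_integral_eq_integral(2)[OF si] by (simp add: set_lebesgue_integral_def)
    also have "\<dots> \<le> (\<integral>\<^sup>+y. ennreal (cmod (indicat_real {a..b} y *\<^sub>R h (Complex x y))) \<partial>lborel)"
      using si by (intro integral_norm_bound_ennreal) (simp add: set_integrable_def)
    also have "\<dots> = D x"
      unfolding D_def k_eq using x by (intro nn_integral_cong) (auto simp: indicator_def)
    finally have "ennreal (cmod (integral {a..b} (\<lambda>y. h (Complex x y)))) < ennreal e" using De by (rule le_less_trans)
    then show ?thesis by (simp add: ennreal_less_iff)
  qed
  have R_top: "filterlim R at_top sequentially"
    by (rule filterlim_at_top_mono[OF filterlim_real_sequentially]) (use R(1) in \<open>auto intro!: always_eventually less_imp_le\<close>)
  have horiz: "(\<lambda>n. integral {- R n..R n} (\<lambda>x. h (Complex x y))) \<longlonglongrightarrow> (LINT x|lborel. h (Complex x y))"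
    if i: "integrable lborel (\<lambda>x. h (Complex x y))" for y
  proof -
    have "(\<lambda>n. LINT x|lborel. indicat_real {- R n..R n} x *\<^sub>R h (Complex x y)) \<longlonglongrightarrow> (LINT x|lborel. h (Complex x y))"
    proof (rule integral_dominated_convergence[where w = "\<lambda>x. cmod (h (Complex x y))"])
      show "AE x in lborel. (\<lambda>n. indicat_real {- R n..R n} x *\<^sub>R h (Complex x y)) \<longlonglongrightarrow> h (Complex x y)"
      proof (intro AE_I2 tendsto_eventually)
        fix x
        have "\<forall>\<^sub>F n in sequentially. \<bar>x\<bar> < R n" using R_top by (simp add: filterlim_at_top_dense)
        then show "\<forall>\<^sub>F n in sequentially. indicat_real {- R n..R n} x *\<^sub>R h (Complex x y) = h (Complex x y)"
          by eventually_elim (auto simp: indicator_def)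
      qed
    qed (use i in \<open>auto simp: indicator_def\<close>)
    moreover have "set_integrable lborel {- R n..R n} (\<lambda>x. h (Complex x y))" for n
      unfolding set_integrable_def by (rule integrable_mult_indicator[OF _ i]) simp
    then have "integral {- R n..R n} (\<lambda>x. h (Complex x y)) = (LINT x|lborel. indicat_real {- R n..R n} x *\<^sub>R h (Complex x y))" for n
      using set_borel_integral_eq_integral(2)[of "{- R n..R n}" "\<lambda>x. h (Complex x y)"]
      by (simp add: set_lebesgue_integral_def)
    ultimately show ?thesis by simp
  qed
  have sides: "(\<lambda>n. integral {a..b} (\<lambda>y. h (Complex (s * R n) y))) \<longlonglongrightarrow> 0" if "s = 1 \<or> s = -1" for s
  proof (rule Lim_null_comparison)
    have "norm (integral {a..b} (\<lambda>y. h (Complex (s * R n) y))) \<le> 1 / real (Suc n)" for n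
      by (rule side) (use that R[of n] DR[of n] in auto)
    then show "\<forall>\<^sub>F n in sequentially. norm (integral {a..b} (\<lambda>y. h (Complex (s * R n) y))) \<le> 1 / real (Suc n)"
      by simp
    show "(\<lambda>n. 1 / real (Suc n)) \<longlonglongrightarrow> 0" using LIMSEQ_inverse_real_of_nat by (simp add: inverse_eq_divide)
  qed
  have "(\<lambda>n. integral {- R n..R n} (\<lambda>x. h (Complex x a)) - integral {- R n..R n} (\<lambda>x. h (Complex x b)) +
    \<i> * (integral {a..b} (\<lambda>y. h (Complex (1 * R n) y)) - integral {a..b} (\<lambda>y. h (Complex (-1 * R n) y))))
    \<longlonglongrightarrow> (LINT x|lborel. h (Complex x a)) - (LINT x|lborel. h (Complex x b)) + \<i> * (0 - 0)"
    by (intro tendsto_intros horiz int sides) auto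
  moreover have "integral {- R n..R n} (\<lambda>x. h (Complex x a)) - integral {- R n..R n} (\<lambda>x. h (Complex x b)) +
    \<i> * (integral {a..b} (\<lambda>y. h (Complex (1 * R n) y)) - integral {a..b} (\<lambda>y. h (Complex (-1 * R n) y))) = c" for n
  proof -
    have "path_image (rectpath (Complex (- R n) a) (Complex (R n) b)) \<subseteq>
       {z. a \<le> Im z \<and> Im z \<le> b \<and> (R0 \<le> \<bar>Re z\<bar> \<or> Im z = a \<or> Im z = b)}"
      using ab R[of n] by (auto simp: path_image_rectpath)
    then have "continuous_on (path_image (rectpath (Complex (- R n) a) (Complex (R n) b))) h"
      by (rule continuous_on_subset[OF cont])
    from contour_integral_rectpath[OF ab R(3) this] rect[OF R(2) R(3)] show ?thesis by simp
  qed
  ultimately show ?thesis using LIMSEQ_unique[OF tendsto_const] by force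
qed

section \<open>The Hardy space\<close>

abbreviation upper_half_plane :: "complex set" where
  "upper_half_plane \<equiv> {z. 0 < Im z}"

definition slice :: "(complex \<Rightarrow> complex) \<Rightarrow> real \<Rightarrow> L2R" where
  "slice F y = abs_L2R (\<lambda>x. F (Complex x y))"

text \<open>
  The defining conditions of \<open>H\<^sup>2\<close> on \<open>F\<close>, restated for the horizontal slices of \<open>F\<close> as a bounded family
  of vectors in the Hilbert space.
\<close>

definition hardy_bounded :: "(complex \<Rightarrow> complex) \<Rightarrow> real \<Rightarrow> bool" where
  "hardy_bounded F C \<longleftrightarrow> F holomorphic_on upper_half_plane \<and>
     (\<forall>y>0. square_integrable (\<lambda>x. F (Complex x y)) \<and> norm (slice F y) \<le> C)"

lemma hardy_boundedD:
  assumes "hardy_bounded F C"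
  shows "F holomorphic_on upper_half_plane"
    and "0 < y \<Longrightarrow> square_integrable (\<lambda>x. F (Complex x y))"
    and "0 < y \<Longrightarrow> norm (slice F y) \<le> C"
    and "0 \<le> C"
proof -
  show "F holomorphic_on upper_half_plane"
    and "0 < y \<Longrightarrow> square_integrable (\<lambda>x. F (Complex x y))"
    and le: "0 < y \<Longrightarrow> norm (slice F y) \<le> C" for y
    using assms by (auto simp: hardy_bounded_def)
  show "0 \<le> C" using norm_ge_zero[of "slice F 1"] le[of 1] by linarith
qed

lemma slice_measurable:
  assumes "F holomorphic_on upper_half_plane" "0 < y"
  shows "(\<lambda>x. F (Complex x y)) \<in> borel_measurable borel"
proof (rule borel_measurable_continuous_onI)
  show "continuous_on UNIV (\<lambda>x. F (Complex x y))"
    by (rule continuous_on_compose2[OF holomorphic_on_imp_continuous_on[OF assms(1)]])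
      (use assms(2) in \<open>auto intro!: continuous_intros simp: Complex_eq\<close>)
qed

lemma open_upper_half_plane: "open upper_half_plane"
  by (rule open_halfspace_Im_gt)

lemma convex_upper_half_plane: "convex upper_half_plane"
  by (rule convex_halfspace_Im_gt)

lemma eventually_at_right_0: "\<forall>\<^sub>F y::real in at_right 0. 0 < y"
  by (simp add: eventually_at_right_less)

lemma hardy_boundary_iff_slice:
  assumes F: "\<And>y. 0 < y \<Longrightarrow> square_integrable (\<lambda>x. F (Complex x y))"
  shows "hardy_boundary F f \<longleftrightarrow> (slice F \<longlongrightarrow> f) (at_right 0)"
proof (cases f rule: L2R_cases)
  case (1 g)
  have "hardy_boundary F f \<longleftrightarrow>
     ((\<lambda>y. \<integral>\<^sup>+x. ennreal ((cmod (F (Complex x y) - g x))\<^sup>2) \<partial>lborel) \<longlongrightarrow> 0) (at_right 0)"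
    unfolding 1(2) by (rule hardy_boundary.abs_eq) (simp add: L2_rel_refl 1(1))
  also have "\<dots> \<longleftrightarrow> ((\<lambda>y. ennreal ((norm (slice F y - f))\<^sup>2)) \<longlongrightarrow> ennreal 0) (at_right 0)"
    unfolding ennreal_0
    by (rule tendsto_cong, rule eventually_mono[OF eventually_at_right_0])
      (simp add: nn_integral_diff_abs_L2R F 1 slice_def)
  also have "\<dots> \<longleftrightarrow> ((\<lambda>y. (norm (slice F y - f))\<^sup>2) \<longlongrightarrow> 0) (at_right 0)"
    by (rule tendsto_ennreal_iff) auto
  also have "\<dots> \<longleftrightarrow> ((\<lambda>y. norm (slice F y - f)) \<longlongrightarrow> 0) (at_right 0)"
  proof
    assume "((\<lambda>y. (norm (slice F y - f))\<^sup>2) \<longlongrightarrow> 0) (at_right 0)"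
    from tendsto_real_sqrt[OF this] show "((\<lambda>y. norm (slice F y - f)) \<longlongrightarrow> 0) (at_right 0)" by simp
  next
    assume "((\<lambda>y. norm (slice F y - f)) \<longlongrightarrow> 0) (at_right 0)"
    from tendsto_power[OF this, of 2] show "((\<lambda>y. (norm (slice F y - f))\<^sup>2) \<longlongrightarrow> 0) (at_right 0)" by simp
  qed
  also have "\<dots> \<longleftrightarrow> (slice F \<longlongrightarrow> f) (at_right 0)"
    by (simp add: tendsto_norm_zero_iff LIM_zero_iff)
  finally show ?thesis .
qed

text \<open>
  From here on \<open>H\<^sup>2\<close> is handled inside the Hilbert space: boundary values are norm limits of slices.
\<close>

lemma H2_iff: "f \<in> H2 \<longleftrightarrow> (\<exists>F C. hardy_bounded F C \<and> (slice F \<longlongrightarrow> f) (at_right 0))"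
proof
  assume "f \<in> H2"
  then obtain F where hol: "F holomorphic_on upper_half_plane"
    and sup: "(SUP y\<in>{0<..}. \<integral>\<^sup>+x. ennreal ((cmod (F (Complex x y)))\<^sup>2) \<partial>lborel) < \<infinity>"
    and bd: "hardy_boundary F f"
    by (auto simp: H2_def)
  obtain S where S: "(SUP y\<in>{0<..}. \<integral>\<^sup>+x. ennreal ((cmod (F (Complex x y)))\<^sup>2) \<partial>lborel) = ennreal S" "0 \<le> S"
    using sup by (cases "SUP y\<in>{0<..}. \<integral>\<^sup>+x. ennreal ((cmod (F (Complex x y)))\<^sup>2) \<partial>lborel") auto
  have le: "(\<integral>\<^sup>+x. ennreal ((cmod (F (Complex x y)))\<^sup>2) \<partial>lborel) \<le> ennreal ((sqrt S)\<^sup>2)" if "0 < y" for y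
    using that S(2) unfolding real_sqrt_pow2[OF S(2)] S(1)[symmetric] by (intro SUP_upper) simp
  have *: "square_integrable (\<lambda>x. F (Complex x y))" "norm (slice F y) \<le> sqrt S" if "0 < y" for y
    unfolding slice_def using S(2) by (auto intro!: norm_abs_L2R_le[OF slice_measurable[OF hol that] le[OF that]])
  then have "hardy_bounded F (sqrt S)" using hol by (auto simp: hardy_bounded_def)
  moreover have "(slice F \<longlongrightarrow> f) (at_right 0)" using bd hardy_boundary_iff_slice[OF *(1)] by simp
  ultimately show "\<exists>F C. hardy_bounded F C \<and> (slice F \<longlongrightarrow> f) (at_right 0)" by blast
next
  assume "\<exists>F C. hardy_bounded F C \<and> (slice F \<longlongrightarrow> f) (at_right 0)"
  then obtain F C where F: "hardy_bounded F C" and lim: "(slice F \<longlongrightarrow> f) (at_right 0)" by blast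
  have "(\<integral>\<^sup>+x. ennreal ((cmod (F (Complex x y)))\<^sup>2) \<partial>lborel) \<le> ennreal (C\<^sup>2)" if "0 < y" for y
    using hardy_boundedD(2,3)[OF F that]
    by (auto simp: nn_integral_abs_L2R slice_def intro!: ennreal_leI power_mono)
  then have "(SUP y\<in>{0<..}. \<integral>\<^sup>+x. ennreal ((cmod (F (Complex x y)))\<^sup>2) \<partial>lborel) \<le> ennreal (C\<^sup>2)"
    by (intro SUP_least) auto
  also have "\<dots> < \<infinity>" by simp
  finally show "f \<in> H2"
    unfolding H2_def using hardy_boundedD(1)[OF F] hardy_boundary_iff_slice[OF hardy_boundedD(2)[OF F]] lim by blast
qed

lemma slice_cauchy_kernel: "slice (\<lambda>z. 1 / (z - w) ^ n) y = cauchy_vector (w - \<i> * y) n"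
proof -
  have "Complex x y - w = of_real x - (w - \<i> * y)" for x by (simp add: Complex_eq)
  then show ?thesis by (simp only: slice_def cauchy_vector_def cauchy_kernel_def[abs_def])
qed

text \<open>
  At horizontal distance at least \<open>1\<close> from the pole the kernel is square integrable with a bound that is
  uniform in the height, also when the line passes through the height of the pole.
\<close>

lemma strip_norm_cauchy_kernel_le:
  fixes y :: real
  assumes "\<bar>Re w\<bar> + 1 \<le> \<bar>x\<bar>" "1 \<le> n"
  shows "(cmod (cauchy_kernel (w - \<i> * y) n x))\<^sup>2 \<le> 2 * (1 / ((x - Re w)\<^sup>2 + 1\<^sup>2))"
proof -
  define m where "m = cmod (of_real x - (w - \<i> * of_real y))"
  have m2: "m\<^sup>2 = (x - Re w)\<^sup>2 + (Im w - y)\<^sup>2" by (simp add: m_def cmod_real_minus_sq)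
  have "1 \<le> \<bar>x - Re w\<bar>" using assms(1) by linarith
  then have x1: "1 \<le> (x - Re w)\<^sup>2" by (metis abs_le_square_iff abs_one one_power2)
  have "1\<^sup>2 \<le> m\<^sup>2" unfolding m2 using x1 by (simp add: add_increasing2)
  then have m1: "1 \<le> m" by (rule power2_le_imp_le) (simp add: m_def)
  have "m\<^sup>2 \<le> m ^ (2 * n)" using m1 assms(2) by (intro power_increasing) auto
  then have "1 / m ^ (2 * n) \<le> 1 / m\<^sup>2" using m1 by (intro divide_left_mono mult_pos_pos) auto
  also have "\<dots> \<le> 2 * (1 / ((x - Re w)\<^sup>2 + 1\<^sup>2))"
  proof -
    have "(x - Re w)\<^sup>2 + 1\<^sup>2 \<le> 2 * m\<^sup>2" 
    proof -
      have "A + 1 \<le> 2 * (A + B)" if "1 \<le> A" "0 \<le> B" for A B :: real using that by simp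
      from this[OF x1 zero_le_power2] show ?thesis unfolding m2 one_power2 .
    qed
    then have "1 / (2 * m\<^sup>2) \<le> 1 / ((x - Re w)\<^sup>2 + 1\<^sup>2)"
      using m1 x1 by (intro divide_left_mono mult_pos_pos) auto
    then show ?thesis by simp
  qed
  finally show ?thesis
    by (simp add: cauchy_kernel_def norm_divide norm_power m_def power_divide mult.commute flip: power_mult)
qed

text \<open>
  The line at height \<open>a\<close> is compared with lines at height \<open>b \<rightarrow> \<infinity>\<close>, where the slices stay bounded while
  the norm of the kernel decays at least like \<open>b\<^sup>-\<^sup>1\<^sup>/\<^sup>2\<close>. The value \<open>c\<close> of the contour integral is left open to cover
  poles below the line (\<open>c = 0\<close>) and above it (Cauchy's formula).
\<close>

lemma hardy_contour_kernel:
  assumes F: "hardy_bounded F C" and a: "0 < a" and w: "Im w \<noteq> a" and n: "1 \<le> n"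
    and rect: "\<And>b R. \<bar>Im w\<bar> + 1 + a \<le> b \<Longrightarrow> \<bar>Re w\<bar> + 1 < R \<Longrightarrow>
        contour_integral (rectpath (Complex (-R) a) (Complex R b)) (\<lambda>z. F z / (z - w) ^ n) = c"
  shows "L2_cinner (slice F a) (cauchy_vector (cnj w + \<i> * a) n) = c"
proof -
  let ?r = "\<lambda>y. cauchy_kernel (w - \<i> * of_real y) n"
  let ?h = "\<lambda>z. F z / (z - w) ^ n"
  \<comment> \<open>from height \<open>b0\<close> on, lines stay at distance at least \<open>1\<close> from the pole\<close>
  define b0 where "b0 = \<bar>Im w\<bar> + 1 + a"
  note Fsq = hardy_boundedD(2)[OF F]
  have h_eq: "?h (Complex x y) = F (Complex x y) * ?r y x" for x y
  proof -
    have "Complex x y - w = of_real x - (w - \<i> * of_real y)" by (simp add: Complex_eq)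
    then show ?thesis by (simp only: cauchy_kernel_def times_divide_eq_right mult_1_right)
  qed
  have r_sq: "square_integrable (?r y)" if "y \<noteq> Im w" for y
    using that n by (intro square_integrable_cauchy_kernel) auto
  have ci: "L2_cinner (slice F y) (cauchy_vector (cnj w + \<i> * y) n) = (LINT x|lborel. ?h (Complex x y))"
    if "0 < y" "y \<noteq> Im w" for y
    using that n Fsq[OF that(1)] unfolding slice_def h_eq
    by (subst cinner_cauchy_vector) (auto simp: cauchy_kernel_def)
  have int: "integrable lborel (\<lambda>x. ?h (Complex x y))" if "0 < y" "y \<noteq> Im w" for y
    unfolding h_eq by (rule square_integrable_mult_integrable[OF Fsq[OF that(1)] r_sq[OF that(2)]])
  have shift: "(LINT x|lborel. ?h (Complex x a)) - (LINT x|lborel. ?h (Complex x b)) = c" if b: "b0 \<le> b" for b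
  proof (rule strip_contour_shift[of a b "\<bar>Re w\<bar> + 1"])
    show "a < b" using b by (simp add: b0_def)
    show "continuous_on {z. a \<le> Im z \<and> Im z \<le> b \<and> (\<bar>Re w\<bar> + 1 \<le> \<bar>Re z\<bar> \<or> Im z = a \<or> Im z = b)} ?h"
    proof (intro continuous_intros)
      show "continuous_on {z. a \<le> Im z \<and> Im z \<le> b \<and> (\<bar>Re w\<bar> + 1 \<le> \<bar>Re z\<bar> \<or> Im z = a \<or> Im z = b)} F"
        by (rule continuous_on_subset[OF holomorphic_on_imp_continuous_on[OF hardy_boundedD(1)[OF F]]]) (use a in auto)
    qed (use w a b in \<open>auto simp: b0_def\<close>)
    show "integrable lborel (\<lambda>x. ?h (Complex x a))" using a w by (intro int) auto
    show "integrable lborel (\<lambda>x. ?h (Complex x b))" using a b by (intro int) (auto simp: b0_def)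
    show "contour_integral (rectpath (Complex (-R) a) (Complex R b)) ?h = c" if "\<bar>Re w\<bar> + 1 < R" for R
      using rect[of b R] b that by (simp add: b0_def)
    define K where "K = C\<^sup>2 + 2 * pi"
    have K0: "0 \<le> K" by (simp add: K_def)
    have inner: "(\<integral>\<^sup>+x. ennreal (cmod (?h (Complex x y))) * indicator {x. \<bar>Re w\<bar> + 1 \<le> \<bar>x\<bar>} x * indicator {a..b} y \<partial>lborel)
        \<le> ennreal K * indicator {a..b} y" for y
    proof (cases "y \<in> {a..b}")
      case True
      then have y0: "0 < y" using a by simp
      have [measurable]: "(\<lambda>x. F (Complex x y)) \<in> borel_measurable borel"
        by (rule slice_measurable[OF hardy_boundedD(1)[OF F] y0])
      have pw: "ennreal (cmod (?h (Complex x y))) * indicator {x. \<bar>Re w\<bar> + 1 \<le> \<bar>x\<bar>} x \<le>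
          ennreal ((cmod (F (Complex x y)))\<^sup>2) + ennreal 2 * ennreal (1 / ((x - Re w)\<^sup>2 + 1\<^sup>2))" for x
      proof (cases "\<bar>Re w\<bar> + 1 \<le> \<bar>x\<bar>")
        case True
        have "cmod (?h (Complex x y)) \<le> (cmod (F (Complex x y)))\<^sup>2 + (cmod (?r y x))\<^sup>2"
        proof -
          have "0 \<le> cmod (F (Complex x y)) * cmod (?r y x)" by simp
          then show ?thesis unfolding h_eq norm_mult
            using sum_squares_bound[of "cmod (F (Complex x y))" "cmod (?r y x)"] by linarith
        qed
        also have "\<dots> \<le> (cmod (F (Complex x y)))\<^sup>2 + 2 * (1 / ((x - Re w)\<^sup>2 + 1\<^sup>2))"
          using strip_norm_cauchy_kernel_le[OF True n] by simp
        finally have "ennreal (cmod (?h (Complex x y))) \<le> ennreal ((cmod (F (Complex x y)))\<^sup>2 + 2 * (1 / ((x - Re w)\<^sup>2 + 1\<^sup>2)))"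
          by (rule ennreal_leI)
        also have "\<dots> = ennreal ((cmod (F (Complex x y)))\<^sup>2) + ennreal 2 * ennreal (1 / ((x - Re w)\<^sup>2 + 1\<^sup>2))"
        proof -
          have "ennreal (2 * (1 / ((x - Re w)\<^sup>2 + 1\<^sup>2))) = ennreal 2 * ennreal (1 / ((x - Re w)\<^sup>2 + 1\<^sup>2))"
            by (rule ennreal_mult) simp_all
          from this[symmetric] show ?thesis by (simp only:) (rule ennreal_plus, simp_all)
        qed
        finally show ?thesis using True by simp
      qed simp
      have "(\<integral>\<^sup>+x. ennreal (cmod (?h (Complex x y))) * indicator {x. \<bar>Re w\<bar> + 1 \<le> \<bar>x\<bar>} x * indicator {a..b} y \<partial>lborel) \<le>
        (\<integral>\<^sup>+x. ennreal ((cmod (F (Complex x y)))\<^sup>2) + ennreal 2 * ennreal (1 / ((x - Re w)\<^sup>2 + 1\<^sup>2)) \<partial>lborel)"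
      proof (rule nn_integral_mono)
        fix x
        show "ennreal (cmod (?h (Complex x y))) * indicator {x. \<bar>Re w\<bar> + 1 \<le> \<bar>x\<bar>} x * indicator {a..b} y \<le>
          ennreal ((cmod (F (Complex x y)))\<^sup>2) + ennreal 2 * ennreal (1 / ((x - Re w)\<^sup>2 + 1\<^sup>2))"
          using pw[of x] True by simp
      qed
      also have "\<dots> = ennreal ((norm (slice F y))\<^sup>2) + ennreal 2 * ennreal (pi / 1)"
        by (subst nn_integral_add, measurable, subst nn_integral_cmult, measurable,
            subst nn_integral_inverse_quadratic, simp, subst nn_integral_abs_L2R[OF Fsq[OF y0]])
          (simp add: slice_def)
      also have "\<dots> = ennreal ((norm (slice F y))\<^sup>2 + 2 * pi)" 
      proof -
        have "ennreal (2 * pi) = ennreal 2 * ennreal pi" by (rule ennreal_mult) simp_all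
        then show ?thesis by (simp add: ennreal_plus)
      qed
      also have "\<dots> \<le> ennreal K"
        unfolding K_def using hardy_boundedD(3)[OF F y0] by (intro ennreal_leI add_right_mono power_mono) auto
      finally show ?thesis using True by simp
    qed simp
    have "(\<integral>\<^sup>+y. \<integral>\<^sup>+x. ennreal (cmod (?h (Complex x y))) * indicator {x. \<bar>Re w\<bar> + 1 \<le> \<bar>x\<bar>} x * indicator {a..b} y \<partial>lborel \<partial>lborel)
       \<le> (\<integral>\<^sup>+y. ennreal K * indicator {a..b} y \<partial>lborel)"
      by (intro nn_integral_mono inner)
    also have "\<dots> < \<infinity>"
      using b by (simp add: nn_integral_cmult_indicator b0_def ennreal_mult_less_top)
    finally show "(\<integral>\<^sup>+y. \<integral>\<^sup>+x. ennreal (cmod (?h (Complex x y))) * indicator {x. \<bar>Re w\<bar> + 1 \<le> \<bar>x\<bar>} x * indicator {a..b} y \<partial>lborel \<partial>lborel) < \<infinity>" .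
  qed
  have top: "((\<lambda>b. LINT x|lborel. ?h (Complex x b)) \<longlongrightarrow> 0) at_top"
  proof (rule Lim_null_comparison)
    show "((\<lambda>b. 2 * C * sqrt (pi / (b - \<bar>Im w\<bar>))) \<longlongrightarrow> 0) at_top"
      by real_asymp
    show "\<forall>\<^sub>F b in at_top. norm (LINT x|lborel. ?h (Complex x b)) \<le> 2 * C * sqrt (pi / (b - \<bar>Im w\<bar>))"
      using eventually_ge_at_top[of b0]
    proof eventually_elim
      case (elim b)
      define d where "d = b - \<bar>Im w\<bar>"
      have b: "0 < b" "b \<noteq> Im w" and d: "1 \<le> d" using elim a by (auto simp: b0_def d_def)
      have "norm (cauchy_vector (cnj w + \<i> * b) n) \<le> sqrt (pi / d)"
        unfolding cauchy_vector_def
      proof (rule norm_abs_L2R_le(2))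
        have "(\<integral>\<^sup>+x. ennreal ((cmod (cauchy_kernel (cnj w + \<i> * b) n x))\<^sup>2) \<partial>lborel) \<le> ennreal (pi / d ^ (2 * n - 1))"
          using d n by (intro nn_integral_cauchy_kernel_le) (auto simp: d_def)
        also have "\<dots> \<le> ennreal (pi / d ^ 1)"
          using d n by (intro ennreal_leI divide_left_mono power_increasing mult_pos_pos) auto
        also have "\<dots> = ennreal ((sqrt (pi / d))\<^sup>2)" using d by simp
        finally show "(\<integral>\<^sup>+x. ennreal ((cmod (cauchy_kernel (cnj w + \<i> * b) n x))\<^sup>2) \<partial>lborel) \<le> ennreal ((sqrt (pi / d))\<^sup>2)" .
      qed (use d in auto)
      then have "2 * norm (slice F b) * norm (cauchy_vector (cnj w + \<i> * b) n) \<le> 2 * C * sqrt (pi / d)"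
        using hardy_boundedD(3)[OF F b(1)] hardy_boundedD(4)[OF F] d by (intro mult_mono) auto
      then show ?case
        using norm_L2_cinner_le[of "slice F b" "cauchy_vector (cnj w + \<i> * b) n"] ci[OF b] by (simp add: d_def)
    qed
  qed
  have "((\<lambda>b::real. LINT x|lborel. ?h (Complex x a)) \<longlongrightarrow> c + 0) at_top"
  proof (rule Lim_transform_eventually[OF tendsto_add[OF tendsto_const[of c] top]])
    show "\<forall>\<^sub>F b in at_top. c + (LINT x|lborel. ?h (Complex x b)) = (LINT x|lborel. ?h (Complex x a))"
      using eventually_ge_at_top[of b0] by eventually_elim (simp flip: shift)
  qed
  then have "(LINT x|lborel. ?h (Complex x a)) = c"
    by (simp add: tendsto_const_iff)
  then show ?thesis using ci[of a] a w by simp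
qed

lemma isCont_cauchy_vector:
  assumes v: "Im v \<noteq> 0" and n: "1 \<le> n"
  shows "isCont (\<lambda>w. cauchy_vector w n) v"
proof (rule continuous_on_interior[OF continuous_on_cauchy_vector[OF n]])
  have "open {w. Im w \<noteq> 0}" by (intro open_Collect_neq continuous_intros)
  then show "v \<in> interior {w. Im w \<noteq> 0}" using v by (simp add: interior_open)
qed

lemma boundary_cauchy_limit:
  assumes lim: "(slice F \<longlongrightarrow> f) (at_right 0)" and v: "Im v \<noteq> 0" and n: "1 \<le> n"
    and eq: "\<forall>\<^sub>F a in at_right 0. L2_cinner (slice F a) (cauchy_vector (v + \<i> * of_real a) n) = c"
  shows "L2_cinner f (cauchy_vector v n) = c"
proof -
  have "isCont (\<lambda>w. cauchy_vector w n) v" by (rule isCont_cauchy_vector[OF v n])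
  moreover have "((\<lambda>a. v + \<i> * complex_of_real a) \<longlongrightarrow> v + \<i> * of_real 0) (at_right 0)"
    by (intro tendsto_intros)
  then have "((\<lambda>a. v + \<i> * complex_of_real a) \<longlongrightarrow> v) (at_right 0)" by simp
  ultimately have "((\<lambda>a. cauchy_vector (v + \<i> * complex_of_real a) n) \<longlongrightarrow> cauchy_vector v n) (at_right 0)"
    by (rule isCont_tendsto_compose)
  from tendsto_L2_cinner[OF lim this] have "((\<lambda>a. c) \<longlongrightarrow> L2_cinner f (cauchy_vector v n)) (at_right (0::real))"
    by (rule Lim_transform_eventually) (rule eq)
  then show ?thesis by (simp add: tendsto_const_iff)
qed

text \<open>
  As a function of the integration variable, the conjugate kernel \<open>1 / (t - cnj v)\<^sup>n\<close> is holomorphic in the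
  upper half plane, so Cauchy's theorem applies on every slice; then the slice tends to the boundary.
\<close>

lemma H2_orthogonal_cauchy_vector:
  assumes f: "f \<in> H2" and v: "0 < Im v" and n: "1 \<le> n"
  shows "L2_cinner f (cauchy_vector v n) = 0"
proof -
  obtain F C where F: "hardy_bounded F C" and lim: "(slice F \<longlongrightarrow> f) (at_right 0)"
    using f by (auto simp: H2_iff)
  have "L2_cinner (slice F a) (cauchy_vector (v + \<i> * of_real a) n) = 0" if a: "0 < a" for a
  proof -
    have "L2_cinner (slice F a) (cauchy_vector (cnj (cnj v) + \<i> * of_real a) n) = 0"
    proof (rule hardy_contour_kernel[OF F a _ n])
      show "Im (cnj v) \<noteq> a" using v a by simp
      fix b R assume b: "\<bar>Im (cnj v)\<bar> + 1 + a \<le> b" and R: "\<bar>Re (cnj v)\<bar> + 1 < R"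
      have "((\<lambda>z. F z / (z - cnj v) ^ n) has_contour_integral 0) (rectpath (Complex (-R) a) (Complex R b))"
      proof (rule Cauchy_theorem_convex_simple[OF _ convex_upper_half_plane])
        show "(\<lambda>z. F z / (z - cnj v) ^ n) holomorphic_on upper_half_plane"
          using v by (intro holomorphic_intros hardy_boundedD(1)[OF F]) auto
        show "path_image (rectpath (Complex (-R) a) (Complex R b)) \<subseteq> upper_half_plane"
          using a b R by (auto simp: path_image_rectpath)
      qed auto
      then show "contour_integral (rectpath (Complex (-R) a) (Complex R b)) (\<lambda>z. F z / (z - cnj v) ^ n) = 0"
        by (rule contour_integral_unique)
    qed
    then show ?thesis by simp
  qed
  then show ?thesis
    using v n by (intro boundary_cauchy_limit[OF lim]) (auto intro: eventually_mono[OF eventually_at_right_0])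
qed

text \<open>
  Cauchy's formula at \<open>z\<close>; the second Cauchy integral in \<open>cinner_poisson_vector_eq\<close> vanishes by
  \<open>H2_orthogonal_cauchy_vector\<close>.
\<close>

lemma hardy_poisson_formula:
  assumes F: "hardy_bounded F C" and lim: "(slice F \<longlongrightarrow> f) (at_right 0)" and z: "0 < Im z"
  shows "F z = L2_cinner f (poisson_vector z)"
proof -
  have f: "f \<in> H2" using F lim by (auto simp: H2_iff)
  have *: "L2_cinner (slice F a) (cauchy_vector (cnj z + \<i> * of_real a) 1) = 2 * pi * \<i> * F z"
    if a: "0 < a" "a < Im z" for a
  proof (rule hardy_contour_kernel[OF F a(1)])
    fix b R assume b: "\<bar>Im z\<bar> + 1 + a \<le> b" and R: "\<bar>Re z\<bar> + 1 < R"
    let ?g = "rectpath (Complex (-R) a) (Complex R b)"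
    have "((\<lambda>\<zeta>. F \<zeta> / (\<zeta> - z)) has_contour_integral (2 * pi * \<i> * winding_number ?g z * F z)) ?g"
    proof (rule Cauchy_integral_formula_convex_simple[OF convex_upper_half_plane hardy_boundedD(1)[OF F]])
      show "z \<in> interior upper_half_plane" using z by (simp add: interior_open open_upper_half_plane)
      show "path_image ?g \<subseteq> upper_half_plane - {z}"
        using a b R by (auto simp: path_image_rectpath)
    qed auto
    moreover have "winding_number ?g z = 1"
      using a b R z by (intro winding_number_rectpath) (auto simp: in_box_complex_iff)
    ultimately have "((\<lambda>\<zeta>. F \<zeta> / (\<zeta> - z)) has_contour_integral (2 * pi * \<i> * F z)) ?g" by simp
    then show "contour_integral ?g (\<lambda>\<zeta>. F \<zeta> / (\<zeta> - z) ^ 1) = 2 * pi * \<i> * F z"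
      by (simp add: contour_integral_unique)
  qed (use a in auto)
  have "\<forall>\<^sub>F a in at_right 0. L2_cinner (slice F a) (cauchy_vector (cnj z + \<i> * of_real a) 1) = 2 * pi * \<i> * F z"
    using eventually_at_right_real[OF z] by eventually_elim (use * in auto)
  then have "L2_cinner f (cauchy_vector (cnj z) 1) = 2 * pi * \<i> * F z"
    using z by (intro boundary_cauchy_limit[OF lim]) auto
  then show ?thesis
    using H2_orthogonal_cauchy_vector[OF f z, of 1] by (simp add: cinner_poisson_vector_eq[OF z])
qed

lemma tendsto_slice_combine:
  assumes "\<And>y. 0 < y \<Longrightarrow> slice H y = g y" "(g \<longlongrightarrow> l) (at_right 0)"
  shows "(slice H \<longlongrightarrow> l) (at_right 0)"
  using assms(2) by (rule Lim_transform_eventually) (rule eventually_mono[OF eventually_at_right_0], simp add: assms(1))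

lemma subspace_H2: "L2.subspace H2"
  unfolding L2.subspace_def
proof (intro conjI ballI allI)
  have "slice (\<lambda>_. 0) y = 0" for y by (simp add: slice_def zero_L2R_def)
  then have "hardy_bounded (\<lambda>_. 0) 0 \<and> (slice (\<lambda>_. 0) \<longlongrightarrow> 0) (at_right 0)"
    by (auto simp: hardy_bounded_def square_integrable_0 intro!: tendsto_slice_combine[of _ "\<lambda>_. 0"])
  then show "0 \<in> H2" unfolding H2_iff by blast
next
  fix f g assume "f \<in> H2" "g \<in> H2"
  then obtain F C G D where F: "hardy_bounded F C" "(slice F \<longlongrightarrow> f) (at_right 0)"
    and G: "hardy_bounded G D" "(slice G \<longlongrightarrow> g) (at_right 0)" by (auto simp: H2_iff)
  note Fd = hardy_boundedD[OF F(1)] and Gd = hardy_boundedD[OF G(1)]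
  have s: "slice (\<lambda>z. F z + G z) y = slice F y + slice G y" if "0 < y" for y
    using that Fd(2) Gd(2) by (simp add: slice_def abs_L2R_plus)
  have "hardy_bounded (\<lambda>z. F z + G z) (C + D)"
    unfolding hardy_bounded_def using Fd Gd
    by (auto simp: s intro!: holomorphic_intros square_integrable_add norm_triangle_le add_mono)
  moreover have "(slice (\<lambda>z. F z + G z) \<longlongrightarrow> f + g) (at_right 0)"
    by (rule tendsto_slice_combine[OF s]) (assumption | rule tendsto_add[OF F(2) G(2)])+
  ultimately show "f + g \<in> H2" unfolding H2_iff by blast
next
  fix c f assume "f \<in> H2"
  then obtain F C where F: "hardy_bounded F C" "(slice F \<longlongrightarrow> f) (at_right 0)" by (auto simp: H2_iff)
  note Fd = hardy_boundedD[OF F(1)]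
  have s: "slice (\<lambda>z. c * F z) y = L2_scaleC c (slice F y)" if "0 < y" for y
    using that Fd(2) by (simp add: slice_def abs_L2R_scaleC)
  have "hardy_bounded (\<lambda>z. c * F z) (cmod c * C)"
    unfolding hardy_bounded_def using Fd
    by (auto simp: s norm_L2_scaleC intro!: holomorphic_intros square_integrable_cmult mult_left_mono)
  moreover have "(slice (\<lambda>z. c * F z) \<longlongrightarrow> L2_scaleC c f) (at_right 0)"
  proof (rule tendsto_slice_combine[OF s])
    show "((\<lambda>y. L2_scaleC c (slice F y)) \<longlongrightarrow> L2_scaleC c f) (at_right 0)"
      unfolding scalar_op.rep_eq[symmetric] by (intro tendsto_intros F(2))
  qed
  ultimately show "L2_scaleC c f \<in> H2" unfolding H2_iff by blast
qed

text \<open>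
  The slices of \<open>z \<mapsto> 1 / (z - w)\<^sup>n\<close> are again kernels, with the pole moved further down.
\<close>

lemma cauchy_vector_in_H2:
  assumes w: "Im w < 0" and n: "1 \<le> n"
  shows "cauchy_vector w n \<in> H2"
proof -
  let ?F = "\<lambda>z. 1 / (z - w) ^ n"
  define b where "b = - Im w"
  have b: "0 < b" using w by (simp add: b_def)
  have sq: "square_integrable (cauchy_kernel (w - \<i> * y) n)" if "0 < y" for y :: real
    using w n that by (intro square_integrable_cauchy_kernel) auto
  have "hardy_bounded ?F (sqrt (pi / b ^ (2 * n - 1)))"
    unfolding hardy_bounded_def
  proof (intro conjI allI impI)
    show "?F holomorphic_on upper_half_plane" using w by (intro holomorphic_intros) auto
    fix y :: real assume y: "0 < y"
    have "(\<lambda>x. ?F (Complex x y)) = cauchy_kernel (w - \<i> * y) n"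
    proof
      fix x
      have "Complex x y - w = of_real x - (w - \<i> * of_real y)" by (simp add: Complex_eq)
      then show "?F (Complex x y) = cauchy_kernel (w - \<i> * y) n x" by (simp only: cauchy_kernel_def)
    qed
    then show "square_integrable (\<lambda>x. ?F (Complex x y))" using sq[OF y] by simp
    have "(\<integral>\<^sup>+x. ennreal ((cmod (cauchy_kernel (w - \<i> * y) n x))\<^sup>2) \<partial>lborel) \<le> ennreal (pi / b ^ (2 * n - 1))"
      using w y n by (intro nn_integral_cauchy_kernel_le b) (auto simp: b_def)
    also have "\<dots> = ennreal ((sqrt (pi / b ^ (2 * n - 1)))\<^sup>2)" using b by simp
    finally show "norm (slice ?F y) \<le> sqrt (pi / b ^ (2 * n - 1))"
      unfolding slice_cauchy_kernel cauchy_vector_def using b by (intro norm_abs_L2R_le(2)) auto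
  qed
  moreover have "(slice ?F \<longlongrightarrow> cauchy_vector w n) (at_right 0)"
  proof (rule tendsto_slice_combine[OF slice_cauchy_kernel])
    have "isCont (\<lambda>w. cauchy_vector w n) w" using w n by (intro isCont_cauchy_vector) auto
    moreover have "((\<lambda>y. w - \<i> * complex_of_real y) \<longlongrightarrow> w - \<i> * of_real 0) (at_right 0)"
      by (intro tendsto_intros)
    then have "((\<lambda>y. w - \<i> * complex_of_real y) \<longlongrightarrow> w) (at_right 0)" by simp
    ultimately show "((\<lambda>y. cauchy_vector (w - \<i> * complex_of_real y) n) \<longlongrightarrow> cauchy_vector w n) (at_right 0)"
      by (rule isCont_tendsto_compose)
  qed
  ultimately show ?thesis unfolding H2_iff by blast
qed

lemma square_integrable_modulate:
  "square_integrable h \<Longrightarrow> square_integrable (\<lambda>x. exp (\<i> * of_real (\<beta> * x)) * h x)"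
  by (intro square_integrable_unimodular_mult)
    (auto intro!: borel_measurable_continuous_onI continuous_intros)

lemma modulation_diff: "modulation \<beta> (f - g) = modulation \<beta> f - modulation \<beta> g"
  and norm_modulation: "norm (modulation \<beta> f) = norm f"
  and modulation_0: "modulation 0 f = f"
proof -
  note m = square_integrable_modulate[of _ \<beta>]
  show "modulation \<beta> (f - g) = modulation \<beta> f - modulation \<beta> g"
    by (cases f rule: L2R_cases, cases g rule: L2R_cases)
      (simp add: abs_L2R_minus modulation_abs_L2R m square_integrable_diff right_diff_distrib
        del: of_real_mult)
  show "modulation 0 f = f"
    by (cases f rule: L2R_cases) (simp add: modulation_abs_L2R)
  show "norm (modulation \<beta> f) = norm f"
  proof (cases f rule: L2R_cases)
    case (1 g)
    have "(norm (modulation \<beta> f))\<^sup>2 = (norm f)\<^sup>2"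
      unfolding 1(2) modulation_abs_L2R[OF 1(1)] norm_abs_L2R_sq[OF 1(1)] norm_abs_L2R_sq[OF m[OF 1(1)]]
      by (simp add: norm_mult)
    then show ?thesis by simp
  qed
qed

text \<open>
  The extension is multiplied by \<open>exp (\<i> \<beta> z)\<close>, which has modulus \<open>exp (- \<beta> y) \<le> 1\<close> at height \<open>y\<close>.
\<close>

lemma modulation_H2:
  assumes \<beta>: "0 \<le> \<beta>" and f: "f \<in> H2"
  shows "modulation \<beta> f \<in> H2"
proof -
  obtain F C where F: "hardy_bounded F C" "(slice F \<longlongrightarrow> f) (at_right 0)" using f by (auto simp: H2_iff)
  note Fd = hardy_boundedD[OF F(1)]
  let ?G = "\<lambda>z. exp (\<i> * \<beta> * z) * F z"
  note m = square_integrable_modulate[of _ \<beta>]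
  have eq: "?G (Complex x y) = of_real (exp (- \<beta> * y)) * (exp (\<i> * of_real (\<beta> * x)) * F (Complex x y))" for x y
  proof -
    have "\<i> * \<beta> * Complex x y = of_real (- \<beta> * y) + \<i> * of_real (\<beta> * x)"
      by (simp add: complex_eq_iff)
    then show ?thesis by (simp only: exp_add exp_of_real mult.assoc)
  qed
  have sq: "square_integrable (\<lambda>x. ?G (Complex x y))" if "0 < y" for y
    unfolding eq by (intro square_integrable_cmult m Fd(2) that)
  have s: "slice ?G y = L2_scaleC (of_real (exp (- \<beta> * y))) (modulation \<beta> (slice F y))" if "0 < y" for y
    unfolding slice_def eq using Fd(2)[OF that] m by (simp add: modulation_abs_L2R abs_L2R_scaleC)
  have "hardy_bounded ?G C"
    unfolding hardy_bounded_def
  proof (intro conjI allI impI sq)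
    show "?G holomorphic_on upper_half_plane" by (intro holomorphic_intros Fd(1))
    fix y :: real assume y: "0 < y"
    have "norm (slice ?G y) = exp (- \<beta> * y) * norm (slice F y)"
      by (simp add: s[OF y] norm_L2_scaleC norm_modulation)
    also have "\<dots> \<le> 1 * norm (slice F y)" using \<beta> y by (intro mult_right_mono) auto
    finally show "norm (slice ?G y) \<le> C" using Fd(3)[OF y] by simp
  qed
  moreover have "(slice ?G \<longlongrightarrow> modulation \<beta> f) (at_right 0)"
  proof (rule tendsto_slice_combine[OF s])
    have "((\<lambda>y. norm (modulation \<beta> (slice F y) - modulation \<beta> f)) \<longlongrightarrow> 0) (at_right 0)"
      using F(2) by (simp add: norm_modulation tendsto_norm_zero_iff LIM_zero_iff flip: modulation_diff)
    then have "((\<lambda>y. modulation \<beta> (slice F y)) \<longlongrightarrow> modulation \<beta> f) (at_right 0)"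
      by (simp add: tendsto_norm_zero_iff LIM_zero_iff)
    moreover have "((\<lambda>y. exp (- \<beta> * y)) \<longlongrightarrow> exp (- \<beta> * 0)) (at_right 0)" by (intro tendsto_intros)
    ultimately have "((\<lambda>y. exp (- \<beta> * y) *\<^sub>R modulation \<beta> (slice F y)) \<longlongrightarrow> exp (- \<beta> * 0) *\<^sub>R modulation \<beta> f) (at_right 0)"
      by (intro tendsto_intros)
    then show "((\<lambda>y. L2_scaleC (of_real (exp (- \<beta> * y))) (modulation \<beta> (slice F y))) \<longlongrightarrow> modulation \<beta> f) (at_right 0)"
      by (simp add: scaleR_L2R_def)
  qed
  ultimately show ?thesis unfolding H2_iff by blast
qed

lemma norm_poisson_vector_le:
  assumes "0 < d" "d \<le> Im z"
  shows "norm (poisson_vector z) \<le> sqrt (1 / d)"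
  unfolding poisson_vector_def by (rule square_integrable_poisson_kernel(2)[OF assms])

text \<open>
  The limit \<open>f\<close> is extended by its Poisson integral \<open>F\<close>. By the Poisson formula \<open>F - G\<^sub>k\<close> is the Poisson
  integral of \<open>f - g\<^sub>k\<close>; this gives locally uniform convergence, hence holomorphy of \<open>F\<close>, and closeness of
  slices uniformly in the height, hence the boundary limit by an \<open>\<epsilon>/3\<close> argument.
\<close>

lemma closed_H2: "closed H2"
proof -
  have "f \<in> H2" if lim: "g \<longlonglongrightarrow> f" and g: "\<And>k. g k \<in> H2" for f g
  proof -
    obtain G C where G: "\<And>k. hardy_bounded (G k) (C k)" and Gl: "\<And>k. (slice (G k) \<longlongrightarrow> g k) (at_right 0)"
      using g unfolding H2_iff by metis
    define F where "F z = L2_cinner f (poisson_vector z)" for z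
    have GP: "G k z = L2_cinner (g k) (poisson_vector z)" if "0 < Im z" for k z
      by (rule hardy_poisson_formula[OF G Gl that])
    have diff: "F z - G k z = L2_cinner (f - g k) (poisson_vector z)" if "0 < Im z" for k z
      by (simp add: F_def GP[OF that] L2_cinner_diff_left)
    have hol: "F holomorphic_on upper_half_plane"
    proof (rule holomorphic_uniform_sequence[OF open_upper_half_plane hardy_boundedD(1)[OF G]])
      fix z :: complex assume "z \<in> upper_half_plane"
      then have z: "0 < Im z" by simp
      define d where "d = Im z / 2"
      have d: "0 < d" using z by (simp add: d_def)
      have im: "d \<le> Im u" if "u \<in> cball z d" for u
        using that abs_Im_le_cmod[of "z - u"] by (auto simp: dist_norm d_def)
      have "uniform_limit (cball z d) G F sequentially"
      proof (rule uniform_limitI)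
        fix e :: real assume e: "0 < e"
        have "(\<lambda>k. 2 * norm (f - g k) * sqrt (1 / d)) \<longlonglongrightarrow> 2 * norm (f - f) * sqrt (1 / d)"
          by (intro tendsto_intros lim)
        then have "\<forall>\<^sub>F k in sequentially. 2 * norm (f - g k) * sqrt (1 / d) < e"
          using e by (intro order_tendstoD) auto
        then show "\<forall>\<^sub>F k in sequentially. \<forall>u\<in>cball z d. dist (G k u) (F u) < e"
        proof eventually_elim
          case (elim k)
          show ?case
          proof
            fix u assume u: "u \<in> cball z d"
            have "dist (G k u) (F u) = norm (L2_cinner (f - g k) (poisson_vector u))"
              using im[OF u] d by (simp add: dist_norm norm_minus_commute flip: diff)
            also have "\<dots> \<le> 2 * norm (f - g k) * norm (poisson_vector u)" by (rule norm_L2_cinner_le)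
            also have "\<dots> \<le> 2 * norm (f - g k) * sqrt (1 / d)"
              by (intro mult_left_mono norm_poisson_vector_le d im[OF u]) auto
            also have "\<dots> < e" by (rule elim)
            finally show "dist (G k u) (F u) < e" .
          qed
        qed
      qed
      moreover have "cball z d \<subseteq> upper_half_plane" using im d by (auto intro: less_le_trans)
      ultimately show "\<exists>d>0. cball z d \<subseteq> upper_half_plane \<and> uniform_limit (cball z d) G F sequentially"
        using d by blast
    qed
    have contr: "square_integrable (\<lambda>x. H (Complex x y)) \<and> norm (slice H y) \<le> norm h"
      if y: "0 < y" and H: "H holomorphic_on upper_half_plane" and eq: "\<And>z. 0 < Im z \<Longrightarrow> H z = L2_cinner h (poisson_vector z)" for H h y
    proof -
      have "(\<integral>\<^sup>+x. ennreal ((cmod (H (Complex x y)))\<^sup>2) \<partial>lborel) \<le> ennreal ((norm h)\<^sup>2)"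
        using nn_integral_poisson_le[OF y, of h] y by (simp add: eq)
      then show ?thesis
        unfolding slice_def using norm_abs_L2R_le[OF slice_measurable[OF H y]] by auto
    qed
    have F: "hardy_bounded F (norm f)"
      unfolding hardy_bounded_def using hol contr[OF _ hol] by (auto simp: F_def)
    have close: "norm (slice F y - slice (G k) y) \<le> norm (f - g k)" if y: "0 < y" for y k
    proof -
      have "slice F y - slice (G k) y = slice (\<lambda>z. F z - G k z) y"
        using y hardy_boundedD(2)[OF F] hardy_boundedD(2)[OF G] by (simp add: slice_def abs_L2R_minus)
      then show ?thesis
        using contr[OF y, of "\<lambda>z. F z - G k z" "f - g k"] hol hardy_boundedD(1)[OF G[of k]] diff
        by (auto intro: holomorphic_intros)
    qed
    have "(slice F \<longlongrightarrow> f) (at_right 0)"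
    proof (rule tendstoI)
      fix e :: real assume e: "0 < e"
      then obtain k where k: "norm (f - g k) < e / 3"
        using LIMSEQ_D[OF lim, of "e / 3"] by (auto simp: norm_minus_commute)
      have "\<forall>\<^sub>F y in at_right 0. dist (slice (G k) y) (g k) < e / 3" using e by (intro tendstoD[OF Gl]) auto
      then show "\<forall>\<^sub>F y in at_right 0. dist (slice F y) f < e"
        using eventually_at_right_0
      proof eventually_elim
        case (elim y)
        have "slice F y - f = (slice F y - slice (G k) y) + ((slice (G k) y - g k) - (f - g k))" by simp
        then have "norm (slice F y - f) \<le> norm (slice F y - slice (G k) y) + norm ((slice (G k) y - g k) - (f - g k))"
          by (metis norm_triangle_ineq)
        then show ?case
          using close[OF elim(2), of k] k elim(1) norm_triangle_ineq4[of "slice (G k) y - g k" "f - g k"]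
          by (simp add: dist_norm)
      qed
    qed
    with F show ?thesis unfolding H2_iff by blast
  qed
  then show ?thesis by (auto simp: closed_sequential_limits)
qed

section \<open>Completeness of Cauchy kernels on a half line\<close>

text \<open>
  The rays \<open>(-\<infinity>,a)\<close> are an intersection-stable generator of the Borel sets, so the integral vanishes over
  every Borel set.
\<close>

lemma AE_zero_if_ray_integrals_zero:
  fixes w :: "real \<Rightarrow> complex"
  assumes w: "integrable lborel w"
    and ray: "\<And>a. (LINT x|lborel. indicat_real {..<a} x *\<^sub>R w x) = 0"
  shows "AE x in lborel. w x = 0"
proof (rule sigma_finite_measure.density_zero[OF lborel.sigma_finite_measure_axioms w])
  have int: "set_integrable lborel A w" if "A \<in> sets borel" for A
    unfolding set_integrable_def using that w by (intro integrable_mult_indicator) auto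
  have tot: "(LINT x|lborel. w x) = 0"
  proof -
    have "(\<lambda>n. LINT x|lborel. indicat_real {..<real n} x *\<^sub>R w x) \<longlonglongrightarrow> (LINT x|lborel. w x)"
    proof (rule integral_dominated_convergence[where w = "\<lambda>x. cmod (w x)"])
      show "AE x in lborel. (\<lambda>n. indicat_real {..<real n} x *\<^sub>R w x) \<longlonglongrightarrow> w x"
      proof (intro AE_I2 tendsto_eventually)
        fix x
        have "\<forall>\<^sub>F n in sequentially. x < real n"
          using filterlim_real_sequentially by (simp add: filterlim_at_top_dense)
        then show "\<forall>\<^sub>F n in sequentially. indicat_real {..<real n} x *\<^sub>R w x = w x"
          by eventually_elim (auto simp: indicator_def)
      qed
    qed (use w in \<open>auto simp: indicator_def\<close>)
    then show ?thesis by (simp add: ray LIMSEQ_const_iff)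
  qed
  fix A :: "real set" assume "A \<in> sets lborel"
  then have A: "A \<in> sigma_sets UNIV (range lessThan)"
    by (simp add: borel_Iio)
  have stable: "Int_stable (range (lessThan :: real \<Rightarrow> _))"
  proof -
    have "{..<a} \<inter> {..<b} = {..<min a b}" for a b :: real by auto
    then show ?thesis by (auto simp: Int_stable_def)
  qed
  have "range (lessThan :: real \<Rightarrow> _) \<subseteq> Pow UNIV" by simp
  from stable this A show "set_lebesgue_integral lborel A w = 0"
  proof (induction rule: sigma_sets_induct_disjoint)
    case (basic A)
    then show ?case using ray by (auto simp: set_lebesgue_integral_def)
  next
    case empty
    show ?case by (simp add: set_lebesgue_integral_def)
  next
    case (compl A)
    have A: "A \<in> sets borel" using compl(1) by (simp add: borel_Iio)
    have "(LINT x|lborel. indicat_real (UNIV - A) x *\<^sub>R w x) = (LINT x|lborel. w x - indicat_real A x *\<^sub>R w x)"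
      by (intro Bochner_Integration.integral_cong) (auto simp: indicator_def)
    also have "\<dots> = (LINT x|lborel. w x) - (LINT x|lborel. indicat_real A x *\<^sub>R w x)"
      using int[OF A] w by (intro Bochner_Integration.integral_diff) (auto simp: set_integrable_def)
    finally show ?case using compl(2) tot by (simp add: set_lebesgue_integral_def)
  next
    case (union A)
    have A: "A i \<in> sets borel" for i using union(2) by (auto simp: borel_Iio)
    have "(LINT x:(\<Union>i. A i)|lborel. w x) = (\<Sum>i. LINT x:(A i)|lborel. w x)"
      using union(1) A by (intro lebesgue_integral_countable_add int) (auto simp: disjoint_family_on_def)
    then show ?case by (simp add: union(3))
  qed
qed

text \<open>
  In terms of \<open>s = 1 / (1 + t) \<in> (0,1]\<close> the hypothesis says that \<open>w\<close> is orthogonal to all polynomials in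
  \<open>s\<close>, hence by Weierstrass to all continuous functions of \<open>s\<close>, and in the limit to indicators of rays.
  Writing \<open>max 0 t\<close> only keeps \<open>s\<close> in \<open>(0,1]\<close> for negative \<open>t\<close>, where \<open>w\<close> vanishes.
\<close>

lemma AE_zero_if_moments_zero:
  fixes w :: "real \<Rightarrow> complex"
  assumes w: "integrable lborel w" and neg: "\<And>t. t < 0 \<Longrightarrow> w t = 0"
    and mom: "\<And>n. (LINT t|lborel. w t * of_real ((1 / (1 + max 0 t)) ^ n)) = 0"
  shows "AE t in lborel. w t = 0"
proof (rule AE_zero_if_ray_integrals_zero[OF w])
  define s :: "real \<Rightarrow> real" where "s t = 1 / (1 + max 0 t)" for t
  have s01: "0 < s t" "s t \<le> 1" for t by (auto simp: s_def field_simps)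
  have s_meas [measurable]: "s \<in> borel_measurable borel" unfolding s_def by measurable
  have [measurable]: "w \<in> borel_measurable borel" using w by auto
  have int: "integrable lborel (\<lambda>t. w t * of_real (q (s t)))"
    if q: "q \<in> borel_measurable borel" and bd: "\<And>u. 0 \<le> u \<Longrightarrow> u \<le> 1 \<Longrightarrow> \<bar>q u\<bar> \<le> B" for q :: "real \<Rightarrow> real" and B
  proof (rule Bochner_Integration.integrable_bound[of _ "\<lambda>t. B * cmod (w t)"])
    show "integrable lborel (\<lambda>t. B * cmod (w t))" using w by auto
    show "(\<lambda>t. w t * complex_of_real (q (s t))) \<in> borel_measurable lborel" using q by measurable
    have "norm (w t * complex_of_real (q (s t))) \<le> norm (B * cmod (w t))" for t
    proof -
      have "\<bar>q (s t)\<bar> \<le> B" using s01[of t] by (intro bd) auto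
      then have "\<bar>q (s t)\<bar> * cmod (w t) \<le> B * cmod (w t)" by (rule mult_right_mono) simp
      also have "\<dots> \<le> norm (B * cmod (w t))" by simp
      finally show ?thesis by (simp add: norm_mult mult.commute)
    qed
    then show "AE t in lborel. norm (w t * complex_of_real (q (s t))) \<le> norm (B * cmod (w t))" by simp
  qed
  have pow: "integrable lborel (\<lambda>t. w t * of_real ((s t) ^ n))" for n
    by (rule int[of "\<lambda>u. u ^ n" 1]) (auto simp: power_le_one)
  have cont: "(LINT t|lborel. w t * of_real (\<phi> (s t))) = 0"
    if \<phi>: "continuous_on UNIV \<phi>" for \<phi> :: "real \<Rightarrow> real"
  proof -
    have \<phi>_meas [measurable]: "\<phi> \<in> borel_measurable borel" by (rule borel_measurable_continuous_onI[OF \<phi>])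
    have \<phi>01: "continuous_on {0..1} \<phi>" by (rule continuous_on_subset[OF \<phi>]) simp
    then have "compact (\<phi> ` {0..1})" by (intro compact_continuous_image) auto
    then obtain B where "\<And>u. u \<in> {0..1} \<Longrightarrow> \<bar>\<phi> u\<bar> \<le> B"
      using compact_imp_bounded bounded_iff by (metis (no_types, lifting) imageI real_norm_def)
    then have \<phi>int: "integrable lborel (\<lambda>t. w t * of_real (\<phi> (s t)))" by (intro int[of \<phi> B]) auto
    have "cmod (LINT t|lborel. w t * of_real (\<phi> (s t))) \<le> e * (LINT t|lborel. cmod (w t))" if e: "0 < e" for e
    proof -
      obtain p where p: "real_polynomial_function p" "\<And>u. u \<in> {0..1} \<Longrightarrow> \<bar>\<phi> u - p u\<bar> < e"
        using Stone_Weierstrass_real_polynomial_function[OF compact_Icc \<phi>01 e] by blast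
      obtain c n where pc: "p = (\<lambda>x. \<Sum>i\<le>n. c i * x ^ i)"
        using p(1) by (auto simp: real_polynomial_function_iff_sum)
      have p_eq: "w t * of_real (p (s t)) = (\<Sum>i\<le>n. of_real (c i) * (w t * of_real ((s t) ^ i)))" for t
        by (simp add: pc sum_distrib_left mult_ac)
      have pint: "integrable lborel (\<lambda>t. w t * of_real (p (s t)))"
        unfolding p_eq by (intro Bochner_Integration.integrable_sum integrable_mult_right pow)
      have "(LINT t|lborel. w t * of_real (p (s t))) = (\<Sum>i\<le>n. of_real (c i) * (LINT t|lborel. w t * of_real ((s t) ^ i)))"
      proof -
        have "(LINT t|lborel. w t * of_real (p (s t))) = (\<Sum>i\<le>n. LINT t|lborel. of_real (c i) * (w t * of_real ((s t) ^ i)))"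
          unfolding p_eq by (rule Bochner_Integration.integral_sum) (rule integrable_mult_right[OF pow])
        then show ?thesis by (simp only: integral_mult_right_zero)
      qed
      also have "\<dots> = 0" using mom by (simp add: s_def)
      finally have "(LINT t|lborel. w t * of_real (\<phi> (s t))) = (LINT t|lborel. w t * of_real (\<phi> (s t)) - w t * of_real (p (s t)))"
        using \<phi>int pint by simp
      also have "cmod \<dots> \<le> (LINT t|lborel. e * cmod (w t))"
      proof (rule Bochner_Integration.integral_norm_bound_integral)
        show "integrable lborel (\<lambda>t. w t * of_real (\<phi> (s t)) - w t * of_real (p (s t)))" using \<phi>int pint by simp
        show "integrable lborel (\<lambda>t. e * cmod (w t))" using w by auto
        show "cmod (w t * of_real (\<phi> (s t)) - w t * of_real (p (s t))) \<le> e * cmod (w t)" for t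
        proof -
          have "cmod (w t * of_real (\<phi> (s t)) - w t * of_real (p (s t))) = cmod (w t) * \<bar>\<phi> (s t) - p (s t)\<bar>"
            by (simp add: norm_mult flip: right_diff_distrib of_real_diff)
          also have "\<dots> \<le> cmod (w t) * e"
            using p(2)[of "s t"] s01[of t] by (intro mult_left_mono) auto
          finally show ?thesis by (simp add: mult.commute)
        qed
      qed
      finally show ?thesis by simp
    qed
    then have "cmod (LINT t|lborel. w t * of_real (\<phi> (s t))) \<le> 0 + e" if e: "0 < e" for e
    proof -
      let ?I = "LINT t|lborel. cmod (w t)"
      have I: "0 \<le> ?I" by simp
      have "cmod (LINT t|lborel. w t * of_real (\<phi> (s t))) \<le> (e / (?I + 1)) * ?I"
        using \<open>\<And>e. 0 < e \<Longrightarrow> _\<close>[of "e / (?I + 1)"] e I by simp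
      also have "\<dots> \<le> e"
      proof -
        have I1: "0 < ?I + 1" using I by linarith
        have "e * ?I \<le> e * (?I + 1)" using e by simp
        then show ?thesis by (simp only: times_divide_eq_left pos_divide_le_eq[OF I1])
      qed
      finally show ?thesis by simp
    qed
    then have "cmod (LINT t|lborel. w t * of_real (\<phi> (s t))) \<le> 0" by (rule field_le_epsilon)
    then show ?thesis by simp
  qed
  fix a :: real
  show "(LINT t|lborel. indicat_real {..<a} t *\<^sub>R w t) = 0"
  proof (cases "0 < a")
    case False
    then have z: "indicat_real {..<a} t *\<^sub>R w t = 0" for t by (auto simp: indicator_def neg)
    show ?thesis by (simp only: z Bochner_Integration.integral_zero)
  next
    case True
    \<comment> \<open>continuous ramps that increase to the indicator of \<open>s > 1 / (1 + a)\<close>, that is of \<open>t < a\<close>\<close>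
    define \<phi> where "\<phi> k u = min 1 (max 0 (real k * (u - 1 / (1 + a))))" for k u
    have "(\<lambda>k. LINT t|lborel. w t * of_real (\<phi> k (s t))) \<longlonglongrightarrow> (LINT t|lborel. indicat_real {..<a} t *\<^sub>R w t)"
    proof (rule integral_dominated_convergence[where w = "\<lambda>t. cmod (w t)"])
      show "AE t in lborel. (\<lambda>k. w t * of_real (\<phi> k (s t))) \<longlonglongrightarrow> indicat_real {..<a} t *\<^sub>R w t"
      proof (intro AE_I2 tendsto_eventually)
        fix t
        show "\<forall>\<^sub>F k in sequentially. w t * of_real (\<phi> k (s t)) = indicat_real {..<a} t *\<^sub>R w t"
        proof (cases "t < a")
          case t: True
          define d where "d = s t - 1 / (1 + a)"
          have "1 + max 0 t < 1 + a" using t True by simp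
          then have "1 / (1 + a) < 1 / (1 + max 0 t)"
            using True by (intro divide_strict_left_mono mult_pos_pos) (auto simp: add_pos_nonneg)
          then have d: "0 < d" by (simp add: d_def s_def)
          have "\<forall>\<^sub>F k in sequentially. 1 / d < real k"
            using filterlim_real_sequentially by (simp add: filterlim_at_top_dense)
          then show ?thesis
          proof eventually_elim
            case (elim k)
            then have "1 < real k * d" using d by (simp add: field_simps)
            then have "\<phi> k (s t) = 1" by (simp add: \<phi>_def d_def)
            then show ?case using t by simp
          qed
        next
          case False
          then have "s t \<le> 1 / (1 + a)" using True by (simp add: s_def field_simps)
          then have "real k * (s t - 1 / (1 + a)) \<le> 0" for k by (simp add: mult_le_0_iff)
          moreover have "min 1 (max 0 u) = (0::real)" if "u \<le> 0" for u using that by simp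
          ultimately have "\<phi> k (s t) = 0" for k unfolding \<phi>_def by blast
          then show ?thesis using False by simp
        qed
      qed
      show "(\<lambda>t. indicat_real {..<a} t *\<^sub>R w t) \<in> borel_measurable lborel" by measurable
      show "(\<lambda>t. w t * of_real (\<phi> k (s t))) \<in> borel_measurable lborel" for k unfolding \<phi>_def by measurable
      show "AE t in lborel. cmod (w t * of_real (\<phi> k (s t))) \<le> cmod (w t)" for k
        by (auto simp: norm_mult \<phi>_def intro!: mult_left_le)
    qed (use w in auto)
    moreover have "(LINT t|lborel. w t * of_real (\<phi> k (s t))) = 0" for k
      unfolding \<phi>_def by (intro cont continuous_intros)
    ultimately show ?thesis by (simp add: LIMSEQ_const_iff)
  qed
qed

text \<open>
  The poles \<open>- c\<^sub>k\<close> approach the point \<open>-1\<close>, which has distance \<open>1\<close> from the support of \<open>v\<close>, so dominated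
  convergence applies. One factor \<open>1 / (1 + t)\<close> is absorbed into \<open>w\<close> to make it integrable; this is why
  the moments of \<open>w\<close> of all orders including \<open>0\<close> are controlled by the exponents \<open>n \<ge> 1\<close>.
\<close>

lemma AE_zero_if_orthogonal_to_shifted_powers:
  fixes v :: "real \<Rightarrow> complex"
  assumes v: "square_integrable v" and neg: "\<And>t. t < 0 \<Longrightarrow> v t = 0"
    and c: "c \<longlonglongrightarrow> 1" "\<And>k::nat. Re (c k) = 1"
    and orth: "\<And>n k. 1 \<le> n \<Longrightarrow> (LINT t|lborel. v t / (of_real t + c k) ^ n) = 0"
  shows "AE t in lborel. v t = 0"
proof -
  have [measurable]: "v \<in> borel_measurable borel" by (rule square_integrable_measurable[OF v])
  define w where "w t = v t * of_real (1 / (1 + max 0 t))" for t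
  have sq: "square_integrable (\<lambda>t. indicator {0..} t * complex_of_real (1 / (1 + max 0 t)))"
  proof (rule square_integrable_mono)
    show "square_integrable (cauchy_kernel \<i> 1)" by (rule square_integrable_cauchy_kernel) auto
    show "(\<lambda>t::real. indicator {0..} t * complex_of_real (1 / (1 + max 0 t))) \<in> borel_measurable borel" by measurable
    fix t :: real
    show "cmod (indicator {0..} t * complex_of_real (1 / (1 + max 0 t))) \<le> cmod (cauchy_kernel \<i> 1 t)"
    proof (cases "0 \<le> t")
      case True
      have ne: "of_real t - \<i> \<noteq> 0" by (simp add: complex_eq_iff)
      have "cmod (of_real t - \<i>) \<le> 1 + t"
        using norm_triangle_ineq4[of "of_real t" \<i>] True by simp
      then have "1 / (1 + t) \<le> 1 / cmod (of_real t - \<i>)"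
        using True ne by (intro divide_left_mono mult_pos_pos) auto
      moreover have "cmod (1 + of_real t) = 1 + t" using norm_of_real[of "1 + t", where 'a = complex] True by simp
      ultimately show ?thesis using True by (simp add: cauchy_kernel_def norm_divide norm_mult max_def)
    qed simp
  qed
  have "w = (\<lambda>t. v t * (indicator {0..} t * complex_of_real (1 / (1 + max 0 t))))"
    using neg by (auto simp: w_def fun_eq_iff indicator_def)
  then have w: "integrable lborel w" using square_integrable_mult_integrable[OF v sq] by simp
  have mom: "(LINT t|lborel. w t * of_real ((1 / (1 + max 0 t)) ^ n)) = 0" for n
  proof -
    have "(\<lambda>k. LINT t|lborel. v t / (of_real t + c k) ^ Suc n) \<longlonglongrightarrow> (LINT t|lborel. w t * of_real ((1 / (1 + max 0 t)) ^ n))"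
    proof (rule integral_dominated_convergence[where w = "\<lambda>t. cmod (w t)"])
      show "(\<lambda>t. w t * of_real ((1 / (1 + max 0 t)) ^ n)) \<in> borel_measurable lborel" unfolding w_def by measurable
      show "(\<lambda>t. v t / (of_real t + c k) ^ Suc n) \<in> borel_measurable lborel" for k by measurable
      show "integrable lborel (\<lambda>t. cmod (w t))" using w by auto
      show "AE t in lborel. (\<lambda>k. v t / (of_real t + c k) ^ Suc n) \<longlonglongrightarrow> w t * of_real ((1 / (1 + max 0 t)) ^ n)"
      proof (intro AE_I2)
        fix t :: real
        show "(\<lambda>k. v t / (of_real t + c k) ^ Suc n) \<longlonglongrightarrow> w t * of_real ((1 / (1 + max 0 t)) ^ n)"
        proof (cases "0 \<le> t")
          case True
          then have ne: "of_real t + (1::complex) \<noteq> 0" by (simp add: complex_eq_iff)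
          have "(\<lambda>k. v t / (of_real t + c k) ^ Suc n) \<longlonglongrightarrow> v t / (of_real t + 1) ^ Suc n"
            using ne by (intro tendsto_intros c(1)) auto
          also have "v t / (of_real t + 1) ^ Suc n = w t * of_real ((1 / (1 + max 0 t)) ^ n)"
            using True ne by (simp add: w_def power_divide max_def add.commute)
          finally show ?thesis .
        qed (simp add: w_def neg)
      qed
      show "AE t in lborel. norm (v t / (of_real t + c k) ^ Suc n) \<le> cmod (w t)" for k
      proof (intro AE_I2)
        fix t :: real
        show "norm (v t / (of_real t + c k) ^ Suc n) \<le> cmod (w t)"
        proof (cases "0 \<le> t")
          case True
          define m where "m = cmod (of_real t + c k)"
          have m: "1 + t \<le> m" using complex_Re_le_cmod[of "of_real t + c k"] c(2)[of k] by (simp add: m_def)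
          then have "m ^ 1 \<le> m ^ Suc n" using True by (intro power_increasing) auto
          then have "1 + t \<le> m ^ Suc n" using m by simp
          then have "cmod (v t) / m ^ Suc n \<le> cmod (v t) / (1 + t)"
            using True by (intro divide_left_mono mult_pos_pos) auto
          moreover have "cmod (1 + of_real t) = 1 + t" using norm_of_real[of "1 + t", where 'a = complex] True by simp
          ultimately show ?thesis using True by (simp add: norm_divide norm_power norm_mult m_def w_def max_def)
        qed (simp add: w_def neg)
      qed
    qed
    then show ?thesis by (simp add: orth LIMSEQ_const_iff del: power_Suc)
  qed
  have "AE t in lborel. w t = 0"
    by (rule AE_zero_if_moments_zero[OF w _ mom]) (simp add: w_def neg)
  moreover have "w t = 0 \<longleftrightarrow> v t = 0" for t
  proof -
    have "1 + max 0 t \<noteq> (0::real)" by (simp add: max_def)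
    then show ?thesis by (simp add: w_def del: of_real_divide)
  qed
  ultimately show ?thesis by simp
qed

text \<open>
  The affine change of variable \<open>x = a + \<sigma> t\<close> covers right half lines (\<open>\<sigma> = 1\<close>) and left half lines
  (\<open>\<sigma> = -1\<close>) at once. The poles \<open>w\<^sub>k\<close> may approach the real point \<open>a - \<sigma>\<close> off the support from
  either side.
\<close>

lemma half_line_cauchy_completeness:
  fixes g :: "real \<Rightarrow> complex" and \<sigma> a :: real
  assumes g: "square_integrable g" and \<sigma>: "\<sigma> = 1 \<or> \<sigma> = -1"
    and zero: "\<And>x. \<sigma> * (x - a) < 0 \<Longrightarrow> g x = 0"
    and w: "w \<longlonglongrightarrow> complex_of_real (a - \<sigma>)" "\<And>k::nat. Re (w k) = a - \<sigma>"
    and orth: "\<And>n k. 1 \<le> n \<Longrightarrow> (LINT x|lborel. g x / (of_real x - w k) ^ n) = 0"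
  shows "abs_L2R g = 0"
proof -
  have \<sigma>2: "\<sigma> * \<sigma> = 1" "\<bar>\<sigma>\<bar> = 1" "\<sigma> \<noteq> 0" using \<sigma> by auto
  have [measurable]: "g \<in> borel_measurable borel" by (rule square_integrable_measurable[OF g])
  define v where "v t = g (a + \<sigma> * t)" for t
  have [measurable]: "v \<in> borel_measurable borel" unfolding v_def by measurable
  have "square_integrable v"
    unfolding square_integrable_iff_nn_integral
  proof
    have "(\<integral>\<^sup>+x. ennreal ((cmod (g x))\<^sup>2) \<partial>lborel) = ennreal \<bar>\<sigma>\<bar> * (\<integral>\<^sup>+x. ennreal ((cmod (v x))\<^sup>2) \<partial>lborel)"
      unfolding v_def by (rule nn_integral_real_affine) (use \<sigma>2 in auto)
    then show "(\<integral>\<^sup>+x. ennreal ((cmod (v x))\<^sup>2) \<partial>lborel) < \<infinity>"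
      using g unfolding square_integrable_iff_nn_integral by (simp add: \<sigma>2)
  qed simp
  moreover have "v t = 0" if "t < 0" for t
  proof -
    have "\<sigma> * (a + \<sigma> * t - a) = t" using \<sigma> by auto
    then show ?thesis using that zero[of "a + \<sigma> * t"] by (simp only: v_def)
  qed
  moreover have "(\<lambda>k. of_real \<sigma> * (of_real a - w k)) \<longlonglongrightarrow> 1"
  proof -
    have "(\<lambda>k. of_real \<sigma> * (of_real a - w k)) \<longlonglongrightarrow> of_real \<sigma> * (of_real a - complex_of_real (a - \<sigma>))"
      by (intro tendsto_intros w(1))
    then show ?thesis using \<sigma> by auto
  qed
  moreover have "Re (of_real \<sigma> * (of_real a - w k)) = 1" for k using w(2)[of k] \<sigma> by auto
  moreover have "(LINT t|lborel. v t / (of_real t + of_real \<sigma> * (of_real a - w k)) ^ n) = 0" if n: "1 \<le> n" for n k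
  proof -
    have "(LINT x|lborel. g x / (of_real x - w k) ^ n) =
        \<bar>\<sigma>\<bar> *\<^sub>R (LINT t|lborel. g (a + \<sigma> * t) / (of_real (a + \<sigma> * t) - w k) ^ n)"
      by (rule lborel_integral_real_affine) (use \<sigma>2 in auto)
    also have "(LINT t|lborel. g (a + \<sigma> * t) / (of_real (a + \<sigma> * t) - w k) ^ n) =
        (LINT t|lborel. of_real (\<sigma> ^ n) * (v t / (of_real t + of_real \<sigma> * (of_real a - w k)) ^ n))"
    proof (rule Bochner_Integration.integral_cong)
      fix t
      define Z where "Z = of_real t + of_real \<sigma> * (of_real a - w k)"
      have e1: "of_real (a + \<sigma> * t) - w k = of_real \<sigma> * Z"
        unfolding Z_def using \<sigma> by auto
      have e2: "of_real (\<sigma> ^ n) = 1 / (of_real \<sigma> :: complex) ^ n" using \<sigma> by (auto simp: power_one_over[symmetric])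
      show "g (a + \<sigma> * t) / (of_real (a + \<sigma> * t) - w k) ^ n =
         of_real (\<sigma> ^ n) * (v t / (of_real t + of_real \<sigma> * (of_real a - w k)) ^ n)"
        unfolding v_def Z_def[symmetric] e1 e2 power_mult_distrib by simp
    qed simp
    also have "\<dots> = of_real (\<sigma> ^ n) * (LINT t|lborel. v t / (of_real t + of_real \<sigma> * (of_real a - w k)) ^ n)"
      by (rule integral_mult_right_zero)
    finally show ?thesis using orth[OF n, of k] \<sigma>2 by simp
  qed
  ultimately have "AE t in lborel. v t = 0" by (rule AE_zero_if_orthogonal_to_shifted_powers)
  then have "AE x in lborel. v (- \<sigma> * a + \<sigma> * x) = 0"
    by (intro AE_borel_affine \<sigma>2) (auto simp: pred_def)
  moreover have "v (- \<sigma> * a + \<sigma> * x) = g x" for x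
    unfolding v_def using \<sigma> by auto
  ultimately have "AE x in lborel. g x = 0" by simp
  then have "abs_L2R g = abs_L2R (\<lambda>_. 0)" using g by (simp add: abs_L2R_eq_iff square_integrable_0)
  then show ?thesis by (simp add: zero_L2R_def)
qed

section \<open>Position of the Hardy space relative to half lines\<close>

lemma tendsto_inverse_Suc_complex: "(\<lambda>k. complex_of_real (1 / real (Suc k))) \<longlonglongrightarrow> 0"
proof -
  have "(\<lambda>k. complex_of_real (1 / real (Suc k))) \<longlonglongrightarrow> complex_of_real 0"
    using LIMSEQ_inverse_real_of_nat by (intro tendsto_of_real) (simp add: inverse_eq_divide)
  then show ?thesis by simp
qed

text \<open>
  A function in \<open>H\<^sup>2\<close> is annihilated by the kernels with poles below the real line; let these tend to a
  point to the left of its support.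
\<close>

lemma H2_Int_L2_above: "H2 \<inter> L2_above a = {0}"
proof
  show "{0} \<subseteq> H2 \<inter> L2_above a"
    using L2_subspaceD(1)[OF subspace_H2] L2_subspaceD(1)[OF subspace_L2_above] by blast
  have "f = 0" if f: "f \<in> H2" "f \<in> L2_above a" for f
  proof -
    obtain h where h: "square_integrable h" "f = abs_L2R h" by (rule L2R_cases)
    define g where "g x = indicator {a<..} x * h x" for x
    have g: "square_integrable g" unfolding g_def[abs_def] by (rule square_integrable_cutoff[OF h(1)])
    have fg: "f = abs_L2R g"
      using f(2) h unfolding L2_above_iff_cutoff g_def[abs_def] by (simp add: cutoff_abs_L2R)
    define w where "w k = complex_of_real (a - 1) - \<i> * of_real (1 / real (Suc k))" for k
    have "abs_L2R g = 0"
    proof (rule half_line_cauchy_completeness[OF g, of 1 a w])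
      show "g x = 0" if "1 * (x - a) < 0" for x using that by (simp add: g_def)
      have "w \<longlonglongrightarrow> complex_of_real (a - 1) - \<i> * 0"
        unfolding w_def by (intro tendsto_intros tendsto_inverse_Suc_complex)
      then show "w \<longlonglongrightarrow> complex_of_real (a - 1)" by simp
      show "Re (w k) = a - 1" for k by (simp add: w_def)
      show "(LINT x|lborel. g x / (of_real x - w k) ^ n) = 0" if n: "1 \<le> n" for n k
      proof -
        have im: "0 < Im (cnj (w k))" by (simp add: w_def)
        then have "L2_cinner f (cauchy_vector (cnj (w k)) n) = 0"
          by (rule H2_orthogonal_cauchy_vector[OF f(1) _ n])
        then show ?thesis using im n by (simp add: fg cinner_cauchy_vector[OF g])
      qed
    qed simp
    then show ?thesis by (simp add: fg)
  qed
  then show "H2 \<inter> L2_above a \<subseteq> {0}" by blast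
qed

text \<open>
  Orthogonality to \<open>L\<^sup>2(0,\<infinity>)\<close> puts the support of \<open>f\<close> on the left half line, and the kernels with poles
  below the real line belong to \<open>H\<^sup>2\<close>. Conjugation moves the poles into the upper half plane, from where
  they tend to the point \<open>1\<close> off the support.
\<close>

lemma orthogonal_H2_L2_above_trivial:
  assumes H: "\<And>h. h \<in> H2 \<Longrightarrow> L2_cinner f h = 0" and A: "\<And>h. h \<in> L2_above 0 \<Longrightarrow> L2_cinner f h = 0"
  shows "f = 0"
proof -
  obtain h where h: "square_integrable h" "f = abs_L2R h" by (rule L2R_cases)
  define g where "g x = h x - indicator {0<..} x * h x" for x
  have g: "square_integrable g"
    unfolding g_def[abs_def] by (intro square_integrable_diff square_integrable_cutoff h(1))
  have gf: "abs_L2R g = f - cutoff 0 f"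
    unfolding g_def[abs_def] using h by (simp add: cutoff_abs_L2R abs_L2R_minus square_integrable_cutoff)
  have "L2_cinner (f - cutoff 0 f) (cutoff 0 f) = 0"
  proof -
    have z: "(h x - indicator {0<..} x * h x) * cnj (indicator {0<..} x * h x) = 0" for x
      by (simp add: indicator_def)
    show ?thesis
      unfolding h(2) cutoff_abs_L2R[OF h(1)] abs_L2R_minus[OF h(1) square_integrable_cutoff[OF h(1)]]
      by (subst cinner_abs_L2R[OF square_integrable_diff[OF h(1) square_integrable_cutoff[OF h(1)]] square_integrable_cutoff[OF h(1)]])
        (simp only: z Bochner_Integration.integral_zero)
  qed
  then have "L2_cinner (cutoff 0 f) (cutoff 0 f) = 0"
    using A[OF cutoff_in_L2_above] by (simp add: L2_cinner_diff_left)
  then have "cutoff 0 f = 0" by (simp add: L2_cinner_self_eq_0)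
  with gf have fg: "f = abs_L2R g" by simp
  define w where "w k = complex_of_real 1 + \<i> * of_real (1 / real (Suc k))" for k
  have "abs_L2R g = 0"
  proof (rule half_line_cauchy_completeness[OF g, of "-1" 0 w])
    show "g x = 0" if "-1 * (x - 0) < 0" for x using that by (simp add: g_def)
    have "w \<longlonglongrightarrow> complex_of_real 1 + \<i> * 0"
      unfolding w_def by (intro tendsto_intros tendsto_inverse_Suc_complex)
    then show "w \<longlonglongrightarrow> complex_of_real (0 - -1)" by simp
    show "Re (w k) = 0 - -1" for k by (simp add: w_def)
    show "(LINT x|lborel. g x / (of_real x - w k) ^ n) = 0" if n: "1 \<le> n" for n k
    proof -
      have im: "Im (cnj (w k)) < 0" by (simp add: w_def)
      then have "L2_cinner f (cauchy_vector (cnj (w k)) n) = 0"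
        by (intro H cauchy_vector_in_H2 n)
      then show ?thesis using im n by (simp add: fg cinner_cauchy_vector[OF g])
    qed
  qed simp
  then show ?thesis by (simp add: fg)
qed

section \<open>Complex-linear operators and finite-dimensional subspaces\<close>

lemma BL2_scaleC: "T \<in> BL2 \<Longrightarrow> blinfun_apply T (L2_scaleC c f) = L2_scaleC c (blinfun_apply T f)"
  by (simp add: BL2_def)

lemma BL2_compose: "S \<in> BL2 \<Longrightarrow> T \<in> BL2 \<Longrightarrow> S o\<^sub>L T \<in> BL2"
  by (simp add: BL2_def)

lemma BL2_add: "S \<in> BL2 \<Longrightarrow> T \<in> BL2 \<Longrightarrow> S + T \<in> BL2"
  by (simp add: BL2_def blinfun.add_left L2.scale_right_distrib)

lemma BL2_diff: "S \<in> BL2 \<Longrightarrow> T \<in> BL2 \<Longrightarrow> S - T \<in> BL2"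
  by (simp add: BL2_def blinfun.diff_left L2.scale_right_diff_distrib)

lemma BL2_id: "id_blinfun \<in> BL2"
  by (simp add: BL2_def)

lemma BL2_zero: "0 \<in> BL2"
  by (simp add: BL2_def)

lemma BL2_sum: "(\<And>i. i \<in> A \<Longrightarrow> S i \<in> BL2) \<Longrightarrow> sum S A \<in> BL2"
  by (induction A rule: infinite_finite_induct) (auto intro: BL2_zero BL2_add)

lemma BL2_scalar_op: "scalar_op c \<in> BL2"
  by (simp add: BL2_def scalar_op.rep_eq mult.commute)

lemma subspace_image_BL2:
  assumes "T \<in> BL2" "L2.subspace M"
  shows "L2.subspace (blinfun_apply T ` M)"
  unfolding L2.subspace_def
proof (intro conjI ballI allI)
  show "0 \<in> blinfun_apply T ` M"
    using L2.subspace_0[OF assms(2)] by (metis blinfun.zero_right imageI)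
  show "x + y \<in> blinfun_apply T ` M" if "x \<in> blinfun_apply T ` M" "y \<in> blinfun_apply T ` M" for x y
    using that L2.subspace_add[OF assms(2)] by (auto simp flip: blinfun.add_right)
  show "L2_scaleC c x \<in> blinfun_apply T ` M" if "x \<in> blinfun_apply T ` M" for c x
    using that L2.subspace_scale[OF assms(2)] by (auto simp flip: BL2_scaleC[OF assms(1)])
qed

lemma span_image_BL2:
  assumes "T \<in> BL2"
  shows "blinfun_apply T ` L2.span C \<subseteq> L2.span (blinfun_apply T ` C)"
proof -
  have "L2.span C \<subseteq> {f. blinfun_apply T f \<in> L2.span (blinfun_apply T ` C)}"
    by (rule L2.span_minimal)
      (auto simp: L2.subspace_def blinfun.add_right BL2_scaleC[OF assms] intro: L2.span_base L2.span_zero L2.span_add L2.span_scale)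
  then show ?thesis by blast
qed

definition rank_one :: "L2R \<Rightarrow> L2R \<Rightarrow> L2R \<Rightarrow>\<^sub>L L2R" where
  "rank_one u e = Blinfun (\<lambda>f. L2_scaleC (L2_cinner f u) e)"

lemma rank_one_apply: "blinfun_apply (rank_one u e) f = L2_scaleC (L2_cinner f u) e"
proof -
  have "bounded_linear (\<lambda>f. L2_scaleC (L2_cinner f u) e)"
  proof (rule bounded_linear_intro[where K = "2 * norm u * norm e"])
    show "L2_scaleC (L2_cinner (f + g) u) e = L2_scaleC (L2_cinner f u) e + L2_scaleC (L2_cinner g u) e" for f g
      by (simp add: L2_cinner_add_left L2.scale_left_distrib)
    show "L2_scaleC (L2_cinner (r *\<^sub>R f) u) e = r *\<^sub>R L2_scaleC (L2_cinner f u) e" for r f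
      by (simp add: scaleR_L2R_def L2_cinner_scaleC_left)
    show "norm (L2_scaleC (L2_cinner f u) e) \<le> norm f * (2 * norm u * norm e)" for f
      using mult_right_mono[OF norm_L2_cinner_le[of f u] norm_ge_zero[of e]]
      by (simp add: norm_L2_scaleC mult_ac)
  qed
  then show ?thesis by (simp add: rank_one_def bounded_linear_Blinfun_apply)
qed

lemma BL2_rank_one: "rank_one u e \<in> BL2"
  by (simp add: BL2_def rank_one_apply L2_cinner_scaleC_left)

lemma L2_cinner_sum_left: "L2_cinner (sum g S) x = (\<Sum>i\<in>S. L2_cinner (g i) x)"
  by (rule bounded_bilinear.sum_left[OF bounded_bilinear_L2_cinner])

lemma L2_span_orthogonal:
  assumes "\<And>b. b \<in> B \<Longrightarrow> L2_cinner h b = 0" "x \<in> L2.span B"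
  shows "L2_cinner h x = 0"
proof -
  have "L2.subspace {x. L2_cinner h x = 0}"
    by (auto simp: L2.subspace_def L2_cinner_add_right L2_cinner_scaleC_right)
  then have "L2.span B \<subseteq> {x. L2_cinner h x = 0}" using assms(1) by (intro L2.span_minimal) auto
  with assms(2) show ?thesis by blast
qed

text \<open>
  Gram-Schmidt without normalisation.
\<close>

lemma orthogonal_basis_exists:
  assumes "finite C" "L2.independent C"
  shows "\<exists>e::nat \<Rightarrow> L2R. (\<forall>i<card C. e i \<noteq> 0) \<and> (\<forall>i<card C. \<forall>j<card C. i \<noteq> j \<longrightarrow> L2_cinner (e i) (e j) = 0) \<and>
     L2.span (e ` {..<card C}) = L2.span C"
  using assms
proof (induction C rule: finite_induct)
  case empty
  show ?case by simp
next
  case (insert x C)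
  have xC: "x \<notin> L2.span C" and indC: "L2.independent C"
    using insert.prems insert.hyps(2) by (auto simp: L2.independent_insert)
  define n where "n = card C"
  obtain e :: "nat \<Rightarrow> L2R" where e: "\<forall>i<n. e i \<noteq> 0"
      "\<forall>i<n. \<forall>j<n. i \<noteq> j \<longrightarrow> L2_cinner (e i) (e j) = 0"
    and sp: "L2.span (e ` {..<n}) = L2.span C"
    using insert.IH[OF indC] unfolding n_def[symmetric] by (elim exE conjE)
  have e0: "e i \<noteq> 0" if "i < n" for i using e(1) that by simp
  have orth: "L2_cinner (e i) (e j) = 0" if "i < n" "j < n" "i \<noteq> j" for i j using e(2) that by simp
  define p where "p = (\<Sum>i<n. L2_scaleC (L2_cinner x (e i) / L2_cinner (e i) (e i)) (e i))"
  have pC: "p \<in> L2.span C"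
    unfolding p_def sp[symmetric] by (intro L2.span_sum L2.span_scale L2.span_base) auto
  have "x - p \<noteq> 0" using xC pC by auto
  have xp: "L2_cinner (x - p) (e j) = 0" if j: "j < n" for j
  proof -
    have "L2_cinner p (e j) = (\<Sum>i<n. L2_cinner x (e i) / L2_cinner (e i) (e i) * L2_cinner (e i) (e j))"
      unfolding p_def L2_cinner_sum_left L2_cinner_scaleC_left ..
    also have "\<dots> = (\<Sum>i<n. if i = j then L2_cinner x (e j) else 0)"
      using e0 orth j by (intro sum.cong) (auto simp: L2_cinner_self_eq_0)
    also have "\<dots> = L2_cinner x (e j)" using j by simp
    finally show ?thesis by (simp add: L2_cinner_diff_left)
  qed
  then have px: "L2_cinner (e j) (x - p) = 0" if "j < n" for j
    using that by (metis L2_cinner_commute complex_cnj_zero)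
  define e' where "e' = e(n := x - p)"
  have card: "card (insert x C) = Suc n" using insert.hyps by (simp add: n_def)
  have img: "e' ` {..<Suc n} = insert (x - p) (e ` {..<n})"
    by (auto simp: e'_def lessThan_Suc)
  have "L2.span (insert (x - p) (e ` {..<n})) = L2.span (insert x C)"
    unfolding L2.span_eq
  proof
    have sub: "L2.span C \<subseteq> L2.span (insert x C)" by (intro L2.span_mono) auto
    have "x - p \<in> L2.span (insert x C)"
      by (rule L2.span_diff[OF L2.span_base subsetD[OF sub pC]]) simp
    moreover have "e ` {..<n} \<subseteq> L2.span (insert x C)"
      using L2.span_superset[of "e ` {..<n}"] sp sub by blast
    ultimately show "insert (x - p) (e ` {..<n}) \<subseteq> L2.span (insert x C)" by simp
    have sub': "L2.span C \<subseteq> L2.span (insert (x - p) (e ` {..<n}))"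
      unfolding sp[symmetric] by (intro L2.span_mono) auto
    have "(x - p) + p \<in> L2.span (insert (x - p) (e ` {..<n}))"
      by (rule L2.span_add[OF L2.span_base subsetD[OF sub' pC]]) simp
    then show "insert x C \<subseteq> L2.span (insert (x - p) (e ` {..<n}))"
      using sub' L2.span_superset[of C] by auto
  qed
  then have "L2.span (e' ` {..<Suc n}) = L2.span (insert x C)" by (simp only: img)
  moreover have "\<forall>i<Suc n. e' i \<noteq> 0" using e0 \<open>x - p \<noteq> 0\<close> by (auto simp: e'_def less_Suc_eq)
  moreover have "\<forall>i<Suc n. \<forall>j<Suc n. i \<noteq> j \<longrightarrow> L2_cinner (e' i) (e' j) = 0"
    using orth xp px by (auto simp: e'_def less_Suc_eq)
  ultimately show ?case unfolding card by blast
qed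

text \<open>
  The identity of a finite-dimensional space as a sum of rank one operators on all of \<open>L\<^sup>2\<close>, with
  \<open>u\<^sub>i = e\<^sub>i / |e\<^sub>i|\<^sup>2\<close>. Its sum is the finite rank projection onto the space, and its terms cut an operator with
  that range into rank one pieces.
\<close>

lemma rank_one_resolution:
  assumes C: "finite C" "L2.independent C"
  shows "\<exists>e u :: nat \<Rightarrow> L2R. (\<forall>i<card C. e i \<in> L2.span C \<and> e i \<noteq> 0 \<and> L2_cinner (e i) (u i) = 1) \<and>
      (\<forall>f\<in>L2.span C. (\<Sum>i<card C. blinfun_apply (rank_one (u i) (e i)) f) = f)"
proof -
  define n where "n = card C"
  obtain e :: "nat \<Rightarrow> L2R" where e: "\<forall>i<n. e i \<noteq> 0"
      "\<forall>i<n. \<forall>j<n. i \<noteq> j \<longrightarrow> L2_cinner (e i) (e j) = 0"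
    and sp: "L2.span (e ` {..<n}) = L2.span C"
    using orthogonal_basis_exists[OF C] unfolding n_def[symmetric] by (elim exE conjE)
  have e0: "e i \<noteq> 0" if "i < n" for i using e(1) that by simp
  have orth: "L2_cinner (e i) (e j) = 0" if "i < n" "j < n" "i \<noteq> j" for i j using e(2) that by simp
  define u where "u i = L2_scaleC (cnj (1 / L2_cinner (e i) (e i))) (e i)" for i
  have u: "L2_cinner f (u i) = L2_cinner f (e i) / L2_cinner (e i) (e i)" for f i
    unfolding u_def L2_cinner_scaleC_right complex_cnj_cnj by simp
  have eC: "e i \<in> L2.span C" if "i < n" for i
    using that L2.span_superset[of "e ` {..<n}"] sp by blast
  have exp: "(\<Sum>i<n. L2_scaleC (L2_cinner f (u i)) (e i)) = f" if f: "f \<in> L2.span C" for f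
  proof -
    let ?p = "\<Sum>i<n. L2_scaleC (L2_cinner f (u i)) (e i)"
    have "L2_cinner (f - ?p) (e j) = 0" if j: "j < n" for j
    proof -
      have "L2_cinner ?p (e j) = (\<Sum>i<n. L2_cinner f (e i) / L2_cinner (e i) (e i) * L2_cinner (e i) (e j))"
        unfolding L2_cinner_sum_left L2_cinner_scaleC_left u ..
      also have "\<dots> = (\<Sum>i<n. if i = j then L2_cinner f (e j) else 0)"
        using e0 orth j by (intro sum.cong) (auto simp: L2_cinner_self_eq_0)
      also have "\<dots> = L2_cinner f (e j)" using j by simp
      finally show ?thesis by (simp add: L2_cinner_diff_left)
    qed
    then have *: "L2_cinner (f - ?p) b = 0" if "b \<in> e ` {..<n}" for b using that by auto
    have "f - ?p \<in> L2.span (e ` {..<n})"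
      using f eC unfolding sp by (intro L2.span_diff L2.span_sum L2.span_scale) auto
    then have "L2_cinner (f - ?p) (f - ?p) = 0"
      by (rule L2_span_orthogonal[of "e ` {..<n}", rotated]) (rule *)
    then show ?thesis by (simp add: L2_cinner_self_eq_0)
  qed
  have "e i \<in> L2.span C \<and> e i \<noteq> 0 \<and> L2_cinner (e i) (u i) = 1" if "i < n" for i
    using eC[OF that] e0[OF that] by (simp add: u L2_cinner_self_eq_0)
  then show ?thesis
    unfolding n_def[symmetric] rank_one_apply using exp by (intro exI[of _ e] exI[of _ u]) simp
qed

section \<open>The ideal generated by the finite rank operators\<close>

lemmas P_plus_properties = orth_proj_properties[OF closed_L2_above subspace_L2_above, of 0, folded P_plus_def]
lemmas Q_plus_properties = orth_proj_properties[OF closed_H2 subspace_H2, folded Q_plus_def]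
lemmas P_plus_fixes = orth_proj_fixes[OF closed_L2_above subspace_L2_above, of _ 0, folded P_plus_def]
lemmas Q_plus_fixes = orth_proj_fixes[OF closed_H2 subspace_H2, folded Q_plus_def]

text \<open>
  \<open>P\<^sub>+ B(L\<^sup>2) (I - Q\<^sub>+)\<close> in terms of range and kernel; the name refers to its being cut out of
  \<open>B(L\<^sup>2)\<close> by a projection on either side.
\<close>

definition corner :: "(L2R \<Rightarrow>\<^sub>L L2R) set" where
  "corner = {T \<in> BL2. (\<forall>f. blinfun_apply T f \<in> L2_above 0) \<and> (\<forall>f\<in>H2. blinfun_apply T f = 0)}"

lemma corner_eq: "{P_plus o\<^sub>L T o\<^sub>L (id_blinfun - Q_plus) | T. T \<in> BL2} = corner"
proof
  show "{P_plus o\<^sub>L T o\<^sub>L (id_blinfun - Q_plus) | T. T \<in> BL2} \<subseteq> corner"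
  proof clarify
    fix T assume T: "T \<in> BL2"
    have "P_plus o\<^sub>L T o\<^sub>L (id_blinfun - Q_plus) \<in> BL2"
      by (intro BL2_compose BL2_diff BL2_id P_plus_properties(3) Q_plus_properties(3) T)
    then show "P_plus o\<^sub>L T o\<^sub>L (id_blinfun - Q_plus) \<in> corner"
      using P_plus_properties(1) Q_plus_fixes by (simp add: corner_def blinfun.diff_left)
  qed
  show "corner \<subseteq> {P_plus o\<^sub>L T o\<^sub>L (id_blinfun - Q_plus) | T. T \<in> BL2}"
  proof
    fix T assume T: "T \<in> corner"
    have "T = P_plus o\<^sub>L T o\<^sub>L (id_blinfun - Q_plus)"
    proof (rule blinfun_eqI)
      fix f
      have "blinfun_apply T (blinfun_apply Q_plus f) = 0" "blinfun_apply T f \<in> L2_above 0"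
        using T Q_plus_properties(1) by (auto simp: corner_def)
      then show "blinfun_apply T f = blinfun_apply (P_plus o\<^sub>L T o\<^sub>L (id_blinfun - Q_plus)) f"
        by (simp add: blinfun.diff_left blinfun.diff_right P_plus_fixes)
    qed
    then show "T \<in> {P_plus o\<^sub>L T o\<^sub>L (id_blinfun - Q_plus) | T. T \<in> BL2}"
      using T unfolding corner_def by blast
  qed
qed

lemma Alg_binestD:
  assumes "T \<in> Alg binest"
  shows "T \<in> BL2" "0 \<le> \<alpha> \<Longrightarrow> f \<in> L2_above (- \<alpha>) \<Longrightarrow> blinfun_apply T f \<in> L2_above (- \<alpha>)"
    "f \<in> H2 \<Longrightarrow> blinfun_apply T f \<in> H2"
proof -
  have T: "T \<in> BL2" "\<And>M. M \<in> binest \<Longrightarrow> blinfun_apply T ` M \<subseteq> M" using assms by (auto simp: Alg_def)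
  show "T \<in> BL2" by (rule T)
  show "blinfun_apply T f \<in> L2_above (- \<alpha>)" if "0 \<le> \<alpha>" "f \<in> L2_above (- \<alpha>)"
  proof -
    have "L2_above (- \<alpha>) \<in> binest" unfolding binest_def using that(1) by blast
    from T(2)[OF this] show ?thesis using that(2) by blast
  qed
  have "modulation 0 ` H2 = H2" by (simp add: modulation_0)
  then have "H2 \<in> {modulation \<beta> ` H2 | \<beta>. 0 \<le> \<beta>}" by (metis (mono_tags, lifting) mem_Collect_eq order_refl)
  then have "H2 \<in> binest" unfolding binest_def by blast
  from T(2)[OF this] show "blinfun_apply T f \<in> H2" if "f \<in> H2" using that by blast
qed

lemma corner_subset_Alg: "corner \<subseteq> Alg binest"
proof
  fix T assume T: "T \<in> corner"
  have "blinfun_apply T ` M \<subseteq> M" if "M \<in> binest" for M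
  proof -
    from that consider "M \<in> {{0}}" | "M \<in> {L2_above (- \<alpha>) | \<alpha>. 0 \<le> \<alpha>}"
      | "M \<in> {modulation \<beta> ` H2 | \<beta>. 0 \<le> \<beta>}" | "M \<in> {UNIV}"
      unfolding binest_def by (elim UnE)
    then show ?thesis
    proof cases
      case 1
      then show ?thesis by simp
    next
      case 2
      then obtain \<alpha> where 2: "M = L2_above (- \<alpha>)" "0 \<le> \<alpha>" by (elim CollectE exE conjE)
      have "blinfun_apply T f \<in> L2_above (- \<alpha>)" for f
        using T L2_above_antimono[of "- \<alpha>" 0] 2(2) unfolding corner_def by (simp add: subsetD)
      then show ?thesis unfolding 2(1) by blast
    next
      case 3
      then obtain \<beta> where 3: "M = modulation \<beta> ` H2" "0 \<le> \<beta>" by (elim CollectE exE conjE)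
      have "modulation \<beta> 0 = 0" using modulation_diff[of \<beta> 0 0] by simp
      then have "0 \<in> modulation \<beta> ` H2"
        using L2_subspaceD(1)[OF subspace_H2] by (metis imageI)
      moreover have "blinfun_apply T f = 0" if "f \<in> modulation \<beta> ` H2" for f
      proof -
        have "f \<in> H2" using that modulation_H2[OF 3(2)] by blast
        then show ?thesis using T by (simp add: corner_def)
      qed
      ultimately show ?thesis unfolding 3(1) by (metis image_subsetI)
    qed simp
  qed
  then show "T \<in> Alg binest" using T by (simp add: Alg_def corner_def)
qed

lemma two_sided_ideal_corner: "two_sided_ideal (Alg binest) corner"
  unfolding two_sided_ideal_def
proof (intro conjI ballI allI corner_subset_Alg)
  note A = L2_subspaceD[OF subspace_L2_above[of 0]]
  show "0 \<in> corner" using A(1) by (simp add: corner_def BL2_zero)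
  show "S + T \<in> corner" if "S \<in> corner" "T \<in> corner" for S T
    using that A(2) by (simp add: corner_def BL2_add blinfun.add_left)
  show "scalar_op c o\<^sub>L S \<in> corner" if "S \<in> corner" for c S
    using that A(3) by (simp add: corner_def BL2_compose BL2_scalar_op scalar_op.rep_eq)
  show "T o\<^sub>L S \<in> corner" if "T \<in> Alg binest" "S \<in> corner" for T S
    using that Alg_binestD(1)[of T] Alg_binestD(2)[of T 0] by (simp add: corner_def BL2_compose)
  show "S o\<^sub>L T \<in> corner" if "T \<in> Alg binest" "S \<in> corner" for T S
    using that Alg_binestD(1,3)[of T] by (simp add: corner_def BL2_compose)
qed

lemma topspace_WOT: "topspace weak_operator_topology = BL2"
  by (simp add: weak_operator_topology_def topspace_pullback_topology)

lemma mem_if_orthogonal_to_complement: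
  assumes "closed M" "L2.subspace M"
    and "\<And>g. (\<And>h. h \<in> M \<Longrightarrow> L2_cinner h g = 0) \<Longrightarrow> L2_cinner f g = 0"
  shows "f \<in> M"
proof -
  obtain p where p: "p \<in> M" "\<And>g. g \<in> M \<Longrightarrow> L2_cinner (f - p) g = 0"
    using L2_projection_ex[OF assms(1,2)] by blast
  have *: "L2_cinner h (f - p) = 0" if "h \<in> M" for h
    using p(2)[OF that] by (metis L2_cinner_commute complex_cnj_zero)
  have "L2_cinner (f - p) (f - p) = 0"
    unfolding L2_cinner_diff_left[of f p] using assms(3)[OF *] *[OF p(1)] by simp
  then show ?thesis using p(1) by (simp add: L2_cinner_self_eq_0)
qed

text \<open>
  Both conditions say that certain matrix coefficients \<open>\<langle>T f, g\<rangle>\<close> vanish: those with \<open>f \<in> H\<^sup>2\<close>, and those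
  with \<open>g\<close> orthogonal to \<open>L\<^sup>2(0,\<infinity>)\<close>.
\<close>

lemma closedin_corner: "closedin weak_operator_topology corner"
proof -
  let ?\<phi> = "\<lambda>T (f, g). L2_cinner (blinfun_apply T f) g"
  define N where "N = {g. \<forall>h\<in>L2_above 0. L2_cinner h g = 0}"
  define Z where "Z = {\<psi> :: L2R \<times> L2R \<Rightarrow> complex. \<forall>p\<in>H2 \<times> UNIV \<union> UNIV \<times> N. \<psi> p = 0}"
  have "Z = (\<Inter>p\<in>H2 \<times> UNIV \<union> UNIV \<times> N. {\<psi>. \<psi> p = 0})" by (auto simp: Z_def)
  moreover have "closed {\<psi> :: L2R \<times> L2R \<Rightarrow> complex. \<psi> p = 0}" for p
    by (intro closed_Collect_eq continuous_on_product_coordinates continuous_on_const)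
  ultimately have "closed Z" by auto
  have mem: "T \<in> corner \<longleftrightarrow> ?\<phi> T \<in> Z" if "T \<in> BL2" for T
  proof
    assume "T \<in> corner"
    then show "?\<phi> T \<in> Z" by (auto simp: corner_def Z_def N_def)
  next
    assume Z: "?\<phi> T \<in> Z"
    have "blinfun_apply T f = 0" if "f \<in> H2" for f
    proof -
      have "?\<phi> T (f, blinfun_apply T f) = 0" using Z that unfolding Z_def by blast
      then show ?thesis by (simp add: L2_cinner_self_eq_0)
    qed
    moreover have "blinfun_apply T f \<in> L2_above 0" for f
    proof (rule mem_if_orthogonal_to_complement[OF closed_L2_above subspace_L2_above])
      fix g assume "\<And>h. h \<in> L2_above 0 \<Longrightarrow> L2_cinner h g = 0"
      then have "g \<in> N" by (simp add: N_def)
      then have "?\<phi> T (f, g) = 0" using Z unfolding Z_def by blast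
      then show "L2_cinner (blinfun_apply T f) g = 0" by simp
    qed
    ultimately show "T \<in> corner" using \<open>T \<in> BL2\<close> by (simp add: corner_def)
  qed
  have "BL2 - corner = ?\<phi> -` (- Z) \<inter> BL2" using mem by auto
  then have "openin weak_operator_topology (BL2 - corner)"
    unfolding weak_operator_topology_def openin_pullback_topology
    using \<open>closed Z\<close> by (metis open_Compl open_openin)
  then show ?thesis
    unfolding closedin_def topspace_WOT by (auto simp: corner_def)
qed

lemma open_fun_finite_coordinates:
  fixes U :: "('a \<Rightarrow> 'b::topological_space) set"
  assumes "open U" "\<phi> \<in> U"
  shows "\<exists>I. finite I \<and> (\<forall>\<psi>. (\<forall>i\<in>I. \<psi> i = \<phi> i) \<longrightarrow> \<psi> \<in> U)"
proof -
  have "openin (product_topology (\<lambda>i. euclidean) UNIV) U" using assms(1) unfolding open_fun_def .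
  from product_topology_open_contains_basis[OF this assms(2)]
  obtain X where X: "\<phi> \<in> (\<Pi>\<^sub>E i\<in>UNIV. X i)" "finite {i. X i \<noteq> topspace euclidean}" "(\<Pi>\<^sub>E i\<in>UNIV. X i) \<subseteq> U"
    by blast
  show ?thesis
  proof (intro exI conjI allI impI, rule X(2))
    fix \<psi> assume eq: "\<forall>i\<in>{i. X i \<noteq> topspace euclidean}. \<psi> i = \<phi> i"
    have "\<psi> i \<in> X i" for i
    proof (cases "X i = topspace euclidean")
      case False
      then show ?thesis using eq X(1) by (simp add: PiE_iff)
    qed simp
    then have "\<psi> \<in> (\<Pi>\<^sub>E i\<in>UNIV. X i)" by (simp add: PiE_iff)
    then show "\<psi> \<in> U" using X(3) by blast
  qed
qed

text \<open>
  A weak neighbourhood of \<open>T\<close> constrains only finitely many pairs \<open>(f, g)\<close>, so an operator that agrees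
  with \<open>T\<close> on finitely many vectors lies in it.
\<close>

lemma WOT_closed_mem:
  assumes J: "closedin weak_operator_topology J" and T: "T \<in> BL2"
    and approx: "\<And>A. finite A \<Longrightarrow> \<exists>S\<in>J. \<forall>f\<in>A. blinfun_apply S f = blinfun_apply T f"
  shows "T \<in> J"
proof (rule ccontr)
  assume "T \<notin> J"
  let ?\<phi> = "\<lambda>T (f, g). L2_cinner (blinfun_apply T f) g"
  have JB: "J \<subseteq> BL2" and op: "openin weak_operator_topology (BL2 - J)"
    using J by (auto simp: closedin_def topspace_WOT)
  from op have "\<exists>U. openin euclidean U \<and> BL2 - J = ?\<phi> -` U \<inter> BL2"
    unfolding weak_operator_topology_def openin_pullback_topology .
  then obtain U where oU: "openin euclidean U" and UJ: "BL2 - J = ?\<phi> -` U \<inter> BL2"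
    by (elim exE conjE)
  have U: "open U" by (rule iffD2[OF open_openin oU])
  have "T \<in> BL2 - J" using \<open>T \<notin> J\<close> T by simp
  then have "T \<in> ?\<phi> -` U" unfolding UJ by (rule IntD1)
  then have TU: "?\<phi> T \<in> U" by (rule vimageD)
  obtain I where I: "finite I" "\<forall>\<psi>. (\<forall>i\<in>I. \<psi> i = ?\<phi> T i) \<longrightarrow> \<psi> \<in> U"
    using open_fun_finite_coordinates[OF U TU] by (elim exE conjE)
  obtain S where S: "S \<in> J" "\<forall>f\<in>fst ` I. blinfun_apply S f = blinfun_apply T f"
    using approx[OF finite_imageI[OF I(1)]] by blast
  have "?\<phi> S \<in> U"
  proof (rule I(2)[rule_format])
    fix i assume i: "i \<in> I"
    obtain f g where fg: "i = (f, g)" by (cases i)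
    have "blinfun_apply S f = blinfun_apply T f" using S(2) i unfolding fg by (metis fst_conv imageI)
    then show "?\<phi> S i = ?\<phi> T i" by (simp add: fg)
  qed
  then have "S \<in> ?\<phi> -` U \<inter> BL2" using S(1) JB by (intro IntI vimageI2) auto
  then have "S \<in> BL2 - J" unfolding UJ .
  with S(1) show False by simp
qed

text \<open>
  Composing with \<open>I - Q\<^sub>+\<close> before the finite rank projection \<open>F\<close> keeps \<open>H\<^sup>2\<close> in the kernel; projecting onto
  the span of the given vectors themselves would not.
\<close>

lemma finite_rank_approximation:
  assumes T: "T \<in> corner" and A: "finite A"
  shows "\<exists>S\<in>corner. finite_rank S \<and> (\<forall>f\<in>A. blinfun_apply S f = blinfun_apply T f)"
proof -
  let ?K = "id_blinfun - Q_plus"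
  have K: "?K \<in> BL2" by (intro BL2_diff BL2_id Q_plus_properties(3))
  obtain C where C: "C \<subseteq> blinfun_apply ?K ` A" "L2.independent C" "blinfun_apply ?K ` A \<subseteq> L2.span C"
    using L2.maximal_independent_subset by blast
  have finC: "finite C" using C(1) A by (meson finite_imageI finite_subset)
  obtain e u :: "nat \<Rightarrow> L2R" where eu: "\<forall>i<card C. e i \<in> L2.span C \<and> e i \<noteq> 0 \<and> L2_cinner (e i) (u i) = 1"
    and exp: "\<forall>f\<in>L2.span C. (\<Sum>i<card C. blinfun_apply (rank_one (u i) (e i)) f) = f"
    using rank_one_resolution[OF finC C(2)] by (elim exE conjE)
  have e: "e i \<in> L2.span C" if "i < card C" for i using eu that by simp
  define F where "F = (\<Sum>i<card C. rank_one (u i) (e i))"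
  have F_apply: "blinfun_apply F f = (\<Sum>i<card C. blinfun_apply (rank_one (u i) (e i)) f)" for f
    by (simp add: F_def blinfun.sum_left)
  have F: "F \<in> BL2" unfolding F_def by (intro BL2_sum BL2_rank_one)
  have FC: "blinfun_apply F f \<in> L2.span C" for f
    unfolding F_apply rank_one_apply using e by (intro L2.span_sum L2.span_scale) auto
  let ?S = "T o\<^sub>L F o\<^sub>L ?K"
  have TB: "T \<in> BL2" using T by (simp add: corner_def)
  have "?S \<in> corner"
  proof -
    have "blinfun_apply ?K f = 0" if "f \<in> H2" for f
      using that by (simp add: blinfun.diff_left Q_plus_fixes)
    then show ?thesis using T F K by (auto simp: corner_def intro!: BL2_compose)
  qed
  moreover have "finite_rank ?S"
  proof -
    have "range (blinfun_apply ?S) \<subseteq> blinfun_apply T ` L2.span C" using FC by auto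
    also have "\<dots> \<subseteq> L2.span (blinfun_apply T ` C)" by (rule span_image_BL2[OF TB])
    finally show ?thesis unfolding finite_rank_def using finC by blast
  qed
  moreover have "blinfun_apply ?S f = blinfun_apply T f" if "f \<in> A" for f
  proof -
    have "blinfun_apply ?K f \<in> L2.span C" using C(3) that by blast
    then have FK: "blinfun_apply F (blinfun_apply ?K f) = blinfun_apply ?K f" using exp unfolding F_apply by (rule bspec[rotated])
    have "blinfun_apply T (blinfun_apply Q_plus f) = 0"
      using T Q_plus_properties(1) by (simp add: corner_def)
    moreover have "blinfun_apply ?S f = blinfun_apply T (blinfun_apply F (blinfun_apply ?K f))" by simp
    ultimately show ?thesis by (simp only: FK) (simp add: blinfun.diff_left blinfun.diff_right)
  qed
  ultimately show ?thesis by blast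
qed

text \<open>
  Instead of dimensions, the proof maximises the size of an independent set \<open>C\<close> contained in some
  \<open>V n = T L\<^sup>2(-n,\<infinity>)\<close>. As the \<open>V n\<close> form a chain, a maximal \<open>C \<subseteq> V N\<close> spans all of them.
\<close>

lemma finite_rank_range_in_half_line:
  assumes T: "T \<in> Alg binest" and fr: "finite_rank T"
  shows "\<exists>a. \<forall>f. blinfun_apply T f \<in> L2_above a"
proof -
  note TB = Alg_binestD(1)[OF T]
  obtain B where B: "finite B" "range (blinfun_apply T) \<subseteq> L2.span B" using fr by (auto simp: finite_rank_def)
  define V where "V n = blinfun_apply T ` L2_above (- real n)" for n
  have Vsub: "L2.subspace (V n)" for n
    unfolding V_def using subspace_L2_above by (intro subspace_image_BL2 TB)
  have Vmono: "V m \<subseteq> V n" if "m \<le> n" for m n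
    unfolding V_def using that by (intro image_mono L2_above_antimono) simp
  have Vabove: "V n \<subseteq> L2_above (- real n)" for n
    unfolding V_def using Alg_binestD(2)[OF T, of "real n"] by auto
  let ?P = "\<lambda>C. L2.independent C \<and> (\<exists>n. C \<subseteq> V n)"
  have bound: "finite C \<and> card C \<le> card B" if "?P C" for C
  proof (rule L2.independent_span_bound[OF B(1)])
    show "L2.independent C" using that by blast
    have "V n \<subseteq> L2.span B" for n using B(2) unfolding V_def by blast
    then show "C \<subseteq> L2.span B" using that by blast
  qed
  have "?P {}" by (simp add: L2.independent_empty)
  moreover have "\<forall>D. ?P D \<longrightarrow> card D < Suc (card B)"
    by (intro allI impI le_imp_less_Suc conjunct2[OF bound])
  ultimately have "\<exists>C. ?P C \<and> (\<forall>D. ?P D \<longrightarrow> card D \<le> card C)"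
    by (rule ex_has_greatest_nat)
  then obtain C where C: "?P C" and maxC: "\<forall>D. ?P D \<longrightarrow> card D \<le> card C"
    by (rule exE) (rule that; erule conjunct1 conjunct2)
  obtain N where N: "C \<subseteq> V N" using conjunct2[OF C] by (elim exE)
  have "V m \<subseteq> L2.span C" for m
  proof
    fix x assume x: "x \<in> V m"
    show "x \<in> L2.span C"
    proof (rule ccontr)
      assume nx: "x \<notin> L2.span C"
      then have "x \<notin> C" using L2.span_base by blast
      have sub: "insert x C \<subseteq> V (max m N)" using x N Vmono[of m "max m N"] Vmono[of N "max m N"] by auto
      have "L2.independent (insert x C)" using conjunct1[OF C] nx by (intro L2.independent_insertI) auto
      with sub have "card (insert x C) \<le> card C" using maxC by (metis (no_types, lifting))
      then show False using \<open>x \<notin> C\<close> bound[OF C] by simp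
    qed
  qed
  moreover have "L2.span C \<subseteq> V N" using N Vsub by (intro L2.span_minimal)
  ultimately have VN: "V m \<subseteq> L2_above (- real N)" for m using Vabove[of N] by blast
  have "blinfun_apply T f \<in> L2_above (- real N)" for f
  proof (rule closed_sequentially[OF closed_L2_above])
    show "blinfun_apply T (cutoff (- real n) f) \<in> L2_above (- real N)" for n
      using VN[of n] cutoff_in_L2_above by (auto simp: V_def)
    show "(\<lambda>n. blinfun_apply T (cutoff (- real n) f)) \<longlonglongrightarrow> blinfun_apply T f"
      by (intro tendsto_intros cutoff_tendsto)
  qed
  then show ?thesis by blast
qed

text \<open>
  With the range in a half line, \<open>T H\<^sup>2 \<subseteq> H\<^sup>2 \<inter> L\<^sup>2(a,\<infinity>) = 0\<close>; then the closed subspace of all \<open>f\<close> with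
  \<open>T f \<in> L\<^sup>2(0,\<infinity>)\<close> contains \<open>H\<^sup>2 + L\<^sup>2(0,\<infinity>)\<close>, which is dense.
\<close>

lemma finite_rank_mem_corner:
  assumes T: "T \<in> Alg binest" and fr: "finite_rank T"
  shows "T \<in> corner"
proof -
  note TB = Alg_binestD(1)[OF T]
  obtain a where a: "\<And>f. blinfun_apply T f \<in> L2_above a"
    using finite_rank_range_in_half_line[OF assms] by blast
  have H: "blinfun_apply T f = 0" if "f \<in> H2" for f
    using H2_Int_L2_above[of a] a[of f] Alg_binestD(3)[OF T that] by blast
  note A0 = L2_subspaceD[OF subspace_L2_above[of 0]]
  let ?K = "{f. blinfun_apply T f \<in> L2_above 0}"
  have "?K = UNIV"
  proof (rule eq_UNIV_if_orthogonal_trivial)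
    have "closed (blinfun_apply T -` L2_above 0)"
      by (rule closed_vimage[OF closed_L2_above]) (intro continuous_intros)
    then show "closed ?K" by (simp add: vimage_def)
    show "L2.subspace ?K"
      unfolding L2.subspace_def using A0 by (simp add: blinfun.add_right BL2_scaleC[OF TB])
    show "g = 0" if g: "\<And>f. f \<in> ?K \<Longrightarrow> L2_cinner g f = 0" for g
    proof (rule orthogonal_H2_L2_above_trivial)
      show "L2_cinner g h = 0" if "h \<in> H2" for h using H[OF that] A0(1) by (intro g) simp
      show "L2_cinner g h = 0" if "h \<in> L2_above 0" for h
        using Alg_binestD(2)[OF T, of 0 h] that by (intro g) simp
    qed
  qed
  then show ?thesis using TB H by (auto simp: corner_def)
qed

lemma wot_closed_ideal_eq_corner:
  "wot_closed_ideal_generated (Alg binest) {T \<in> Alg binest. finite_rank T} = corner"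
  unfolding wot_closed_ideal_generated_def
proof (rule hull_unique)
  show "{T \<in> Alg binest. finite_rank T} \<subseteq> corner" using finite_rank_mem_corner by blast
  show "two_sided_ideal (Alg binest) corner \<and> closedin weak_operator_topology corner"
    using two_sided_ideal_corner closedin_corner by blast
  fix J assume J: "{T \<in> Alg binest. finite_rank T} \<subseteq> J"
    "two_sided_ideal (Alg binest) J \<and> closedin weak_operator_topology J"
  show "corner \<subseteq> J"
  proof
    fix T assume T: "T \<in> corner"
    show "T \<in> J"
    proof (rule WOT_closed_mem)
      show "closedin weak_operator_topology J" using J(2) by blast
      show "T \<in> BL2" using T by (simp add: corner_def)
      show "\<exists>S\<in>J. \<forall>f\<in>A. blinfun_apply S f = blinfun_apply T f" if "finite A" for A
        using finite_rank_approximation[OF T that] J(1) corner_subset_Alg by blast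
    qed
  qed
qed

text \<open>
  The pieces \<open>f \<mapsto> \<langle>T f, u\<^sub>i\<rangle> e\<^sub>i\<close> inherit the kernel of \<open>T\<close>, and \<open>e\<^sub>i\<close> is itself a value of \<open>T\<close>; the latter also
  shows that no piece is zero.
\<close>

lemma rank_one_decomposition:
  assumes T: "T \<in> corner" and rk: "has_rank T n"
  shows "\<exists>R. (\<forall>i<n. R i \<in> corner \<and> has_rank (R i) 1) \<and> T = (\<Sum>i<n. R i)"
proof -
  have TB: "T \<in> BL2" using T by (simp add: corner_def)
  obtain B where B: "finite B" "range (blinfun_apply T) \<subseteq> L2.span B"
    using rk by (auto simp: has_rank_def finite_rank_def)
  obtain C where C: "C \<subseteq> range (blinfun_apply T)" "L2.independent C" "range (blinfun_apply T) \<subseteq> L2.span C"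
    and card: "card C = n"
    using L2.basis_exists[of "range (blinfun_apply T)"] rk by (metis has_rank_def)
  have finC: "finite C" using L2.independent_span_bound[OF B(1) C(2)] C(1) B(2) by blast
  have "L2.span C \<subseteq> range (blinfun_apply T)"
    by (rule L2.span_minimal[OF C(1) subspace_image_BL2[OF TB L2.subspace_UNIV]])
  then have sp: "L2.span C = range (blinfun_apply T)" using C(3) by blast
  obtain e u :: "nat \<Rightarrow> L2R"
    where eu': "\<forall>i<n. e i \<in> range (blinfun_apply T) \<and> e i \<noteq> 0 \<and> L2_cinner (e i) (u i) = 1"
      and exp: "\<forall>f\<in>range (blinfun_apply T). (\<Sum>i<n. blinfun_apply (rank_one (u i) (e i)) f) = f"
    using rank_one_resolution[OF finC C(2)] unfolding card sp by (elim exE conjE)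
  have e: "e i \<in> range (blinfun_apply T)" and e0: "e i \<noteq> 0" and eu: "L2_cinner (e i) (u i) = 1" if "i < n" for i
    using eu' that by simp_all
  define R where "R i = rank_one (u i) (e i) o\<^sub>L T" for i
  have R_apply: "blinfun_apply (R i) f = L2_scaleC (L2_cinner (blinfun_apply T f) (u i)) (e i)" for i f
    by (simp add: R_def rank_one_apply)
  have "R i \<in> corner" if "i < n" for i
  proof -
    have "e i \<in> L2_above 0" using e[OF that] T by (auto simp: corner_def)
    then show ?thesis
      using T L2_subspaceD(3)[OF subspace_L2_above]
      by (simp add: corner_def R_apply) (simp add: R_def BL2_compose BL2_rank_one)
  qed
  moreover have "has_rank (R i) 1" if i: "i < n" for i
  proof -
    obtain g where g: "e i = blinfun_apply T g" using e[OF i] by blast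
    have sub: "range (blinfun_apply (R i)) \<subseteq> L2.span {e i}"
    proof clarify
      have "e i \<in> L2.span {e i}" by (rule L2.span_base) simp
      then show "blinfun_apply (R i) f \<in> L2.span {e i}" for f
        unfolding R_apply by (rule L2.span_scale)
    qed
    have "blinfun_apply (R i) g = e i" using eu[OF i] by (simp add: R_apply flip: g)
    then have "{e i} \<subseteq> L2.span (range (blinfun_apply (R i)))"
      by (metis L2.span_base empty_subsetI insert_subset rangeI)
    then have "L2.span {e i} = L2.span (range (blinfun_apply (R i)))"
      using sub unfolding L2.span_eq by blast
    then have "L2.dim (range (blinfun_apply (R i))) = card {e i}"
      using e0[OF i] by (intro L2.dim_eq_card) auto
    then show ?thesis using sub unfolding has_rank_def finite_rank_def by auto
  qed
  moreover have "T = (\<Sum>i<n. R i)"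
  proof (rule blinfun_eqI)
    fix f
    show "blinfun_apply T f = blinfun_apply (\<Sum>i<n. R i) f"
      using exp by (simp add: blinfun.sum_left R_apply rank_one_apply)
  qed
  ultimately show ?thesis by blast
qed

theorem proposition4p1:
  shows "wot_closed_ideal_generated (Alg binest) {T \<in> Alg binest. finite_rank T} =
           {P_plus o\<^sub>L T o\<^sub>L (id_blinfun - Q_plus) | T. T \<in> BL2}
       \<and> (\<forall>(n::nat). \<forall>T\<in>Alg binest. has_rank T n \<longrightarrow>
           (\<exists>R. (\<forall>i<n. R i \<in> Alg binest \<and> has_rank (R i) 1) \<and> T = (\<Sum>i<n. R i)))"
proof (intro conjI allI ballI impI)
  show "wot_closed_ideal_generated (Alg binest) {T \<in> Alg binest. finite_rank T} =
           {P_plus o\<^sub>L T o\<^sub>L (id_blinfun - Q_plus) | T. T \<in> BL2}"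
    unfolding corner_eq by (rule wot_closed_ideal_eq_corner)
  fix n T assume T: "T \<in> Alg binest" and rk: "has_rank T n"
  then have "T \<in> corner" using finite_rank_mem_corner by (simp add: has_rank_def)
  from rank_one_decomposition[OF this rk]
  show "\<exists>R. (\<forall>i<n. R i \<in> Alg binest \<and> has_rank (R i) 1) \<and> T = (\<Sum>i<n. R i)"
    using corner_subset_Alg by blast
qed

end
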